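(* Let $0<\alpha<\frac12$. Let $\mathcal{F}_1$ and $\mathcal{F}_2$ be convex parameter spaces with $\mathcal{F}_1\cap\mathcal{F}_2\ne\varnothing$ and let $\mathcal{F}=\mathcal{F}_1\cup\mathcal{F}_2$. Let $CI^*_{j,\beta}$ ($j=1,2$, $0<\beta<1$) be the intervals defined in the context and let $CI^*_\alpha=CI^*_{1,\alpha/2}\cap CI^*_{2,\alpha/2}$. Then $CI^*_\alpha\in\mathcal{I}_{\alpha,\mathcal{F}}$ and, for both $j=1$ and $j=2$, $$L^*_\alpha(\mathcal{F}_j,\mathcal{F})\ \le\ L(CI^*_\alpha,\mathcal{F}_j)\ \le\ C(\alpha)\,L^*_\alpha(\mathcal{F}_j,\mathcal{F}),$$ where $C(\alpha)$ is a constant depending only on $\alpha$. Consequently $L(CI^*_\alpha,\mathcal{F}_j)\asymp\omega_+\big(\frac{z_{\alpha/2}}{\sqrt n},\mathcal{F}_j,\mathcal{F}\big)$.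
   Context: Model. One observes, for a given $n$, either the white noise model $dY(t)=f(t)\,dt+n^{-1/2}\,dW(t)$, $-\frac12\le t\le\frac12$, with $W$ standard Brownian motion, or the Gaussian sequence model $Y(i)=f(i)+n^{-1/2}z_i$, $i\in\mathcal{M}$, with $z_i$ i.i.d. standard normal and $\mathcal{M}$ a finite or countably infinite index set. The result is for either model. $P_f,E_f$ denote probability and expectation when $f$ is the truth. $\|\cdot\|_2$ is the $L_2(-\frac12,\frac12)$ norm, respectively the $\ell_2(\mathcal{M})$ norm. A parameter space is a (nonempty) set of possible $f$, and $T$ is a linear functional. Confidence intervals. A confidence interval $CI$ is a data-dependent interval, with length $L(CI)$ (an empty interval has length $0$). $\mathcal{I}_{\alpha,\mathcal{F}}$ is the collection of all confidence intervals with $\inf_{f\in\mathcal{F}}P_f(Tf\in CI)\ge1-\alpha$. $L(CI,\mathcal{G})=\sup_{f\in\mathcal{G}}E_f(L(CI))$ and $L_\alpha^*(\mathcal{G},\mathcal{F})=\inf_{CI\in\mathcal{I}_{\alpha,\mathcal{F}}}L(CI,\mathcal{G})$. Moduli. $\omega(\varepsilon,\mathcal{F},\mathcal{G})=\sup\{Tg-Tf:\|g-f\|_2\le\varepsilon,\ f\in\mathcal{F},\ g\in\mathcal{G}\}$ (ordered modulus) and $\omega_+(\varepsilon,\mathcal{F},\mathcal{G})=\max\{\omega(\varepsilon,\mathcal{F},\mathcal{G}),\omega(\varepsilon,\mathcal{G},\mathcal{F})\}$ (between class modulus). $z_\alpha=\Phi^{-1}(1-\alpha)$, with $\Phi$ the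 standard normal distribution function. Construction. A linear estimator has the form $c+\int h\,dY$, respectively $c+\sum_i h(i)Y(i)$, with $c$ constant and $h$ square integrable/summable. For $0<\beta<1$ and $1\le i,j\le2$ put $\omega_{i,j}=\omega(z_{\beta/2}/\sqrt n,\mathcal{F}_i,\mathcal{F}_j)$ and let $\hat T_{i,j}$ be a linear estimator (both depend on $\beta$) with $$\mathrm{Var}(\hat T_{i,j})\le\frac{\omega_{i,j}^2}{z_{\beta/2}^2},\quad \inf_{f\in\mathcal{F}_j}(E_f\hat T_{i,j}-Tf)\ge-\tfrac12\omega_{i,j},\quad \sup_{f\in\mathcal{F}_i}(E_f\hat T_{i,j}-Tf)\le\tfrac12\omega_{i,j}.$$ (Such estimators are known to exist, by earlier work.) For $j=1,2$ define $$CI^*_{j,\beta}=\Big[\min_{i=1,2}\{\hat T_{i,j}-\tfrac32\omega_{i,j}\},\ \max_{i=1,2}\{\hat T_{j,i}+\tfrac32\omega_{j,i}\}\Big].$$ $a_n\asymp b_n$ means $0<\liminf a_n/b_n\le\limsup a_n/b_n<\infty$ (here as $n\to\infty$). *)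

theory Defs
  imports "HOL-Probability.Probability" "HOL-Library.Function_Algebras"
begin

text \<open>Parameters are real-valued functions. The pointwise vector space structure makes
  the library notions \<^const>\<open>convex\<close> and \<^const>\<open>subspace\<close> available for sets of parameters.\<close>

instantiation "fun" :: (type, real_vector) real_vector
begin

definition scaleR_fun :: "real \<Rightarrow> ('a \<Rightarrow> 'b) \<Rightarrow> 'a \<Rightarrow> 'b" where
  "scaleR_fun c f = (\<lambda>x. c *\<^sub>R f x)"

instance
  by standard
    (simp_all add: scaleR_fun_def fun_eq_iff scaleR_add_right scaleR_add_left)

end

text \<open>The functional need only be defined, and linear, on a space of functions containing the
  parameter spaces (for instance, point evaluation on continuous functions).\<close>

definition linear_functional_on :: "('i \<Rightarrow> real) set \<Rightarrow> (('i \<Rightarrow> real) \<Rightarrow> real) \<Rightarrow> bool" where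
  "linear_functional_on V T \<longleftrightarrow>
     subspace V \<and>
     (\<forall>f\<in>V. \<forall>g\<in>V. T (f + g) = T f + T g) \<and>
     (\<forall>c. \<forall>f\<in>V. T (c *\<^sub>R f) = c * T f)"

definition normal_quantile :: "real \<Rightarrow> real" where
  "normal_quantile \<alpha> = inv (cdf std_normal_distribution) (1 - \<alpha>)"

section \<open>Confidence intervals\<close>

text \<open>In this section \<open>D\<close> is the measurable space of data and \<open>P f\<close> the law of the data when
  \<open>f\<close> is the truth. Intervals may be empty, unbounded, open or closed. Measurability of
  \<open>{y. t \<in> CI y}\<close> for all \<open>t\<close> also makes the length of \<open>CI\<close> measurable.\<close>

definition random_interval :: "'d measure \<Rightarrow> ('d \<Rightarrow> real set) \<Rightarrow> bool" where
  "random_interval D CI \<longleftrightarrow>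
     (\<forall>y\<in>space D. is_interval (CI y)) \<and> (\<forall>t. {y \<in> space D. t \<in> CI y} \<in> sets D)"

definition confidence_intervals ::
  "'d measure \<Rightarrow> ('p \<Rightarrow> 'd measure) \<Rightarrow> ('p \<Rightarrow> real) \<Rightarrow> real \<Rightarrow> 'p set \<Rightarrow> ('d \<Rightarrow> real set) set" where
  "confidence_intervals D P T \<alpha> F =
     {CI. random_interval D CI \<and>
          (INF f\<in>F. measure (P f) {y \<in> space (P f). T f \<in> CI y}) \<ge> 1 - \<alpha>}"

definition max_length :: "('p \<Rightarrow> 'd measure) \<Rightarrow> ('d \<Rightarrow> real set) \<Rightarrow> 'p set \<Rightarrow> ennreal" where
  "max_length P CI G = (SUP f\<in>G. \<integral>\<^sup>+ y. emeasure lborel (CI y) \<partial>P f)"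

definition min_max_length ::
  "'d measure \<Rightarrow> ('p \<Rightarrow> 'd measure) \<Rightarrow> ('p \<Rightarrow> real) \<Rightarrow> real \<Rightarrow> 'p set \<Rightarrow> 'p set \<Rightarrow> ennreal" where
  "min_max_length D P T \<alpha> G F = (INF CI\<in>confidence_intervals D P T \<alpha> F. max_length P CI G)"

section \<open>Moduli of continuity\<close>

text \<open>\<open>N\<close> is the relevant two-norm. Moduli may be infinite.\<close>

definition ordered_modulus ::
  "(('i \<Rightarrow> real) \<Rightarrow> real) \<Rightarrow> (('i \<Rightarrow> real) \<Rightarrow> real) \<Rightarrow> real \<Rightarrow> ('i \<Rightarrow> real) set \<Rightarrow> ('i \<Rightarrow> real) set \<Rightarrow> ereal"
  where
  "ordered_modulus N T \<epsilon> F G =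
     Sup {ereal (T g - T f) | f g. N (g - f) \<le> \<epsilon> \<and> f \<in> F \<and> g \<in> G}"

definition between_modulus ::
  "(('i \<Rightarrow> real) \<Rightarrow> real) \<Rightarrow> (('i \<Rightarrow> real) \<Rightarrow> real) \<Rightarrow> real \<Rightarrow> ('i \<Rightarrow> real) set \<Rightarrow> ('i \<Rightarrow> real) set \<Rightarrow> ereal"
  where
  "between_modulus N T \<epsilon> F G = max (ordered_modulus N T \<epsilon> F G) (ordered_modulus N T \<epsilon> G F)"

section \<open>The adaptive interval\<close>

text \<open>The two parameter spaces are \<open>F 1\<close> and \<open>F 2\<close>.\<close>

definition pair_modulus ::
  "(('i \<Rightarrow> real) \<Rightarrow> real) \<Rightarrow> (('i \<Rightarrow> real) \<Rightarrow> real) \<Rightarrow> (nat \<Rightarrow> ('i \<Rightarrow> real) set) \<Rightarrow>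
   nat \<Rightarrow> real \<Rightarrow> nat \<Rightarrow> nat \<Rightarrow> ereal" where
  "pair_modulus N T F n \<beta> i j =
     ordered_modulus N T (normal_quantile (\<beta> / 2) / sqrt (real n)) (F i) (F j)"

definition balanced_estimator ::
  "('p \<Rightarrow> 'd measure) \<Rightarrow> ('p \<Rightarrow> real) \<Rightarrow> (nat \<Rightarrow> 'p set) \<Rightarrow> real \<Rightarrow> (nat \<Rightarrow> nat \<Rightarrow> ereal) \<Rightarrow>
   nat \<Rightarrow> nat \<Rightarrow> ('d \<Rightarrow> real) \<Rightarrow> bool" where
  "balanced_estimator P T F \<beta> \<omega> i j S \<longleftrightarrow>
     (\<forall>f\<in>F 1 \<union> F 2. ereal (prob_space.variance (P f) S)
                       \<le> (\<omega> i j)\<^sup>2 / ereal ((normal_quantile (\<beta> / 2))\<^sup>2)) \<and>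
     (INF f\<in>F j. ereal (prob_space.expectation (P f) S - T f)) \<ge> - (1/2 * \<omega> i j) \<and>
     (SUP f\<in>F i. ereal (prob_space.expectation (P f) S - T f)) \<le> 1/2 * \<omega> i j"

definition CI_star ::
  "(nat \<Rightarrow> nat \<Rightarrow> ereal) \<Rightarrow> (nat \<Rightarrow> nat \<Rightarrow> 'd \<Rightarrow> real) \<Rightarrow> nat \<Rightarrow> 'd \<Rightarrow> real set" where
  "CI_star \<omega> That j y =
     {x. (MIN i\<in>{1,2}. ereal (That i j y) - 3/2 * \<omega> i j) \<le> ereal x \<and>
         ereal x \<le> (MAX i\<in>{1,2}. ereal (That j i y) + 3/2 * \<omega> j i)}"

definition CI_adaptive ::
  "(nat \<Rightarrow> nat \<Rightarrow> ereal) \<Rightarrow> (nat \<Rightarrow> nat \<Rightarrow> 'd \<Rightarrow> real) \<Rightarrow> 'd \<Rightarrow> real set" where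
  "CI_adaptive \<omega> That y = CI_star \<omega> That 1 y \<inter> CI_star \<omega> That 2 y"

section \<open>Order of magnitude\<close>

text \<open>The quotients \<open>0/0\<close> and \<open>\<infinity>/\<infinity>\<close>, which are \<open>0\<close> in \<^typ>\<open>ennreal\<close>, are read as \<open>1\<close>, so that
  quantities vanishing together or infinite together count as comparable. All other
  quotients are those of \<^typ>\<open>ennreal\<close>.\<close>

definition same_order :: "(nat \<Rightarrow> ennreal) \<Rightarrow> (nat \<Rightarrow> ennreal) \<Rightarrow> bool" where
  "same_order a b \<longleftrightarrow>
     (let r = (\<lambda>n. if a n = b n then 1 else a n / b n)
      in 0 < liminf r \<and> liminf r \<le> limsup r \<and> limsup r < \<infinity>)"

section \<open>The white noise model\<close>

definition unit_interval :: "real set" where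
  "unit_interval = {-1/2..1/2}"

definition L2_space :: "(real \<Rightarrow> real) set" where
  "L2_space = {f. f \<in> borel_measurable (lebesgue_on unit_interval) \<and>
                  integrable (lebesgue_on unit_interval) (\<lambda>t. (f t)\<^sup>2)}"

definition L2_norm :: "(real \<Rightarrow> real) \<Rightarrow> real" where
  "L2_norm f = sqrt (\<integral>t. (f t)\<^sup>2 \<partial>lebesgue_on unit_interval)"

text \<open>The space of continuous paths, with the \<open>\<sigma>\<close>-algebra generated by the coordinates.\<close>

definition path_space :: "(real \<Rightarrow> real) measure" where
  "path_space = restrict_space (Pi\<^sub>M unit_interval (\<lambda>_. borel)) {w. continuous_on unit_interval w}"

text \<open>\<open>W\<close> is the law of a standard Brownian motion that starts at the left end point (only its
  increments matter for the model). By a theorem of Wiener there is exactly one such measure.\<close>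

definition wiener_measure :: "(real \<Rightarrow> real) measure \<Rightarrow> bool" where
  "wiener_measure W \<longleftrightarrow>
     prob_space W \<and> sets W = sets path_space \<and>
     (AE w in W. w (-1/2) = 0) \<and>
     (\<forall>s\<in>unit_interval. \<forall>t\<in>unit_interval. s < t \<longrightarrow>
        distributed W lborel (\<lambda>w. w t - w s) (normal_density 0 (sqrt (t - s)))) \<and>
     (\<forall>(k::nat) \<tau>. (\<forall>i\<le>k. \<tau> i \<in> unit_interval) \<and> (\<forall>i<k. \<tau> i < \<tau> (Suc i)) \<longrightarrow>
        prob_space.indep_vars W (\<lambda>_. borel) (\<lambda>i w. w (\<tau> (Suc i)) - w (\<tau> i)) {..<k})"

text \<open>The law of \<open>Y(t) = \<integral>\<^bsub>-1/2\<^esub>\<^bsup>t\<^esup> f(s) ds + n\<^bsup>-1/2\<^esup> W(t)\<close>.\<close>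

definition white_noise :: "(real \<Rightarrow> real) measure \<Rightarrow> nat \<Rightarrow> (real \<Rightarrow> real) \<Rightarrow> (real \<Rightarrow> real) measure" where
  "white_noise W n f =
     distr W path_space
       (\<lambda>w. \<lambda>t\<in>unit_interval. (\<integral>s. f s \<partial>lebesgue_on {-1/2..t}) + w t / sqrt (real n))"

definition step_function :: "nat \<Rightarrow> (nat \<Rightarrow> real) \<Rightarrow> (nat \<Rightarrow> real) \<Rightarrow> real \<Rightarrow> real" where
  "step_function k \<tau> a t = (\<Sum>i<k. a i * indicator {\<tau> i<..\<tau> (Suc i)} t)"

definition step_integral :: "nat \<Rightarrow> (nat \<Rightarrow> real) \<Rightarrow> (nat \<Rightarrow> real) \<Rightarrow> (real \<Rightarrow> real) \<Rightarrow> real" where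
  "step_integral k \<tau> a Y = (\<Sum>i<k. a i * (Y (\<tau> (Suc i)) - Y (\<tau> i)))"

text \<open>The statistic \<open>I\<close> is a version of the Wiener integral \<open>\<integral> h dY\<close>: the mean square limit of
  the integrals of step functions that tend to \<open>h\<close> in \<open>L\<^sub>2\<close>. One version serves all \<open>f\<close>, since
  the laws \<^term>\<open>white_noise W n f\<close> are mutually absolutely continuous.\<close>

definition white_noise_integral ::
  "(real \<Rightarrow> real) measure \<Rightarrow> nat \<Rightarrow> (real \<Rightarrow> real) \<Rightarrow> ((real \<Rightarrow> real) \<Rightarrow> real) \<Rightarrow> bool" where
  "white_noise_integral W n h I \<longleftrightarrow>
     I \<in> borel_measurable path_space \<and>
     (\<exists>k \<tau> a.
        (\<forall>m. (\<forall>i\<le>k m. \<tau> m i \<in> unit_interval) \<and> (\<forall>i<k m. \<tau> m i < \<tau> m (Suc i))) \<and>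
        (\<lambda>m. L2_norm (h - step_function (k m) (\<tau> m) (a m))) \<longlonglongrightarrow> 0 \<and>
        (\<forall>f\<in>L2_space.
           (\<lambda>m. \<integral>\<^sup>+ y. ennreal ((I y - step_integral (k m) (\<tau> m) (a m) y)\<^sup>2) \<partial>white_noise W n f)
           \<longlonglongrightarrow> 0))"

definition white_noise_linear_estimator ::
  "(real \<Rightarrow> real) measure \<Rightarrow> nat \<Rightarrow> ((real \<Rightarrow> real) \<Rightarrow> real) \<Rightarrow> bool" where
  "white_noise_linear_estimator W n S \<longleftrightarrow>
     (\<exists>c. \<exists>h\<in>L2_space. \<exists>I. white_noise_integral W n h I \<and> S = (\<lambda>y. c + I y))"

section \<open>The Gaussian sequence model\<close>

text \<open>A finite or countably infinite index set is represented by a set \<open>M\<close> of natural numbers.\<close>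

definition l2_space :: "nat set \<Rightarrow> (nat \<Rightarrow> real) set" where
  "l2_space M = {f. (\<lambda>i. (f i)\<^sup>2) summable_on M}"

definition l2_norm :: "nat set \<Rightarrow> (nat \<Rightarrow> real) \<Rightarrow> real" where
  "l2_norm M f = sqrt (\<Sum>\<^sub>\<infinity>i\<in>M. (f i)\<^sup>2)"

definition sequence_data_space :: "nat set \<Rightarrow> (nat \<Rightarrow> real) measure" where
  "sequence_data_space M = Pi\<^sub>M M (\<lambda>_. borel)"

definition gaussian_sequence :: "nat set \<Rightarrow> nat \<Rightarrow> (nat \<Rightarrow> real) \<Rightarrow> (nat \<Rightarrow> real) measure" where
  "gaussian_sequence M n f =
     distr (Pi\<^sub>M M (\<lambda>_. std_normal_distribution)) (sequence_data_space M)
       (\<lambda>z. \<lambda>i\<in>M. f i + z i / sqrt (real n))"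

text \<open>For infinite \<open>M\<close> the series \<open>\<Sum>\<^sub>i h(i) Y(i)\<close> is the mean square limit of its finite partial
  sums; \<open>I\<close> is a version of it that serves all square summable \<open>f\<close>.\<close>

definition gaussian_series ::
  "nat set \<Rightarrow> nat \<Rightarrow> (nat \<Rightarrow> real) \<Rightarrow> ((nat \<Rightarrow> real) \<Rightarrow> real) \<Rightarrow> bool" where
  "gaussian_series M n h I \<longleftrightarrow>
     I \<in> borel_measurable (sequence_data_space M) \<and>
     (\<forall>f\<in>l2_space M.
        ((\<lambda>A. \<integral>\<^sup>+ y. ennreal ((I y - (\<Sum>i\<in>A. h i * y i))\<^sup>2) \<partial>gaussian_sequence M n f) \<longlongrightarrow> 0)
          (finite_subsets_at_top M))"

definition gaussian_sequence_linear_estimator ::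
  "nat set \<Rightarrow> nat \<Rightarrow> ((nat \<Rightarrow> real) \<Rightarrow> real) \<Rightarrow> bool" where
  "gaussian_sequence_linear_estimator M n S \<longleftrightarrow>
     (\<exists>c. \<exists>h\<in>l2_space M. \<exists>I. gaussian_series M n h I \<and> S = (\<lambda>y. c + I y))"

end

theory Submission
  imports Defs
begin

text \<open>Coverage and length of the adaptive interval only use that the estimators are Gaussian with
  the prescribed bias and variance: each of the four possible misses is a Gaussian tail event of
  probability at most \<open>\<alpha>/4\<close>, and the expected length is at most a constant times the between class
  modulus. Conversely, two parameters at distance of order \<open>n\<^sup>-\<^sup>1\<^sup>/\<^sup>2\<close> have laws so close in total
  variation that every confidence interval contains both values of the functional with probability
  bounded below, so its expected length is at least a constant times the modulus at a smaller radius.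
  By convexity the moduli at the two radii are comparable. The total variation bound comes from the
  chi-square divergence of shifted Gaussian vectors and passes from finitely many coordinates
  (increments of the path, or components of the sequence) to all measurable sets.\<close>

section \<open>Gaussian shifts in finite dimension\<close>

text \<open>The functional may be unbounded and any modulus infinite, so lengths and moduli are
  compared as extended nonnegative reals; an infinite modulus puts an end point at infinity, where
  it cannot miss. \<open>CI_star\<close> is taken at level \<beta> = \<alpha>/2, hence each tail has
  probability \<beta>/2 = \<alpha>/4, and \<open>T f\<close> can be missed at either end of either
  of the two intervals. For the length on \<open>F j\<close> only the interval with index
  \<open>j\<close> counts, because its estimators are the ones with the required one-sided bias
  bounds on \<open>F j\<close>. The obstacle in the lower bound is that data are infinite
  dimensional while Gaussian densities are computed for finitely many coordinates. The bound on such
  coordinates depends on the shift only through its Euclidean norm, which never exceeds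
  \<open>sqrt (real n)\<close> times the distance of the parameters, so it is uniform in the chosen
  coordinates. Three radii occur, each divided by the square root of \<open>n\<close>: z at
  \<alpha>/4 in the construction, z at \<alpha>/2 in the final comparison, and the detection radius
  in the lower bound. Changing the radius costs a factor that depends on \<alpha> alone.\<close>

abbreviation gaussian_measure :: "'i set \<Rightarrow> ('i \<Rightarrow> real) measure" where
  "gaussian_measure K \<equiv> Pi\<^sub>M K (\<lambda>_. std_normal_distribution)"

lemma prob_space_std_normal: "prob_space std_normal_distribution"
  by (rule prob_space_normal_density) simp

lemma product_prob_space_std_normal: "product_prob_space (\<lambda>_. std_normal_distribution)"
  by (intro product_prob_spaceI prob_space_std_normal)

lemma prob_space_gaussian_measure: "prob_space (gaussian_measure K)"
  by (intro prob_space_PiM prob_space_std_normal)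

lemma sets_gaussian_measure [measurable_cong]: "sets (gaussian_measure K) = sets (Pi\<^sub>M K (\<lambda>_. borel))"
  by (intro sets_PiM_cong) auto

lemma space_gaussian_measure: "space (gaussian_measure K) = PiE K (\<lambda>_. UNIV)"
  by (simp add: space_PiM)

lemma distr_std_normal_affine:
  assumes "0 < s"
  shows "distr std_normal_distribution borel (\<lambda>x. m + s * x) = density lborel (normal_density m s)"
proof -
  interpret prob_space std_normal_distribution by (rule prob_space_std_normal)
  have "distributed std_normal_distribution lborel (\<lambda>x. x) std_normal_density"
    by (auto simp: distributed_def distr_id2)
  from normal_density_affine[OF this, of s m] assms
  have "distributed std_normal_distribution lborel (\<lambda>x. m + s * x) (normal_density m s)"
    by simp
  from distributed_distr_eq_density[OF this] show ?thesis
    by (simp cong: distr_cong)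
qed

text \<open>The exponential is the likelihood ratio of N(d,1) against N(0,1); the identity completes
  the square.\<close>

lemma std_normal_density_exp:
  "std_normal_density x * exp (d * x - d\<^sup>2 / 2) = normal_density d 1 x"
  by (simp add: normal_density_def power2_eq_square field_simps flip: exp_add)

lemma distr_std_normal_shift:
  "distr std_normal_distribution borel (\<lambda>x. x + d) =
   density std_normal_distribution (\<lambda>x. ennreal (exp (d * x - d\<^sup>2 / 2)))"
proof -
  have "distr std_normal_distribution borel (\<lambda>x. x + d) = density lborel (normal_density d 1)"
    using distr_std_normal_affine[of 1 d] by (simp add: add.commute)
  also have "\<dots> = density std_normal_distribution (\<lambda>x. ennreal (exp (d * x - d\<^sup>2 / 2)))"
    by (subst density_density_eq)
       (simp_all add: normal_density_nonneg std_normal_density_exp flip: ennreal_mult)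
  finally show ?thesis .
qed

lemma nn_integral_std_normal_exp:
  "(\<integral>\<^sup>+x. ennreal (exp (d * x - d\<^sup>2 / 2)) \<partial>std_normal_distribution) = 1"
proof -
  interpret prob_space "distr std_normal_distribution borel (\<lambda>x. x + d)"
    by (intro prob_space.prob_space_distr prob_space_std_normal) simp
  show ?thesis
    using emeasure_space_1 unfolding distr_std_normal_shift
    by (simp add: emeasure_density cong: nn_integral_cong)
qed

text \<open>Squaring the likelihood ratio doubles the shift: L_d^2 = e^(d^2) L_(2d), and L_(2d) has
  integral 1. The value minus 1 is the chi-square divergence of N(d,1) from N(0,1).\<close>

lemma nn_integral_std_normal_exp_square:
  "(\<integral>\<^sup>+x. ennreal ((exp (d * x - d\<^sup>2 / 2))\<^sup>2) \<partial>std_normal_distribution) = ennreal (exp (d\<^sup>2))"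
proof -
  have "(exp (d * x - d\<^sup>2 / 2))\<^sup>2 = exp (d\<^sup>2) * exp ((2 * d) * x - (2 * d)\<^sup>2 / 2)" for x :: real
    by (simp add: power2_eq_square field_simps flip: exp_add)
  then have "(\<integral>\<^sup>+x. ennreal ((exp (d * x - d\<^sup>2 / 2))\<^sup>2) \<partial>std_normal_distribution) =
      ennreal (exp (d\<^sup>2)) * (\<integral>\<^sup>+x. ennreal (exp ((2 * d) * x - (2 * d)\<^sup>2 / 2)) \<partial>std_normal_distribution)"
    by (subst nn_integral_cmult[symmetric]) (simp_all add: ennreal_mult)
  then show ?thesis unfolding nn_integral_std_normal_exp by simp
qed

text \<open>The finite-dimensional Cameron-Martin density: the likelihood ratio of the Gaussian
  vector with mean \<open>d\<close> against the centred one.\<close>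

definition shift_density :: "'i set \<Rightarrow> ('i \<Rightarrow> real) \<Rightarrow> ('i \<Rightarrow> real) \<Rightarrow> real" where
  "shift_density K d x = (\<Prod>i\<in>K. exp (d i * x i - (d i)\<^sup>2 / 2))"

lemma shift_density_measurable [measurable]:
  "shift_density K d \<in> borel_measurable (Pi\<^sub>M K (\<lambda>_. borel))"
  unfolding shift_density_def by measurable

lemma nn_integral_gaussian_prod:
  fixes f :: "'i \<Rightarrow> real \<Rightarrow> ennreal"
  assumes "finite K" "\<And>i. i \<in> K \<Longrightarrow> f i \<in> borel_measurable borel"
  shows "(\<integral>\<^sup>+x. (\<Prod>i\<in>K. f i (x i)) \<partial>gaussian_measure K) =
    (\<Prod>i\<in>K. \<integral>\<^sup>+x. f i x \<partial>std_normal_distribution)"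
proof -
  interpret product_prob_space "\<lambda>_::'i. std_normal_distribution"
    by (rule product_prob_space_std_normal)
  show ?thesis using assms by (intro product_nn_integral_prod) auto
qed

text \<open>On every measurable rectangle both measures give the product of the one-dimensional
  shifted laws \<open>Q i\<close>, so each of them is the product measure
  \<open>Pi\<^sub>M K Q\<close>.\<close>

lemma distr_gaussian_measure_shift:
  assumes K: "finite K"
  shows "distr (gaussian_measure K) (gaussian_measure K) (\<lambda>x. \<lambda>i\<in>K. x i + d i) =
    density (gaussian_measure K) (\<lambda>x. ennreal (shift_density K d x))"
proof -
  define Q where "Q = (\<lambda>i. distr std_normal_distribution borel (\<lambda>x. x + d i))"
  have Q: "prob_space (Q i)" for i
    unfolding Q_def by (intro prob_space.prob_space_distr prob_space_std_normal) simp
  interpret Q: product_prob_space Q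
    by (intro product_prob_spaceI Q)
  interpret N: product_prob_space "\<lambda>_::'a. std_normal_distribution"
    by (rule product_prob_space_std_normal)
  have sQ: "sets (Pi\<^sub>M K Q) = sets (gaussian_measure K)"
    by (intro sets_PiM_cong) (auto simp: Q_def)
  have meas [measurable]: "(\<lambda>x. \<lambda>i\<in>K. x i + d i) \<in> gaussian_measure K \<rightarrow>\<^sub>M gaussian_measure K"
    by measurable
  have "distr (gaussian_measure K) (gaussian_measure K) (\<lambda>x. \<lambda>i\<in>K. x i + d i) = Pi\<^sub>M K Q"
  proof (rule Q.PiM_eqI)
    fix A assume A: "\<And>i. i \<in> K \<Longrightarrow> A i \<in> sets (Q i)"
    then have [measurable]: "\<And>i. i \<in> K \<Longrightarrow> A i \<in> sets borel" by (simp add: Q_def)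
    have AK: "Pi\<^sub>E K A \<in> sets (gaussian_measure K)"
      using K by (intro sets_PiM_I_finite) auto
    have "emeasure (distr (gaussian_measure K) (gaussian_measure K) (\<lambda>x. \<lambda>i\<in>K. x i + d i)) (Pi\<^sub>E K A) =
      emeasure (gaussian_measure K) (PiE K (\<lambda>i. (\<lambda>x. x + d i) -` A i))"
      using AK by (subst emeasure_distr[OF meas]) (auto simp: space_PiM PiE_iff intro!: arg_cong2[where f=emeasure])
    also have "\<dots> = (\<Prod>i\<in>K. emeasure std_normal_distribution ((\<lambda>x. x + d i) -` A i))"
      using K by (intro N.emeasure_PiM) (auto intro!: measurable_sets_borel[where M=borel])
    also have "\<dots> = (\<Prod>i\<in>K. emeasure (Q i) (A i))"
      by (intro prod.cong) (simp_all add: Q_def emeasure_distr)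
    finally show "emeasure (distr (gaussian_measure K) (gaussian_measure K) (\<lambda>x. \<lambda>i\<in>K. x i + d i)) (Pi\<^sub>E K A) = (\<Prod>i\<in>K. emeasure (Q i) (A i))" .
  qed (use K sQ in auto)
  also have "\<dots> = density (gaussian_measure K) (\<lambda>x. ennreal (shift_density K d x))"
  proof (rule Q.PiM_eqI[symmetric])
    fix A assume A: "\<And>i. i \<in> K \<Longrightarrow> A i \<in> sets (Q i)"
    then have [measurable]: "\<And>i. i \<in> K \<Longrightarrow> A i \<in> sets borel" by (simp add: Q_def)
    have AK: "Pi\<^sub>E K A \<in> sets (gaussian_measure K)"
      using K by (intro sets_PiM_I_finite) auto
    have "emeasure (density (gaussian_measure K) (\<lambda>x. ennreal (shift_density K d x))) (Pi\<^sub>E K A) =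
       (\<integral>\<^sup>+x. (\<Prod>i\<in>K. ennreal (exp (d i * x i - (d i)\<^sup>2 / 2)) * indicator (A i) (x i)) \<partial>gaussian_measure K)"
      using AK K
      by (subst emeasure_density)
         (auto intro!: nn_integral_cong split: split_indicator
            simp: shift_density_def prod_ennreal prod.distrib space_PiM PiE_iff)
    also have "\<dots> = (\<Prod>i\<in>K. emeasure (Q i) (A i))"
      using K by (subst nn_integral_gaussian_prod) (auto simp: Q_def distr_std_normal_shift emeasure_density intro!: prod.cong)
    finally show "emeasure (density (gaussian_measure K) (\<lambda>x. ennreal (shift_density K d x))) (Pi\<^sub>E K A) = (\<Prod>i\<in>K. emeasure (Q i) (A i))" .
  qed (use K sQ in auto)
  finally show ?thesis .
qed

text \<open>With L the likelihood ratio, the difference is the integral of 1 - L over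
  \<open>B\<close>. It is at most E|L - 1| <= sqrt(E(L - 1)^2), and E(L - 1)^2 = E L^2 - 1 because E
  L = 1. The bound sees \<open>K\<close> only through the norm of the shift, so it survives the
  passage to infinitely many coordinates.\<close>

lemma gaussian_shift_bound:
  assumes K: "finite K" and B: "B \<in> sets (gaussian_measure K)"
  shows "\<bar>measure (gaussian_measure K) B -
      measure (gaussian_measure K) {x \<in> space (gaussian_measure K). (\<lambda>i\<in>K. x i + d i) \<in> B}\<bar>
    \<le> sqrt (exp (\<Sum>i\<in>K. (d i)\<^sup>2) - 1)"
proof -
  interpret prob_space "gaussian_measure K" by (rule prob_space_gaussian_measure)
  let ?L = "shift_density K d"
  have Lnn: "0 \<le> ?L x" for x by (auto simp: shift_density_def intro!: prod_nonneg)
  have "(\<integral>\<^sup>+x. ennreal (?L x) \<partial>gaussian_measure K) = 1"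
    using K nn_integral_gaussian_prod[of K "\<lambda>i x. ennreal (exp (d i * x - (d i)\<^sup>2 / 2))"]
    by (simp add: shift_density_def prod_ennreal[symmetric] nn_integral_std_normal_exp)
  then have L1: "integrable (gaussian_measure K) ?L" "integral\<^sup>L (gaussian_measure K) ?L = 1"
    using Lnn by (auto intro!: integrableI_nonneg simp: integral_eq_nn_integral)
  have "(\<integral>\<^sup>+x. ennreal ((?L x)\<^sup>2) \<partial>gaussian_measure K) = ennreal (exp (\<Sum>i\<in>K. (d i)\<^sup>2))"
    using K nn_integral_gaussian_prod[of K "\<lambda>i x. ennreal ((exp (d i * x - (d i)\<^sup>2 / 2))\<^sup>2)"]
    by (simp add: shift_density_def prod_ennreal[symmetric] prod_power_distrib
      nn_integral_std_normal_exp_square exp_sum)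
  then have L2: "integrable (gaussian_measure K) (\<lambda>x. (?L x)\<^sup>2)"
      "integral\<^sup>L (gaussian_measure K) (\<lambda>x. (?L x)\<^sup>2) = exp (\<Sum>i\<in>K. (d i)\<^sup>2)"
    by (auto intro!: integrableI_nonneg simp: integral_eq_nn_integral)
  have sq: "(\<lambda>x. (\<bar>?L x - 1\<bar>)\<^sup>2) = (\<lambda>x. (?L x)\<^sup>2 - 2 * ?L x + 1)"
    by (auto simp: power2_eq_square algebra_simps)
  have i2: "integrable (gaussian_measure K) (\<lambda>x. (\<bar>?L x - 1\<bar>)\<^sup>2)"
    unfolding sq using L1 L2 by auto
  have e2: "expectation (\<lambda>x. (\<bar>?L x - 1\<bar>)\<^sup>2) = exp (\<Sum>i\<in>K. (d i)\<^sup>2) - 1"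
    unfolding sq using L1 L2 by (simp add: prob_space)
  have i1: "integrable (gaussian_measure K) (\<lambda>x. \<bar>?L x - 1\<bar>)"
    using L1 by auto
  \<comment> \<open>Nonnegativity of this variance is Jensen's inequality (E|L - 1|)^2 <= E(L -
    1)^2.\<close>
  have "0 \<le> variance (\<lambda>x. \<bar>?L x - 1\<bar>)" by (rule variance_positive)
  then have "(expectation (\<lambda>x. \<bar>?L x - 1\<bar>))\<^sup>2 \<le> exp (\<Sum>i\<in>K. (d i)\<^sup>2) - 1"
    using variance_eq[OF i1 i2] e2 by simp
  then have cs: "expectation (\<lambda>x. \<bar>?L x - 1\<bar>) \<le> sqrt (exp (\<Sum>i\<in>K. (d i)\<^sup>2) - 1)"
    by (rule real_le_rsqrt)
  have meas: "(\<lambda>x. \<lambda>i\<in>K. x i + d i) \<in> gaussian_measure K \<rightarrow>\<^sub>M gaussian_measure K"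
    by measurable
  have "measure (gaussian_measure K) {x \<in> space (gaussian_measure K). (\<lambda>i\<in>K. x i + d i) \<in> B} =
     measure (distr (gaussian_measure K) (gaussian_measure K) (\<lambda>x. \<lambda>i\<in>K. x i + d i)) B"
    by (subst measure_distr[OF meas B]) (auto intro!: arg_cong2[where f=measure])
  also have "\<dots> = (\<integral>x. indicator B x * ?L x \<partial>gaussian_measure K)"
    unfolding distr_gaussian_measure_shift[OF K]
    using B Lnn by (subst integral_eq_nn_integral)
      (auto simp: measure_def emeasure_density intro!: arg_cong[where f=enn2real] nn_integral_cong split: split_indicator)
  moreover have "integrable (gaussian_measure K) (indicat_real B)"
    using B by (intro integrable_const_bound[where B=1]) (auto simp: indicator_def)
  ultimately have "\<bar>prob B - measure (gaussian_measure K) {x \<in> space (gaussian_measure K). (\<lambda>i\<in>K. x i + d i) \<in> B}\<bar>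
    = \<bar>\<integral>x. indicator B x - indicator B x * ?L x \<partial>gaussian_measure K\<bar>"
    using B L1(1) 
    by (subst Bochner_Integration.integral_diff)
       (auto simp: integrable_mult_indicator[where 'b=real, simplified])
  also have "\<dots> \<le> (\<integral>x. \<bar>indicator B x - indicator B x * ?L x\<bar> \<partial>gaussian_measure K)"
    by (rule integral_abs_bound)
  also have "\<dots> \<le> expectation (\<lambda>x. \<bar>?L x - 1\<bar>)"
    using i1 by (intro integral_mono') (auto split: split_indicator)
  finally show ?thesis using cs by simp
qed

section \<open>Gaussian random variables and their mean square limits\<close>

lemma Cauchy_Schwarz_integral:
  fixes f g :: "'a \<Rightarrow> real"
  assumes [measurable]: "f \<in> borel_measurable M" "g \<in> borel_measurable M"
    and f2: "integrable M (\<lambda>x. (f x)\<^sup>2)" and g2: "integrable M (\<lambda>x. (g x)\<^sup>2)"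
  shows "integrable M (\<lambda>x. f x * g x)"
    and "(\<integral>x. f x * g x \<partial>M)\<^sup>2 \<le> (\<integral>x. (f x)\<^sup>2 \<partial>M) * (\<integral>x. (g x)\<^sup>2 \<partial>M)"
proof -
  show *: "integrable M (\<lambda>x. f x * g x)"
  proof (rule Bochner_Integration.integrable_bound)
    show "integrable M (\<lambda>x. (f x)\<^sup>2 + (g x)\<^sup>2)" using f2 g2 by simp
    have "\<bar>f x * g x\<bar> \<le> (f x)\<^sup>2 + (g x)\<^sup>2" for x
      using sum_squares_bound[of "\<bar>f x\<bar>" "\<bar>g x\<bar>"] abs_ge_zero[of "f x * g x"]
      unfolding abs_mult power2_abs by linarith
    then show "AE x in M. norm (f x * g x) \<le> norm ((f x)\<^sup>2 + (g x)\<^sup>2)" by simp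
  qed simp
  have "(\<integral>\<^sup>+x. ennreal \<bar>f x\<bar> * ennreal \<bar>g x\<bar> \<partial>M)\<^sup>2
      \<le> (\<integral>\<^sup>+x. (ennreal \<bar>f x\<bar>)\<^sup>2 \<partial>M) * (\<integral>\<^sup>+x. (ennreal \<bar>g x\<bar>)\<^sup>2 \<partial>M)"
    by (intro Cauchy_Schwarz_nn_integral) simp_all
  also have "(\<integral>\<^sup>+x. ennreal \<bar>f x\<bar> * ennreal \<bar>g x\<bar> \<partial>M) = ennreal (\<integral>x. \<bar>f x * g x\<bar> \<partial>M)"
    using integrable_abs[OF *] by (subst nn_integral_eq_integral[symmetric]) (auto simp: abs_mult ennreal_mult)
  also have "(\<integral>\<^sup>+x. (ennreal \<bar>f x\<bar>)\<^sup>2 \<partial>M) = ennreal (\<integral>x. (f x)\<^sup>2 \<partial>M)"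
    using f2 by (subst nn_integral_eq_integral[symmetric]) (auto simp: ennreal_power)
  also have "(\<integral>\<^sup>+x. (ennreal \<bar>g x\<bar>)\<^sup>2 \<partial>M) = ennreal (\<integral>x. (g x)\<^sup>2 \<partial>M)"
    using g2 by (subst nn_integral_eq_integral[symmetric]) (auto simp: ennreal_power)
  finally have "ennreal ((\<integral>x. \<bar>f x * g x\<bar> \<partial>M)\<^sup>2) \<le> ennreal ((\<integral>x. (f x)\<^sup>2 \<partial>M) * (\<integral>x. (g x)\<^sup>2 \<partial>M))"
    by (subst ennreal_mult, simp, simp, subst ennreal_power[symmetric], simp)
  then have "(\<integral>x. \<bar>f x * g x\<bar> \<partial>M)\<^sup>2 \<le> (\<integral>x. (f x)\<^sup>2 \<partial>M) * (\<integral>x. (g x)\<^sup>2 \<partial>M)"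
    by (subst (asm) ennreal_le_iff) simp_all
  moreover have "(\<integral>x. f x * g x \<partial>M)\<^sup>2 \<le> (\<integral>x. \<bar>f x * g x\<bar> \<partial>M)\<^sup>2"
    using power_mono[OF integral_abs_bound[of M "\<lambda>x. f x * g x"] abs_ge_zero, of 2] by simp
  ultimately show "(\<integral>x. f x * g x \<partial>M)\<^sup>2 \<le> (\<integral>x. (f x)\<^sup>2 \<partial>M) * (\<integral>x. (g x)\<^sup>2 \<partial>M)"
    by simp
qed

section \<open>Quantiles and symmetry of the standard normal law\<close>

lemma measure_std_normal_singleton: "measure std_normal_distribution {x} = 0"
proof -
  have "emeasure std_normal_distribution {x} = 0"
    using AE_lborel_singleton[of x]
    by (subst emeasure_density) (auto simp: nn_integral_0_iff_AE)
  then show ?thesis by (simp add: measure_def)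
qed

text \<open>\<open>normal_quantile\<close> is defined through \<open>inv\<close>, so the equation
  requires that 1 - a is attained. The law has no atoms, hence its distribution function is
  continuous, and with the limits 0 and 1 the intermediate value theorem applies.\<close>

lemma cdf_std_normal_quantile:
  assumes "0 < a" "a < 1"
  shows "cdf std_normal_distribution (normal_quantile a) = 1 - a"
proof -
  interpret real_distribution std_normal_distribution by (rule real_dist_normal_dist)
  have c: "continuous_on UNIV (cdf std_normal_distribution)"
    by (intro continuous_at_imp_continuous_on ballI) (simp add: isCont_cdf measure_std_normal_singleton)
  obtain l where l: "cdf std_normal_distribution l < 1 - a"
    using order_tendstoD(2)[OF cdf_lim_at_bot, of "1 - a"] assms by (auto simp: eventually_at_bot_linorder)
  obtain u where u: "1 - a < cdf std_normal_distribution u"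
    using order_tendstoD(1)[OF cdf_lim_at_top_prob, of "1 - a"] assms by (auto simp: eventually_at_top_linorder)
  have "l \<le> u" using l u cdf_nondecreasing[of u l] by linarith
  then obtain x where "cdf std_normal_distribution x = 1 - a"
    using IVT'[of "cdf std_normal_distribution" l "1 - a" u] l u continuous_on_subset[OF c] by auto
  then have "1 - a \<in> range (cdf std_normal_distribution)" by (metis rangeI)
  then show ?thesis unfolding normal_quantile_def by (rule f_inv_into_f)
qed

lemma distr_std_normal_uminus: "distr std_normal_distribution borel uminus = std_normal_distribution"
proof -
  interpret prob_space std_normal_distribution by (rule prob_space_std_normal)
  have "distributed std_normal_distribution lborel (\<lambda>x. x) std_normal_density"
    by (auto simp: distributed_def distr_id2)
  from normal_density_affine[OF this, of "-1" 0]
  have "distributed std_normal_distribution lborel (\<lambda>x. - x) std_normal_density"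
    by simp
  from distributed_distr_eq_density[OF this] show ?thesis
    by (simp cong: distr_cong)
qed

text \<open>Reflection gives the two half lines at 0 equal mass, and 0 is not an atom. The
  inequality makes the quantiles at levels below 1/2 positive.\<close>

lemma cdf_std_normal_0: "cdf std_normal_distribution 0 \<le> 1 / 2"
proof -
  interpret real_distribution std_normal_distribution by (rule real_dist_normal_dist)
  have "measure std_normal_distribution {..0::real} = measure (distr std_normal_distribution borel uminus) {..0::real}"
    by (simp add: distr_std_normal_uminus)
  also have "\<dots> = measure std_normal_distribution {0::real..}"
    by (subst measure_distr) (auto intro!: arg_cong2[where f=measure])
  finally have eq: "measure std_normal_distribution {..0::real} = measure std_normal_distribution {0::real..}" .
  have "prob {0::real..} = prob {0} + prob {0<..}"
    by (subst finite_measure_Union[symmetric]) (auto intro!: arg_cong2[where f=measure])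
  moreover have "prob {..0} + prob {0<..} = 1"
    using prob_compl[of "{..0}"] by (simp add: Compl_atMost flip: Compl_eq_Diff_UNIV)
  ultimately show ?thesis using measure_std_normal_singleton[of 0] eq by (simp add: cdf_def)
qed

lemma normal_quantile_pos:
  assumes "0 < a" "a < 1 / 2"
  shows "0 < normal_quantile a"
proof (rule ccontr)
  interpret real_distribution std_normal_distribution by (rule real_dist_normal_dist)
  assume "\<not> 0 < normal_quantile a"
  then have "cdf std_normal_distribution (normal_quantile a) \<le> cdf std_normal_distribution 0"
    by (intro cdf_nondecreasing) simp
  then show False using cdf_std_normal_quantile[of a] cdf_std_normal_0 assms by simp
qed

lemma measure_std_normal_tail:
  assumes "0 < a" "a < 1"
  shows "measure std_normal_distribution {normal_quantile a<..} = a"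
proof -
  interpret real_distribution std_normal_distribution by (rule real_dist_normal_dist)
  have "prob {..normal_quantile a} + prob {normal_quantile a<..} = 1"
    using prob_compl[of "{..normal_quantile a}"] by (simp add: Compl_atMost flip: Compl_eq_Diff_UNIV)
  then show ?thesis using cdf_std_normal_quantile[OF assms] by (simp add: cdf_def)
qed

section \<open>Characteristic functions and Gaussian random variables\<close>

lemma char_std_normal_affine:
  "char (distr std_normal_distribution borel (\<lambda>x. m + s * x)) t =
    iexp (t * m) * complex_of_real (exp (- ((s * t)\<^sup>2) / 2))"
proof -
  have "char (distr std_normal_distribution borel (\<lambda>x. m + s * x)) t =
      (CLINT x|std_normal_distribution. iexp (t * m) * iexp ((s * t) * x))"
    unfolding char_def by (subst integral_distr) (auto intro!: Bochner_Integration.integral_cong simp: field_simps simp flip: exp_add)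
  also have "\<dots> = iexp (t * m) * char std_normal_distribution (s * t)"
    unfolding char_def by (rule Bochner_Integration.integral_mult_right_zero)
  finally show ?thesis by (simp add: char_std_normal_distribution)
qed

lemma distr_std_normal_eqI:
  assumes "real_distribution \<mu>"
    and "\<And>t. char \<mu> t = iexp (t * m) * complex_of_real (exp (- ((s * t)\<^sup>2) / 2))"
  shows "\<mu> = distr std_normal_distribution borel (\<lambda>x. m + s * x)"
proof (rule Levy_uniqueness)
  show "real_distribution (distr std_normal_distribution borel (\<lambda>x. m + s * x))"
    by (rule prob_space.real_distribution_distr[OF prob_space_std_normal]) simp
qed (use assms in \<open>auto simp: char_std_normal_affine\<close>)

text \<open>The law is given as an affine image of N(0,1) rather than by a density so that
  \<open>s = 0\<close> is included: an estimator may be constant, for instance when its modulus and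
  hence its variance vanish. The sign of \<open>s\<close> is left free.\<close>

definition gaussian_rv :: "'a measure \<Rightarrow> ('a \<Rightarrow> real) \<Rightarrow> bool" where
  "gaussian_rv P X \<longleftrightarrow> X \<in> borel_measurable P \<and>
    (\<exists>m s. distr P borel X = distr std_normal_distribution borel (\<lambda>x. m + s * x))"

lemma std_normal_moments:
  "integrable std_normal_distribution (\<lambda>x. x)" "(\<integral>x. x \<partial>std_normal_distribution) = 0"
  "integrable std_normal_distribution (\<lambda>x. x\<^sup>2)" "(\<integral>x. x\<^sup>2 \<partial>std_normal_distribution) = 1"
  using integrable_std_normal_distribution_moment[of 1] integral_std_normal_distribution_moment_odd[of 1]
    integrable_std_normal_distribution_moment[of 2] std_normal_distribution_even_moments(1)[of 1]
  by simp_all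

lemma gaussian_rv_moments:
  assumes P: "prob_space P" and X: "X \<in> borel_measurable P"
    and law: "distr P borel X = distr std_normal_distribution borel (\<lambda>x. m + s * x)"
  shows "integrable P X" "integrable P (\<lambda>y. (X y)\<^sup>2)" "prob_space.expectation P X = m"
    "prob_space.expectation P (\<lambda>y. (X y)\<^sup>2) = m\<^sup>2 + s\<^sup>2" "prob_space.variance P X = s\<^sup>2"
proof -
  interpret prob_space P by fact
  interpret N: prob_space std_normal_distribution by (rule prob_space_std_normal)
  have int: "integrable P (\<lambda>y. g (X y)) \<longleftrightarrow> integrable std_normal_distribution (\<lambda>x. g (m + s * x))"
   and val: "(\<integral>y. g (X y) \<partial>P) = (\<integral>x. g (m + s * x) \<partial>std_normal_distribution)"
    if [measurable]: "g \<in> borel_measurable borel" for g :: "real \<Rightarrow> real"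
    using integrable_distr_eq[OF X that] integral_distr[OF X that]
      integrable_distr_eq[of "\<lambda>x. m + s * x" std_normal_distribution borel g]
      integral_distr[of "\<lambda>x. m + s * x" std_normal_distribution borel g] law by auto
  have sq: "(m + s * x)\<^sup>2 = m\<^sup>2 + (2 * m * s) * x + s\<^sup>2 * x\<^sup>2" for x
    by (simp add: power2_eq_square algebra_simps)
  have c1: "N.expectation (\<lambda>_. c) = c" for c :: real using N.prob_space by simp
  have i1: "integrable std_normal_distribution (\<lambda>x. m + s * x)"
    by (intro Bochner_Integration.integrable_add integrable_mult_right std_normal_moments N.integrable_const)
  have e1: "N.expectation (\<lambda>x. m + s * x) = m"
    by (subst Bochner_Integration.integral_add)
       (simp_all only: N.integrable_const integrable_mult_right std_normal_moments integral_mult_right_zero c1 mult_zero_right add_0_right)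
  have i2: "integrable std_normal_distribution (\<lambda>x. (m + s * x)\<^sup>2)" unfolding sq
    by (intro Bochner_Integration.integrable_add integrable_mult_right std_normal_moments N.integrable_const)
  have e2: "N.expectation (\<lambda>x. (m + s * x)\<^sup>2) = m\<^sup>2 + s\<^sup>2" unfolding sq
    by (subst Bochner_Integration.integral_add, (intro Bochner_Integration.integrable_add integrable_mult_right std_normal_moments N.integrable_const)+)+
       (simp only: std_normal_moments integral_mult_right_zero c1 mult_zero_right add_0_right mult_1_right)
  have b2: "(\<lambda>x::real. x\<^sup>2) \<in> borel_measurable borel" by simp
  show iX: "integrable P X" using int[OF measurable_ident] i1 by (simp only: id_def)
  show iX2: "integrable P (\<lambda>y. (X y)\<^sup>2)" using int[OF b2] i2 by (simp only:)
  show eX: "expectation X = m" using val[OF measurable_ident] e1 by (simp only: id_def)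
  show eX2: "expectation (\<lambda>y. (X y)\<^sup>2) = m\<^sup>2 + s\<^sup>2" using val[OF b2] e2 by (simp only:)
  show "variance X = s\<^sup>2" using variance_eq[OF iX iX2] eX eX2 by simp
qed

text \<open>The characteristic function involves \<open>s\<close> only through its square, so any
  representation may be replaced by the one in which \<open>s\<close> is the square root of the
  variance.\<close>

lemma gaussian_rv_law:
  assumes P: "prob_space P" and G: "gaussian_rv P X"
  shows "distr P borel X = distr std_normal_distribution borel
    (\<lambda>x. prob_space.expectation P X + sqrt (prob_space.variance P X) * x)"
proof -
  interpret prob_space P by fact
  from G obtain m s where X: "X \<in> borel_measurable P"
    and law: "distr P borel X = distr std_normal_distribution borel (\<lambda>x. m + s * x)"
    by (auto simp: gaussian_rv_def)
  note mom = gaussian_rv_moments[OF P X law]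
  show ?thesis unfolding mom(5) unfolding mom(3)
    by (rule distr_std_normal_eqI)
       (auto simp: law char_std_normal_affine power_mult_distrib X intro!: real_distribution_distr prob_space.real_distribution_distr[OF prob_space_std_normal])
qed

lemma gaussian_rv_uminus: "gaussian_rv P X \<Longrightarrow> gaussian_rv P (\<lambda>y. - X y)"
proof -
  assume G: "gaussian_rv P X"
  then obtain m s where X [measurable]: "X \<in> borel_measurable P"
    and law: "distr P borel X = distr std_normal_distribution borel (\<lambda>x. m + s * x)"
    by (auto simp: gaussian_rv_def)
  have "distr P borel (\<lambda>y. - X y) = distr (distr P borel X) borel uminus"
    by (subst distr_distr) (auto simp: comp_def)
  also have "\<dots> = distr std_normal_distribution borel (\<lambda>x. - m + (- s) * x)"
    unfolding law by (subst distr_distr) (auto simp: comp_def)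
  finally have "distr P borel (\<lambda>y. - X y) = distr std_normal_distribution borel (\<lambda>x. - m + (- s) * x)" .
  then show ?thesis unfolding gaussian_rv_def by (intro conjI exI[of _ "- m"] exI[of _ "- s"]) simp_all
qed

lemma gaussian_rv_tail:
  assumes P: "prob_space P" and G: "gaussian_rv P X" and a: "0 < a" "a < 1 / 2"
    and x: "normal_quantile a * sqrt (prob_space.variance P X) \<le> x"
  shows "measure P {y \<in> space P. prob_space.expectation P X + x < X y} \<le> a"
proof -
  interpret prob_space P by fact
  interpret N: prob_space std_normal_distribution by (rule prob_space_std_normal)
  have X [measurable]: "X \<in> borel_measurable P" using G by (simp add: gaussian_rv_def)
  define m s where "m = expectation X" and "s = sqrt (variance X)"
  have s: "0 \<le> s" using variance_positive by (simp add: s_def)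
  have "measure P {y \<in> space P. m + x < X y} = measure (distr P borel X) {m + x<..}"
    by (subst measure_distr) (auto intro!: arg_cong2[where f=measure])
  also have "\<dots> = measure std_normal_distribution {v. x < s * v}"
    unfolding gaussian_rv_law[OF P G] s_def[symmetric] unfolding m_def[symmetric]
    by (subst measure_distr) (auto intro!: arg_cong2[where f=measure])
  also have "\<dots> \<le> measure std_normal_distribution {normal_quantile a<..}"
  proof (rule N.finite_measure_mono)
    show "{v. x < s * v} \<subseteq> {normal_quantile a<..}"
    proof safe
      fix v assume "x < s * v"
      then have "s * normal_quantile a < s * v" using x by (simp add: s_def mult.commute)
      \<comment> \<open>For \<open>s = 0\<close> the preceding strict inequality reads 0 < 0, so the
        event is empty.\<close>
      then show "normal_quantile a < v" using s mult_less_cancel_left_pos by (cases "s = 0") auto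
    qed
  qed simp
  also have "\<dots> = a" using a by (intro measure_std_normal_tail) auto
  finally show ?thesis by (simp add: m_def)
qed

lemma gaussian_rv_distr:
  assumes [measurable]: "g \<in> P \<rightarrow>\<^sub>M Q" "X \<in> borel_measurable Q"
  shows "gaussian_rv (distr P Q g) X \<longleftrightarrow> gaussian_rv P (\<lambda>x. X (g x))"
  by (simp add: gaussian_rv_def distr_distr comp_def)

text \<open>Independence factors the characteristic function over the coordinates; the product is
  that of a Gaussian law whose variance is the sum of the \<open>(c i)\<^sup>2\<close>.\<close>

lemma gaussian_rv_linear:
  assumes K: "finite K"
  shows "gaussian_rv (gaussian_measure K) (\<lambda>x. c0 + (\<Sum>i\<in>K. c i * x i))"
proof -
  interpret prob_space "gaussian_measure K" by (rule prob_space_gaussian_measure)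
  interpret N: product_prob_space "\<lambda>_::'a. std_normal_distribution"
    by (rule product_prob_space_std_normal)
  have [measurable]: "(\<lambda>x. c0 + (\<Sum>i\<in>K. c i * x i)) \<in> borel_measurable (gaussian_measure K)"
    by measurable
  have int: "integrable std_normal_distribution (\<lambda>x. iexp (t * c i * x))" for t i
    by (rule finite_measure.integrable_const_bound[OF prob_space.finite_measure[OF prob_space_std_normal], where B=1]) auto
  have "char (distr (gaussian_measure K) borel (\<lambda>x. c0 + (\<Sum>i\<in>K. c i * x i))) t =
     iexp (t * c0) * complex_of_real (exp (- ((sqrt (\<Sum>i\<in>K. (c i)\<^sup>2) * t)\<^sup>2) / 2))" for t
  proof -
    have "char (distr (gaussian_measure K) borel (\<lambda>x. c0 + (\<Sum>i\<in>K. c i * x i))) t =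
        (CLINT x|gaussian_measure K. iexp (t * c0) * (\<Prod>i\<in>K. iexp (t * c i * x i)))"
      unfolding char_def
      by (subst integral_distr)
         (auto intro!: Bochner_Integration.integral_cong
           simp: K exp_sum sum_distrib_left distrib_left mult.assoc simp flip: exp_add exp_sum)
    also have "\<dots> = iexp (t * c0) * (CLINT x|gaussian_measure K. (\<Prod>i\<in>K. iexp (t * c i * x i)))"
      by (rule Bochner_Integration.integral_mult_right_zero)
    also have "(CLINT x|gaussian_measure K. (\<Prod>i\<in>K. iexp (t * c i * x i))) =
       (\<Prod>i\<in>K. CLINT x|std_normal_distribution. iexp (t * c i * x))"
      using K int by (intro N.product_integral_prod) auto
    also have "\<dots> = (\<Prod>i\<in>K. char std_normal_distribution (t * c i))"
      by (simp add: char_def)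
    also have "\<dots> = complex_of_real (exp (\<Sum>i\<in>K. - ((t * c i)\<^sup>2) / 2))"
      using K by (simp add: char_std_normal_distribution exp_sum)
    also have "(\<Sum>i\<in>K. - ((t * c i)\<^sup>2) / 2) = - ((sqrt (\<Sum>i\<in>K. (c i)\<^sup>2) * t)\<^sup>2) / 2"
      by (simp add: power_mult_distrib sum_nonneg sum_negf sum_divide_distrib[symmetric] sum_distrib_left[symmetric])
    finally show ?thesis .
  qed
  then have "distr (gaussian_measure K) borel (\<lambda>x. c0 + (\<Sum>i\<in>K. c i * x i)) =
      distr std_normal_distribution borel (\<lambda>x. c0 + sqrt (\<Sum>i\<in>K. (c i)\<^sup>2) * x)"
    by (intro distr_std_normal_eqI real_distribution_distr) auto
  then show ?thesis unfolding gaussian_rv_def by auto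
qed

text \<open>The factor \<open>iexp y\<close> of modulus 1 can be pulled out. This Lipschitz bound
  turns closeness in L1 into closeness of characteristic functions.\<close>

lemma iexp_diff_le: "cmod (iexp x - iexp y) \<le> \<bar>x - y\<bar>"
proof -
  have "iexp x - iexp y = iexp y * (iexp (x - y) - 1)"
    by (simp add: algebra_simps flip: exp_add)
  then have "cmod (iexp x - iexp y) = cmod (iexp (x - y) - 1)"
    by (simp add: norm_mult)
  also have "\<dots> \<le> \<bar>x - y\<bar>" using iexp_approx1[of "x - y" 0] by simp
  finally show ?thesis .
qed

text \<open>Mean and second moment are continuous under mean square convergence, and the
  characteristic function of a Gaussian variable depends on these two alone. So the characteristic
  functions of the \<open>Y k\<close> converge to a Gaussian one, and by L1 convergence also to that
  of \<open>X\<close>. The filter is general because one model uses sequences of grids and the other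
  finite subsets of the index set.\<close>

lemma gaussian_rv_mean_square_limit:
  fixes X :: "'a \<Rightarrow> real" and Y :: "'k \<Rightarrow> 'a \<Rightarrow> real"
  assumes P: "prob_space P" and X [measurable]: "X \<in> borel_measurable P" and F: "F \<noteq> bot"
    and G: "\<forall>\<^sub>F k in F. gaussian_rv P (Y k)"
    and lim: "((\<lambda>k. \<integral>\<^sup>+y. ennreal ((X y - Y k y)\<^sup>2) \<partial>P) \<longlongrightarrow> 0) F"
  shows "gaussian_rv P X"
proof -
  interpret prob_space P by fact
  define U where "U k = (\<lambda>y. Y k y - X y)" for k
  \<comment> \<open>The bound 1 only serves to make the mean square distance finite, hence
    \<open>U k\<close> square integrable.\<close>
  have good: "\<forall>\<^sub>F k in F. gaussian_rv P (Y k) \<and> (\<integral>\<^sup>+y. ennreal ((X y - Y k y)\<^sup>2) \<partial>P) < 1"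
    using G order_tendstoD(2)[OF lim, of 1] by (auto elim: eventually_elim2)
  have basic: "Y k \<in> borel_measurable P \<and> integrable P (Y k) \<and> integrable P (\<lambda>y. (Y k y)\<^sup>2) \<and>
      integrable P (U k) \<and> integrable P (\<lambda>y. (U k y)\<^sup>2) \<and> 
      expectation (\<lambda>y. (U k y)\<^sup>2) = enn2real (\<integral>\<^sup>+y. ennreal ((X y - Y k y)\<^sup>2) \<partial>P)"
    if "gaussian_rv P (Y k) \<and> (\<integral>\<^sup>+y. ennreal ((X y - Y k y)\<^sup>2) \<partial>P) < 1" for k
  proof -
    from that obtain m s where [measurable]: "Y k \<in> borel_measurable P"
      and law: "distr P borel (Y k) = distr std_normal_distribution borel (\<lambda>x. m + s * x)"
      by (auto simp: gaussian_rv_def)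
    note mom = gaussian_rv_moments[OF P _ law]
    have eq: "(\<lambda>y. ennreal ((X y - Y k y)\<^sup>2)) = (\<lambda>y. ennreal ((U k y)\<^sup>2))"
      by (auto simp: U_def power2_commute)
    have U2: "integrable P (\<lambda>y. (U k y)\<^sup>2)"
      using that unfolding eq
      by (intro integrableI_nonneg) (auto simp: U_def less_trans[OF _ ennreal_one_less_top])
    have "integrable P (U k)" by (rule square_integrable_imp_integrable[OF _ U2]) (auto simp: U_def)
    moreover have "expectation (\<lambda>y. (U k y)\<^sup>2) = enn2real (\<integral>\<^sup>+y. ennreal ((X y - Y k y)\<^sup>2) \<partial>P)"
      unfolding eq by (rule integral_eq_nn_integral) (auto simp: U_def)
    ultimately show ?thesis using mom U2 by simp
  qed
  from good F obtain k0 where k0: "gaussian_rv P (Y k0) \<and> (\<integral>\<^sup>+y. ennreal ((X y - Y k0 y)\<^sup>2) \<partial>P) < 1"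
    using eventually_happens' by blast
  have X2: "integrable P (\<lambda>y. (X y)\<^sup>2)"
  proof (rule Bochner_Integration.integrable_bound)
    show "integrable P (\<lambda>y. 2 * (Y k0 y)\<^sup>2 + 2 * (U k0 y)\<^sup>2)" using basic[OF k0] by simp
    have "(X y)\<^sup>2 \<le> 2 * (Y k0 y)\<^sup>2 + 2 * (U k0 y)\<^sup>2" for y
      using zero_le_power2[of "Y k0 y + U k0 y"] unfolding U_def by (simp add: power2_eq_square algebra_simps)
    then show "AE y in P. norm ((X y)\<^sup>2) \<le> norm (2 * (Y k0 y)\<^sup>2 + 2 * (U k0 y)\<^sup>2)" by simp
  qed simp
  have X1: "integrable P X" by (rule square_integrable_imp_integrable[OF X X2])
  define e where "e k = expectation (\<lambda>y. (U k y)\<^sup>2)" for k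
  have "((\<lambda>k. enn2real (\<integral>\<^sup>+y. ennreal ((X y - Y k y)\<^sup>2) \<partial>P)) \<longlongrightarrow> enn2real 0) F"
    by (rule tendsto_enn2real) (use lim in simp_all)
  moreover have "\<forall>\<^sub>F k in F. enn2real (\<integral>\<^sup>+y. ennreal ((X y - Y k y)\<^sup>2) \<partial>P) = e k"
    using good by eventually_elim (use basic in \<open>simp add: e_def\<close>)
  ultimately have e0: "(e \<longlongrightarrow> 0) F"
    using Lim_transform_eventually by fastforce
  have se0: "((\<lambda>k. sqrt (e k)) \<longlongrightarrow> 0) F" using tendsto_real_sqrt[OF e0] by simp
  have U1: "expectation (\<lambda>y. \<bar>U k y\<bar>) \<le> sqrt (e k)"
    if "gaussian_rv P (Y k) \<and> (\<integral>\<^sup>+y. ennreal ((X y - Y k y)\<^sup>2) \<partial>P) < 1" for k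
  proof (rule real_le_rsqrt)
    have [measurable]: "U k \<in> borel_measurable P" using basic[OF that] by auto
    show "(expectation (\<lambda>y. \<bar>U k y\<bar>))\<^sup>2 \<le> e k"
      using Cauchy_Schwarz_integral(2)[of "\<lambda>y. \<bar>U k y\<bar>" P "\<lambda>_. 1"] basic[OF that]
      by (simp add: e_def prob_space)
  qed
  have m: "((\<lambda>k. expectation (Y k)) \<longlongrightarrow> expectation X) F"
  proof (rule Lim_null[THEN iffD2], rule Lim_null_comparison[OF _ se0])
    show "\<forall>\<^sub>F k in F. norm (expectation (Y k) - expectation X) \<le> sqrt (e k)"
      using good
    proof eventually_elim
      case (elim k)
      have "expectation (Y k) - expectation X = expectation (U k)"
        using basic[OF elim] X1 by (simp add: U_def)
      moreover have "\<bar>expectation (U k)\<bar> \<le> expectation (\<lambda>y. \<bar>U k y\<bar>)" by (rule integral_abs_bound)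
      ultimately show ?case using U1[OF elim] unfolding real_norm_def by linarith
    qed
  qed
  define r where "r = expectation (\<lambda>y. (X y)\<^sup>2)"
  \<comment> \<open>Expanding \<open>Y k = X + U k\<close> leaves \<open>e k\<close> and twice a
    cross term, which Cauchy-Schwarz bounds by \<open>sqrt r * sqrt (e k)\<close>.\<close>
  have m2: "((\<lambda>k. expectation (\<lambda>y. (Y k y)\<^sup>2)) \<longlongrightarrow> r) F"
  proof (rule Lim_null[THEN iffD2], rule Lim_null_comparison)
    show "((\<lambda>k. e k + 2 * (sqrt r * sqrt (e k))) \<longlongrightarrow> 0) F"
      using tendsto_add[OF e0 tendsto_mult[OF tendsto_const[of 2] tendsto_mult[OF tendsto_const[of "sqrt r"] se0]]] by simp
    show "\<forall>\<^sub>F k in F. norm (expectation (\<lambda>y. (Y k y)\<^sup>2) - r) \<le> e k + 2 * (sqrt r * sqrt (e k))"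
      using good
    proof eventually_elim
      case (elim k)
      have [measurable]: "U k \<in> borel_measurable P" using basic[OF elim] by auto
      have U2: "integrable P (\<lambda>y. (U k y)\<^sup>2)" using basic[OF elim] by simp
      have XU: "integrable P (\<lambda>y. X y * U k y)" by (rule Cauchy_Schwarz_integral(1)[OF _ _ X2 U2]) simp_all
      have "(expectation (\<lambda>y. X y * U k y))\<^sup>2 \<le> r * e k"
        unfolding r_def e_def by (rule Cauchy_Schwarz_integral(2)[OF _ _ X2 U2]) simp_all
      then have XU2: "\<bar>expectation (\<lambda>y. X y * U k y)\<bar> \<le> sqrt r * sqrt (e k)"
        by (metis real_sqrt_abs real_sqrt_le_iff real_sqrt_mult)
      have "(\<lambda>y. (Y k y)\<^sup>2) = (\<lambda>y. (X y)\<^sup>2 + 2 * (X y * U k y) + (U k y)\<^sup>2)"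
        by (auto simp: U_def power2_eq_square algebra_simps)
      then have "expectation (\<lambda>y. (Y k y)\<^sup>2) = r + 2 * expectation (\<lambda>y. X y * U k y) + e k"
        using X2 U2 XU by (simp add: r_def e_def)
      moreover have "0 \<le> e k" by (simp add: e_def)
      ultimately show ?case using XU2 unfolding real_norm_def by linarith
    qed
  qed
  define v where "v = r - (expectation X)\<^sup>2"
  have v: "((\<lambda>k. expectation (\<lambda>y. (Y k y)\<^sup>2) - (expectation (Y k))\<^sup>2) \<longlongrightarrow> v) F"
    unfolding v_def by (intro tendsto_intros m m2)
  have v0: "0 \<le> v" using variance_positive[of X] variance_eq[OF X1 X2] by (simp add: v_def r_def)
  have "char (distr P borel X) t = iexp (t * expectation X) * complex_of_real (exp (- ((sqrt v * t)\<^sup>2) / 2))" for t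
  proof (rule tendsto_unique[OF F])
    show "((\<lambda>k. char (distr P borel (Y k)) t) \<longlongrightarrow> char (distr P borel X) t) F"
    proof (rule Lim_null[THEN iffD2], rule Lim_null_comparison)
      show "((\<lambda>k. \<bar>t\<bar> * sqrt (e k)) \<longlongrightarrow> 0) F" using tendsto_mult_right_zero[OF se0] by simp
      show "\<forall>\<^sub>F k in F. norm (char (distr P borel (Y k)) t - char (distr P borel X) t) \<le> \<bar>t\<bar> * sqrt (e k)"
        using good
      proof eventually_elim
        case (elim k)
        have [measurable]: "Y k \<in> borel_measurable P" using basic[OF elim] by simp
        have iY: "integrable P (\<lambda>y. iexp (t * Y k y))" and iX: "integrable P (\<lambda>y. iexp (t * X y))"
          by (rule integrable_const_bound[where B=1]; simp)+
        have "char (distr P borel (Y k)) t - char (distr P borel X) t =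
            (CLINT y|P. iexp (t * Y k y) - iexp (t * X y))"
          using iX iY unfolding char_def by (simp add: integral_distr)
        also have "norm \<dots> \<le> (\<integral>y. norm (iexp (t * Y k y) - iexp (t * X y)) \<partial>P)"
          by (rule integral_norm_bound)
        also have "\<dots> \<le> (\<integral>y. \<bar>t\<bar> * \<bar>U k y\<bar> \<partial>P)"
        proof (rule integral_mono)
          show "norm (iexp (t * Y k y) - iexp (t * X y)) \<le> \<bar>t\<bar> * \<bar>U k y\<bar>" for y
            using iexp_diff_le[of "t * Y k y" "t * X y"] by (simp add: U_def abs_mult[symmetric] right_diff_distrib)
        qed (use basic[OF elim] iX iY in auto)
        also have "\<dots> \<le> \<bar>t\<bar> * sqrt (e k)" using U1[OF elim] by (simp add: mult_left_mono)
        finally show ?case .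
      qed
    qed
    have lim: "((\<lambda>k. iexp (t * expectation (Y k)) *
        complex_of_real (exp (- ((expectation (\<lambda>y. (Y k y)\<^sup>2) - (expectation (Y k))\<^sup>2) * t\<^sup>2) / 2)))
      \<longlongrightarrow> iexp (t * expectation X) * complex_of_real (exp (- (v * t\<^sup>2) / 2))) F"
      by (intro tendsto_intros m v) simp
    show "((\<lambda>k. char (distr P borel (Y k)) t)
      \<longlongrightarrow> iexp (t * expectation X) * complex_of_real (exp (- ((sqrt v * t)\<^sup>2) / 2))) F"
    proof (rule Lim_transform_eventually)
      show "((\<lambda>k. iexp (t * expectation (Y k)) *
        complex_of_real (exp (- ((expectation (\<lambda>y. (Y k y)\<^sup>2) - (expectation (Y k))\<^sup>2) * t\<^sup>2) / 2)))
      \<longlongrightarrow> iexp (t * expectation X) * complex_of_real (exp (- ((sqrt v * t)\<^sup>2) / 2))) F"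
        using lim v0 by (simp add: power_mult_distrib)
      show "\<forall>\<^sub>F k in F. iexp (t * expectation (Y k)) *
          complex_of_real (exp (- ((expectation (\<lambda>y. (Y k y)\<^sup>2) - (expectation (Y k))\<^sup>2) * t\<^sup>2) / 2)) =
          char (distr P borel (Y k)) t"
        using G
      proof eventually_elim
        case (elim k)
        then obtain m s where [measurable]: "Y k \<in> borel_measurable P"
          and law: "distr P borel (Y k) = distr std_normal_distribution borel (\<lambda>x. m + s * x)"
          by (auto simp: gaussian_rv_def)
        show ?case unfolding law char_std_normal_affine
          using gaussian_rv_moments[OF P _ law] by (simp add: power_mult_distrib)
      qed
    qed
  qed
  then have "distr P borel X = distr std_normal_distribution borel (\<lambda>x. expectation X + sqrt v * x)"
    by (intro distr_std_normal_eqI real_distribution_distr) auto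
  then show ?thesis using X unfolding gaussian_rv_def by blast
qed

section \<open>Two-point lower bounds and moduli\<close>

text \<open>The interface shared by both models. \<open>H\<close> holds the square integrable or
  square summable parameters and \<open>N\<close> is their norm;
  \<open>sqrt (real n) * N (g - f)\<close> is the distance of two parameters in units of the noise
  level. The bound in \<open>total_variation\<close> is the square root of the chi-square divergence
  of a Gaussian shift of this size.\<close>

locale shift_experiment =
  fixes D :: "'d measure" and P :: "('i \<Rightarrow> real) \<Rightarrow> 'd measure" and N :: "('i \<Rightarrow> real) \<Rightarrow> real"
    and H :: "('i \<Rightarrow> real) set" and n :: nat
  assumes n: "1 \<le> n"
    and prob_space_P: "f \<in> H \<Longrightarrow> prob_space (P f)"
    and sets_P: "sets (P f) = sets D"
    and total_variation: "\<lbrakk>f \<in> H; g \<in> H; A \<in> sets D\<rbrakk> \<Longrightarrow>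
      \<bar>measure (P f) A - measure (P g) A\<bar> \<le> sqrt (exp ((sqrt (real n) * N (g - f))\<^sup>2) - 1)"
    and norm_scaleR: "N (c *\<^sub>R f) = \<bar>c\<bar> * N f"
begin

lemma space_P: "space (P f) = space D"
  by (rule sets_eq_imp_space_eq[OF sets_P])

lemma norm_zero: "N 0 = 0"
  using norm_scaleR[of 0 0] by simp

lemma norm_minus_commute: "N (f - g) = N (g - f)"
  using norm_scaleR[of "-1" "g - f"] by simp

end

text \<open>The between class modulus as a single supremum. Absolute values treat both orders at
  once, and in \<open>ennreal\<close> infinite moduli can be multiplied by constants like finite
  ones.\<close>

definition abs_modulus ::
  "(('i \<Rightarrow> real) \<Rightarrow> real) \<Rightarrow> (('i \<Rightarrow> real) \<Rightarrow> real) \<Rightarrow> real \<Rightarrow> ('i \<Rightarrow> real) set \<Rightarrow> ('i \<Rightarrow> real) set \<Rightarrow> ennreal"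
  where
  "abs_modulus N T \<epsilon> F G = (SUP (f, g)\<in>{(f, g). f \<in> F \<and> g \<in> G \<and> N (g - f) \<le> \<epsilon>}. ennreal \<bar>T g - T f\<bar>)"

text \<open>Since \<open>N\<close> is symmetric, the two ordered moduli are the suprema of
  \<open>T g - T f\<close> and of \<open>T f - T g\<close> over the same pairs, so their maximum is
  the supremum of the absolute values. If there are no pairs, \<open>e2ennreal\<close> sends the
  supremum of the empty set, minus infinity, to 0.\<close>

lemma (in shift_experiment) between_modulus_eq:
  "e2ennreal (between_modulus N T \<epsilon> F G) = abs_modulus N T \<epsilon> F G"
proof (rule antisym)
  let ?S = "abs_modulus N T \<epsilon> F G"
  have le: "ereal x \<le> enn2ereal ?S" if "ennreal \<bar>x\<bar> \<le> ?S" for x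
  proof -
    have "ereal x \<le> ereal \<bar>x\<bar>" by simp
    also have "\<dots> = enn2ereal (ennreal \<bar>x\<bar>)" by (simp add: enn2ereal_ennreal)
    also have "\<dots> \<le> enn2ereal ?S" using that by (simp add: less_eq_ennreal.rep_eq)
    finally show ?thesis .
  qed
  have "between_modulus N T \<epsilon> F G \<le> enn2ereal ?S"
    unfolding between_modulus_def ordered_modulus_def
  proof (intro max.boundedI Sup_least)
    fix v assume "v \<in> {ereal (T g - T f) |f g. N (g - f) \<le> \<epsilon> \<and> f \<in> F \<and> g \<in> G}"
    then obtain f g where v: "v = ereal (T g - T f)" "N (g - f) \<le> \<epsilon>" "f \<in> F" "g \<in> G" by auto
    then show "v \<le> enn2ereal ?S" unfolding v(1)
      by (intro le) (auto simp: abs_modulus_def intro!: SUP_upper2[of "(f, g)"])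
  next
    fix v assume "v \<in> {ereal (T g - T f) |f g. N (g - f) \<le> \<epsilon> \<and> f \<in> G \<and> g \<in> F}"
    then obtain f g where v: "v = ereal (T g - T f)" "N (g - f) \<le> \<epsilon>" "f \<in> G" "g \<in> F" by auto
    then show "v \<le> enn2ereal ?S" unfolding v(1)
      by (intro le) (auto simp: abs_modulus_def norm_minus_commute abs_minus_commute intro!: SUP_upper2[of "(g, f)"])
  qed
  then have "e2ennreal (between_modulus N T \<epsilon> F G) \<le> e2ennreal (enn2ereal ?S)"
    by (rule e2ennreal_mono)
  then show "e2ennreal (between_modulus N T \<epsilon> F G) \<le> ?S" by simp
next
  show "abs_modulus N T \<epsilon> F G \<le> e2ennreal (between_modulus N T \<epsilon> F G)"
    unfolding abs_modulus_def
  proof (rule SUP_least, clarify)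
    fix f g assume fg: "f \<in> F" "g \<in> G" "N (g - f) \<le> \<epsilon>"
    have 1: "ereal (T g - T f) \<le> between_modulus N T \<epsilon> F G"
      unfolding between_modulus_def ordered_modulus_def using fg
      by (intro max.coboundedI1 Sup_upper) auto
    have 2: "ereal (T f - T g) \<le> between_modulus N T \<epsilon> F G"
      unfolding between_modulus_def ordered_modulus_def using fg norm_minus_commute[of f g]
      by (intro max.coboundedI2 Sup_upper CollectI exI[of _ g] exI[of _ f]) auto
    have "ereal \<bar>T g - T f\<bar> \<le> between_modulus N T \<epsilon> F G"
      using 1 2 by (simp add: abs_if)
    then have "e2ennreal (ereal \<bar>T g - T f\<bar>) \<le> e2ennreal (between_modulus N T \<epsilon> F G)"
      by (rule e2ennreal_mono)
    then show "ennreal \<bar>T g - T f\<bar> \<le> e2ennreal (between_modulus N T \<epsilon> F G)"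
      by (simp add: ennreal.abs_eq[symmetric])
  qed
qed

text \<open>Contracting both parameters towards a common point of the two spaces divides the distance
  and the increment of the functional by the same factor.\<close>

lemma (in shift_experiment) abs_modulus_scale:
  assumes T: "linear_functional_on V T" and F: "\<forall>i\<in>{1,2::nat}. F i \<subseteq> V \<inter> H \<and> convex (F i)"
    and p: "p \<in> F 1 \<inter> F 2" and j: "j \<in> {1,2}" and c: "0 < c" and e: "0 \<le> \<epsilon>"
  shows "abs_modulus N T (c * \<epsilon>) (F j) (F 1 \<union> F 2) \<le>
    ennreal (max 1 c) * abs_modulus N T \<epsilon> (F j) (F 1 \<union> F 2)"
  unfolding abs_modulus_def[of N T "c * \<epsilon>"]
proof (rule SUP_least, clarify)
  fix f g assume f: "f \<in> F j" and g: "g \<in> F 1 \<union> F 2" and d: "N (g - f) \<le> c * \<epsilon>"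
  \<comment> \<open>The contraction weight \<open>1 / m\<close> must not exceed 1 for
    \<open>h x\<close> to be a convex combination. For \<open>c < 1\<close> nothing is contracted,
    and the pair already lies within the larger radius.\<close>
  define m where "m = max 1 c"
  define h where "h x = (1 - 1 / m) *\<^sub>R p + (1 / m) *\<^sub>R x" for x
  have m: "1 \<le> m" "0 < m" "c \<le> m" by (auto simp: m_def)
  from g obtain i where i: "i \<in> {1,2}" "g \<in> F i" by auto
  have hF: "h x \<in> F i" if "x \<in> F i" "i \<in> {1,2}" for x i
    using that F p m unfolding h_def by (auto intro!: convexD)
  have "h g - h f = (1 / m) *\<^sub>R (g - f)" by (simp add: h_def scaleR_right_diff_distrib)
  then have "N (h g - h f) = N (g - f) / m" using m by (simp add: norm_scaleR)
  also have "\<dots> \<le> \<epsilon>"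
    using d m mult_right_mono[OF m(3) e] by (simp add: divide_le_eq mult.commute)
  finally have Nh: "N (h g - h f) \<le> \<epsilon>" .
  have V: "subspace V" and p: "p \<in> V" and fV: "f \<in> V" and gV: "g \<in> V"
    using T F p f i j by (auto simp: linear_functional_on_def)
  have Th: "T (h x) = (1 - 1 / m) * T p + 1 / m * T x" if "x \<in> V" for x
    using T that p V unfolding linear_functional_on_def h_def by (simp add: subspace_scale)
  have "T g - T f = m * (T (h g) - T (h f))"
    using m Th[OF fV] Th[OF gV] by (simp add: field_simps)
  then have "ennreal \<bar>T g - T f\<bar> = ennreal m * ennreal \<bar>T (h g) - T (h f)\<bar>"
    using m by (simp add: abs_mult ennreal_mult)
  also have "\<dots> \<le> ennreal m * abs_modulus N T \<epsilon> (F j) (F 1 \<union> F 2)"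
    unfolding abs_modulus_def using Nh hF[OF f j] hF[OF i(2,1)] i
    by (intro mult_left_mono SUP_upper2[of "(h f, h g)"]) auto
  finally show "ennreal \<bar>T g - T f\<bar> \<le> ennreal (max 1 c) * abs_modulus N T \<epsilon> (F j) (F 1 \<union> F 2)"
    by (simp add: m_def)
qed

text \<open>If the laws at \<open>f\<close> and \<open>g\<close> differ by at most \<delta>, both
  values are covered under \<open>f\<close> with probability at least (1 - \<alpha>) + (1 - \<alpha>
  - \<delta>) - 1 = 1 - 2\<alpha> - \<delta>. Half of 1 - 2\<alpha> is allotted to \<delta>, and the
  same amount remains.\<close>

definition detection_gap :: "real \<Rightarrow> real" where
  "detection_gap \<alpha> = (1 - 2 * \<alpha>) / 2"

text \<open>The distance, in units of the noise level, at which the total variation bound equals the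
  gap.\<close>

definition detection_radius :: "real \<Rightarrow> real" where
  "detection_radius \<alpha> = sqrt (ln (1 + (detection_gap \<alpha>)\<^sup>2))"

lemma detection_gap_pos: "\<alpha> < 1 / 2 \<Longrightarrow> 0 < detection_gap \<alpha>"
  by (simp add: detection_gap_def)

lemma detection_radius_pos: "\<alpha> < 1 / 2 \<Longrightarrow> 0 < detection_radius \<alpha>"
  using detection_gap_pos[of \<alpha>] unfolding detection_radius_def
  by (intro real_sqrt_gt_zero ln_gt_zero) simp

lemma detection_radius: "\<alpha> < 1 / 2 \<Longrightarrow> sqrt (exp ((detection_radius \<alpha>)\<^sup>2) - 1) = detection_gap \<alpha>"
proof -
  assume "\<alpha> < 1 / 2"
  then have "0 < detection_gap \<alpha>" by (rule detection_gap_pos)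
  moreover from this have "0 < 1 + (detection_gap \<alpha>)\<^sup>2" by (simp add: add_pos_nonneg)
  ultimately show ?thesis by (simp add: detection_radius_def)
qed

text \<open>An interval that contains both \<open>T f\<close> and \<open>T g\<close> is at least as
  long as their distance. Coverage of \<open>T g\<close> is guaranteed under \<open>g\<close>; the
  total variation bound transfers it to \<open>f\<close>, where it meets the coverage of
  \<open>T f\<close>.\<close>

lemma (in shift_experiment) expected_length_lower_bound:
  assumes a: "\<alpha> < 1 / 2" and CI: "CI \<in> confidence_intervals D P T \<alpha> F" and F: "F \<subseteq> H"
    and f: "f \<in> F" and g: "g \<in> F"
    and d: "N (g - f) \<le> detection_radius \<alpha> / sqrt (real n)" and d0: "0 \<le> N (g - f)"
  shows "ennreal (detection_gap \<alpha>) * ennreal \<bar>T g - T f\<bar> \<le> (\<integral>\<^sup>+y. emeasure lborel (CI y) \<partial>P f)"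
proof -
  interpret prob_space "P f" using f F by (intro prob_space_P) auto
  have iv: "is_interval (CI y)" if "y \<in> space D" for y
    using CI that unfolding confidence_intervals_def random_interval_def by auto
  have m [measurable]: "{y \<in> space D. t \<in> CI y} \<in> sets D" for t
    using CI unfolding confidence_intervals_def random_interval_def by auto
  have cov: "1 - \<alpha> \<le> measure (P h) {y \<in> space D. T h \<in> CI y}" if "h \<in> F" for h
  proof -
    have "1 - \<alpha> \<le> (INF f\<in>F. measure (P f) {y \<in> space (P f). T f \<in> CI y})"
      using CI unfolding confidence_intervals_def by simp
    also have "\<dots> \<le> measure (P h) {y \<in> space (P h). T h \<in> CI y}"
      using that by (intro cINF_lower bdd_belowI2[where m=0]) auto
    finally show ?thesis by (simp add: space_P)
  qed
  have "(sqrt (real n) * N (g - f))\<^sup>2 \<le> (detection_radius \<alpha>)\<^sup>2"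
    using d d0 n by (intro power_mono) (simp_all add: field_simps)
  then have "sqrt (exp ((sqrt (real n) * N (g - f))\<^sup>2) - 1) \<le> detection_gap \<alpha>"
    using detection_radius[OF a] by (metis diff_right_mono exp_le_cancel_iff real_sqrt_le_iff)
  moreover have "\<bar>measure (P f) {y \<in> space D. T g \<in> CI y} - measure (P g) {y \<in> space D. T g \<in> CI y}\<bar>
      \<le> sqrt (exp ((sqrt (real n) * N (g - f))\<^sup>2) - 1)"
    using f g F m by (intro total_variation) auto
  ultimately have g': "1 - \<alpha> - detection_gap \<alpha> \<le> prob {y \<in> space D. T g \<in> CI y}"
    using cov[OF g] by linarith
  define B where "B = {y \<in> space D. T f \<in> CI y} \<inter> {y \<in> space D. T g \<in> CI y}"
  have B: "B \<in> sets (P f)" unfolding B_def sets_P by measurable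
  have "prob ({y \<in> space D. T f \<in> CI y} \<union> {y \<in> space D. T g \<in> CI y}) =
     prob {y \<in> space D. T f \<in> CI y} + prob {y \<in> space D. T g \<in> CI y} - prob B"
    unfolding B_def by (rule measure_Un3) (auto simp: fmeasurable_eq_sets sets_P m)
  \<comment> \<open>The arithmetic of inclusion-exclusion: coverage 1 - \<alpha> of one value and 1
    - \<alpha> minus the gap of the other, less a union of probability at most 1, leaves the
    gap.\<close>
  moreover have "(1 - 2 * \<alpha>) / 2 \<le> v"
    if "u = s + t - v" "1 - \<alpha> \<le> s" "1 - \<alpha> - (1 - 2 * \<alpha>) / 2 \<le> t" "u \<le> 1" for s t u v :: real
    using that by (simp add: field_simps)
  ultimately have "prob B \<ge> detection_gap \<alpha>"
    using cov[OF f] g' prob_le_1 unfolding detection_gap_def by blast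
  then have "ennreal (detection_gap \<alpha>) * ennreal \<bar>T g - T f\<bar> \<le> emeasure (P f) B * ennreal \<bar>T g - T f\<bar>"
    by (intro mult_right_mono) (auto simp: emeasure_eq_measure)
  also have "\<dots> = (\<integral>\<^sup>+y. ennreal \<bar>T g - T f\<bar> * indicator B y \<partial>P f)"
    using B by (subst nn_integral_cmult_indicator) (simp_all add: mult.commute)
  also have "\<dots> \<le> (\<integral>\<^sup>+y. emeasure lborel (CI y) \<partial>P f)"
  proof (rule nn_integral_mono)
    fix y assume y: "y \<in> space (P f)"
    show "ennreal \<bar>T g - T f\<bar> * indicator B y \<le> emeasure lborel (CI y)"
    proof (cases "y \<in> B")
      case True
      have ivy: "is_interval (CI y)" using iv y by (simp add: space_P)
      have "{min (T f) (T g)..max (T f) (T g)} \<subseteq> CI y"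
        using True ivy unfolding B_def is_interval_1 by (auto simp: min_def max_def split: if_splits)
      then have "emeasure lborel {min (T f) (T g)..max (T f) (T g)} \<le> emeasure lborel (CI y)"
        using real_interval_borel_measurable[OF ivy] by (intro emeasure_mono) auto
      then show ?thesis using True by (auto simp: min_def max_def abs_if split: if_splits)
    qed simp
  qed
  finally show ?thesis .
qed

section \<open>The adaptive interval\<close>

lemma ereal_half: "(1 / 2 :: ereal) = ereal (1 / 2)" "(3 / 2 :: ereal) = ereal (3 / 2)"
  by (simp_all add: one_ereal_def numeral_eq_ereal)

text \<open>For a finite modulus the constraints become inequalities between reals. The bias is
  bounded below on \<open>F j\<close> and above on \<open>F i\<close>; this asymmetry decides which
  estimator serves at which end of an interval.\<close>

lemma balanced_estimatorD:
  assumes S: "balanced_estimator P T F \<beta> \<omega> i j S" and w: "\<omega> i j = ereal w"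
    and z: "0 < normal_quantile (\<beta> / 2)"
  shows "f \<in> F 1 \<union> F 2 \<Longrightarrow> prob_space.variance (P f) S \<le> (w / normal_quantile (\<beta> / 2))\<^sup>2"
    and "f \<in> F j \<Longrightarrow> - (w / 2) \<le> prob_space.expectation (P f) S - T f"
    and "f \<in> F i \<Longrightarrow> prob_space.expectation (P f) S - T f \<le> w / 2"
proof -
  show "prob_space.variance (P f) S \<le> (w / normal_quantile (\<beta> / 2))\<^sup>2" if "f \<in> F 1 \<union> F 2"
  proof -
    have "ereal (prob_space.variance (P f) S) \<le> (\<omega> i j)\<^sup>2 / ereal ((normal_quantile (\<beta> / 2))\<^sup>2)"
      using S that unfolding balanced_estimator_def by blast
    then show ?thesis using z w by (simp add: power_divide)
  qed
  show "- (w / 2) \<le> prob_space.expectation (P f) S - T f" if "f \<in> F j"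
  proof -
    have "- (1/2 * \<omega> i j) \<le> (INF f\<in>F j. ereal (prob_space.expectation (P f) S - T f))"
      using S unfolding balanced_estimator_def by blast
    also have "\<dots> \<le> ereal (prob_space.expectation (P f) S - T f)" using that by (rule INF_lower)
    finally show ?thesis unfolding w ereal_half by simp
  qed
  show "prob_space.expectation (P f) S - T f \<le> w / 2" if "f \<in> F i"
  proof -
    have "ereal (prob_space.expectation (P f) S - T f) \<le> (SUP f\<in>F i. ereal (prob_space.expectation (P f) S - T f))"
      using that by (rule SUP_upper)
    also have "\<dots> \<le> 1/2 * \<omega> i j"
      using S unfolding balanced_estimator_def by blast
    finally show ?thesis unfolding w ereal_half by simp
  qed
qed

text \<open>Four terms, two estimators at each end. Each contributes 2 moduli, namely the margin 3/2
  and the bias 1/2, and a mean absolute deviation of at most the modulus divided by z. The level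
  \<open>\<alpha> / 2 / 2\<close> is \<beta>/2 for \<beta> = \<alpha>/2.\<close>

definition length_factor :: "real \<Rightarrow> real" where
  "length_factor \<alpha> = 4 * (2 + 1 / normal_quantile (\<alpha> / 2 / 2))"

text \<open>The length on \<open>F j\<close> is at most \<open>length_factor\<close> times the
  modulus at radius z; the maximum moves that modulus to the detection radius, where the length of
  every confidence interval is at least the gap times the modulus.\<close>

definition adaptation_constant :: "real \<Rightarrow> real" where
  "adaptation_constant \<alpha> = length_factor \<alpha> *
     max 1 (normal_quantile (\<alpha> / 2 / 2) / detection_radius \<alpha>) / detection_gap \<alpha>"

text \<open>A fixed sample size. The estimators enter through Gaussianity under every parameter in
  \<open>H\<close> instead of linearity, so that both models are instances. \<open>V\<close> is
  where \<open>T\<close> is linear, \<open>H\<close> where the laws of the data are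
  controlled.\<close>

locale adaptive_interval = shift_experiment D P N H n
  for D :: "'d measure" and P :: "('i \<Rightarrow> real) \<Rightarrow> 'd measure" and N H n +
  fixes V T and F :: "nat \<Rightarrow> ('i \<Rightarrow> real) set" and \<alpha> :: real
    and S :: "nat \<Rightarrow> nat \<Rightarrow> 'd \<Rightarrow> real"
  assumes alpha: "0 < \<alpha>" "\<alpha> < 1 / 2"
    and linear: "linear_functional_on V T"
    and spaces: "\<forall>i\<in>{1,2}. F i \<subseteq> V \<inter> H \<and> convex (F i)"
    and common: "F 1 \<inter> F 2 \<noteq> {}"
    and norm_nonneg: "0 \<le> N f"
    and measurable_S: "\<lbrakk>i \<in> {1,2}; j \<in> {1,2}\<rbrakk> \<Longrightarrow> S i j \<in> borel_measurable D"
    and gaussian_S: "\<lbrakk>i \<in> {1,2}; j \<in> {1,2}; f \<in> H\<rbrakk> \<Longrightarrow> gaussian_rv (P f) (S i j)"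
    and balanced: "\<lbrakk>i \<in> {1,2}; j \<in> {1,2}\<rbrakk> \<Longrightarrow>
      balanced_estimator P T F (\<alpha> / 2) (pair_modulus N T F n (\<alpha> / 2)) i j (S i j)"
begin

text \<open>The intervals have level \<beta> = \<alpha>/2 and are built with the quantile at
  \<beta>/2, so this is the quantile at \<alpha>/4.\<close>

abbreviation z where "z \<equiv> normal_quantile (\<alpha> / 2 / 2)"
abbreviation \<omega> where "\<omega> \<equiv> pair_modulus N T F n (\<alpha> / 2)"
abbreviation CI where "CI \<equiv> CI_adaptive \<omega> S"
abbreviation M where "M \<epsilon> j \<equiv> abs_modulus N T (\<epsilon> / sqrt (real n)) (F j) (F 1 \<union> F 2)"

lemma z_pos: "0 < z"
  using alpha by (intro normal_quantile_pos) auto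

lemma F_subset: "F 1 \<union> F 2 \<subseteq> H"
  using spaces by auto

lemma prob_F: "f \<in> F 1 \<union> F 2 \<Longrightarrow> prob_space (P f)"
  using F_subset by (intro prob_space_P) auto

text \<open>A common point of the two spaces, paired with itself, contributes the value 0. This
  excludes minus infinity, so a modulus is either infinite or a nonnegative real.\<close>

lemma modulus_nonneg: "i \<in> {1,2} \<Longrightarrow> j \<in> {1,2} \<Longrightarrow> 0 \<le> \<omega> i j"
proof -
  assume ij: "i \<in> {1,2}" "j \<in> {1,2}"
  from common obtain p where "p \<in> F 1 \<inter> F 2" by auto
  with ij have p: "p \<in> F i" "p \<in> F j" by auto
  have "0 \<le> z / sqrt (real n)" using z_pos by simp
  then show ?thesis unfolding pair_modulus_def ordered_modulus_def
    using p norm_zero by (intro Sup_upper2[of "ereal (T p - T p)"] CollectI exI[of _ p]) auto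
qed

lemma modulus_cases:
  assumes "i \<in> {1,2}" "j \<in> {1,2}"
  obtains "\<omega> i j = \<infinity>" | w where "\<omega> i j = ereal w" "0 \<le> w"
  using modulus_nonneg[OF assms] by (cases "\<omega> i j") auto

section \<open>Coverage\<close>

lemma sd_le:
  assumes ij: "i \<in> {1,2}" "j \<in> {1,2}" and f: "f \<in> F 1 \<union> F 2" and w: "\<omega> i j = ereal w"
  shows "sqrt (prob_space.variance (P f) (S i j)) \<le> w / z"
proof -
  have "0 \<le> w" using modulus_nonneg[OF ij] w by simp
  then show ?thesis
    using balanced_estimatorD(1)[where T=T, OF balanced[OF ij] w z_pos f] z_pos
    by (intro real_le_lsqrt) simp_all
qed

text \<open>With an infinite modulus the lower end is minus infinity and the event is empty.
  Otherwise the bias on \<open>F i\<close> is at most half the modulus w, so a miss forces the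
  estimator above its mean by more than 3/2 w - 1/2 w = w, which is at least \<open>z\<close>
  standard deviations.\<close>

lemma lower_end:
  assumes ij: "i \<in> {1,2}" "j \<in> {1,2}" and f: "f \<in> F i"
  shows "measure (P f) {y \<in> space (P f). ereal (T f) < ereal (S i j y) - 3/2 * \<omega> i j} \<le> \<alpha> / 2 / 2"
proof -
  have f': "f \<in> F 1 \<union> F 2" using ij f by auto
  interpret prob_space "P f" by (rule prob_F[OF f'])
  show ?thesis using ij
  proof (cases rule: modulus_cases)
    case 1
    then show ?thesis using alpha by (simp add: ereal_half)
  next
    case (2 w)
    have "prob {y \<in> space (P f). ereal (T f) < ereal (S i j y) - 3/2 * \<omega> i j} \<le>
        prob {y \<in> space (P f). expectation (S i j) + w < S i j y}"
    proof (rule finite_measure_mono)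
      show "{y \<in> space (P f). expectation (S i j) + w < S i j y} \<in> events"
        using measurable_S[OF ij] sets_P[of f] by measurable
      show "{y \<in> space (P f). ereal (T f) < ereal (S i j y) - 3/2 * \<omega> i j} \<subseteq>
         {y \<in> space (P f). expectation (S i j) + w < S i j y}"
        using balanced_estimatorD(3)[OF balanced[OF ij] 2(1) z_pos f]
        by (auto simp: 2(1) ereal_half)
    qed
    also have "\<dots> \<le> \<alpha> / 2 / 2"
    proof (rule gaussian_rv_tail)
      show "gaussian_rv (P f) (S i j)" using gaussian_S[OF ij] F_subset f' by auto
      show "z * sqrt (variance (S i j)) \<le> w"
        using sd_le[OF ij f' 2(1)] z_pos by (simp add: pos_le_divide_eq mult.commute)
    qed (use alpha in \<open>auto intro: prob_space_axioms\<close>)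
    finally show ?thesis .
  qed
qed

text \<open>The mirror image, applied to the negated estimator. The class of \<open>f\<close> is now
  the second index, since the bias of \<open>S j i\<close> is bounded below on
  \<open>F i\<close>.\<close>

lemma upper_end:
  assumes ij: "j \<in> {1,2}" "i \<in> {1,2}" and f: "f \<in> F i"
  shows "measure (P f) {y \<in> space (P f). ereal (S j i y) + 3/2 * \<omega> j i < ereal (T f)} \<le> \<alpha> / 2 / 2"
proof -
  have f': "f \<in> F 1 \<union> F 2" using ij f by auto
  interpret prob_space "P f" by (rule prob_F[OF f'])
  show ?thesis using ij
  proof (cases rule: modulus_cases)
    case 1
    then show ?thesis using alpha by (simp add: ereal_half)
  next
    case (2 w)
    have "prob {y \<in> space (P f). ereal (S j i y) + 3/2 * \<omega> j i < ereal (T f)} \<le>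
        prob {y \<in> space (P f). expectation (\<lambda>y. - S j i y) + w < - S j i y}"
    proof (rule finite_measure_mono)
      show "{y \<in> space (P f). expectation (\<lambda>y. - S j i y) + w < - S j i y} \<in> events"
        using measurable_S[OF ij] sets_P[of f] by measurable
      show "{y \<in> space (P f). ereal (S j i y) + 3/2 * \<omega> j i < ereal (T f)} \<subseteq>
         {y \<in> space (P f). expectation (\<lambda>y. - S j i y) + w < - S j i y}"
        using balanced_estimatorD(2)[OF balanced[OF ij] 2(1) z_pos f]
        by (auto simp: 2(1) ereal_half)
    qed
    also have "\<dots> \<le> \<alpha> / 2 / 2"
    proof (rule gaussian_rv_tail)
      show "gaussian_rv (P f) (\<lambda>y. - S j i y)"
        using gaussian_S[OF ij] F_subset f' by (intro gaussian_rv_uminus) auto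
      have "variance (\<lambda>y. - S j i y) = variance (S j i)"
        by (simp add: power2_commute)
      then show "z * sqrt (variance (\<lambda>y. - S j i y)) \<le> w"
        using sd_le[OF ij f' 2(1)] z_pos by (simp add: pos_le_divide_eq mult.commute)
    qed (use alpha in \<open>auto intro: prob_space_axioms\<close>)
    finally show ?thesis .
  qed
qed

lemma random_interval_CI: "random_interval D CI"
  unfolding random_interval_def
proof safe
  \<comment> \<open>The bounds are extended reals because an infinite modulus sends an end point to
    infinity.\<close>
  have iv: "is_interval {x. l \<le> ereal x \<and> ereal x \<le> u}" for l u
    unfolding is_interval_1
  proof safe
    fix a b x :: real
    assume "a \<le> x" "x \<le> b"
    then have "ereal a \<le> ereal x" "ereal x \<le> ereal b" by simp_all
    then show "l \<le> ereal a \<Longrightarrow> l \<le> ereal x" "ereal b \<le> u \<Longrightarrow> ereal x \<le> u"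
      by (blast intro: order_trans)+
  qed
  fix y show "is_interval (CI y)"
    unfolding CI_adaptive_def CI_star_def by (intro is_interval_Int iv)
next
  fix t :: real
  have [measurable]: "S 1 1 \<in> borel_measurable D" "S 1 2 \<in> borel_measurable D"
    "S 2 1 \<in> borel_measurable D" "S 2 2 \<in> borel_measurable D"
    using measurable_S by auto
  show "{y \<in> space D. t \<in> CI y} \<in> sets D"
    unfolding CI_adaptive_def CI_star_def by (simp del: One_nat_def) measurable
qed

text \<open>In each interval the minimum and the maximum run over both classes, hence include the
  class \<open>i\<close> of \<open>f\<close>. A miss therefore implies one of the four tail events
  with that index, two for each interval \<open>j\<close>, and the union bound gives 4 times
  \<alpha>/4.\<close>

lemma coverage:
  assumes f: "f \<in> F 1 \<union> F 2"
  shows "1 - \<alpha> \<le> measure (P f) {y \<in> space (P f). T f \<in> CI y}"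
proof -
  interpret prob_space "P f" by (rule prob_F[OF f])
  from f obtain i where i: "i \<in> {1,2}" "f \<in> F i" by auto
  have [measurable]: "S k l \<in> borel_measurable (P f)" if "k \<in> {1,2}" "l \<in> {1,2}" for k l
    using measurable_S[OF that] sets_P[of f] by (simp cong: measurable_cong_sets)
  define A where "A j = {y \<in> space (P f). ereal (T f) < ereal (S i j y) - 3/2 * \<omega> i j}" for j
  define B where "B j = {y \<in> space (P f). ereal (S j i y) + 3/2 * \<omega> j i < ereal (T f)}" for j
  have AB [measurable]: "A j \<in> events" "B j \<in> events" if "j \<in> {1,2}" for j
    using that i(1) unfolding A_def B_def by measurable
  have E: "{y \<in> space (P f). T f \<in> CI y} \<in> events"
    using random_interval_CI unfolding random_interval_def sets_P space_P by simp
  have "prob (space (P f) - {y \<in> space (P f). T f \<in> CI y}) \<le> prob ((A 1 \<union> A 2) \<union> (B 1 \<union> B 2))"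
  proof (rule finite_measure_mono)
    show "space (P f) - {y \<in> space (P f). T f \<in> CI y} \<subseteq> (A 1 \<union> A 2) \<union> (B 1 \<union> B 2)"
      using i(1) by (auto simp: A_def B_def CI_adaptive_def CI_star_def not_le min_le_iff_disj le_max_iff_disj)
  qed (use AB in auto)
  also have "\<dots> \<le> prob (A 1 \<union> A 2) + prob (B 1 \<union> B 2)"
    using AB by (intro measure_Un_le) auto
  also have "\<dots> \<le> (prob (A 1) + prob (A 2)) + (prob (B 1) + prob (B 2))"
    using AB by (intro add_mono measure_Un_le) auto
  also have "\<dots> \<le> (\<alpha> / 2 / 2 + \<alpha> / 2 / 2) + (\<alpha> / 2 / 2 + \<alpha> / 2 / 2)"
    unfolding A_def B_def using i by (intro add_mono lower_end upper_end) auto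
  finally show ?thesis using prob_compl[OF E] by simp
qed

lemma CI_confidence: "CI \<in> confidence_intervals D P T \<alpha> (F 1 \<union> F 2)"
  unfolding confidence_intervals_def
  using random_interval_CI coverage common by (auto intro!: cINF_greatest)

section \<open>Expected length of the adaptive interval\<close>

lemma pair_modulus_le:
  assumes "i \<in> {1,2}" "j \<in> {1,2}"
  shows "e2ennreal (\<omega> j i) \<le> M z j" "e2ennreal (\<omega> i j) \<le> M z j"
proof -
  have "\<omega> j i \<le> between_modulus N T (z / sqrt (real n)) (F j) (F 1 \<union> F 2)"
    unfolding between_modulus_def pair_modulus_def ordered_modulus_def
    using assms by (intro max.coboundedI1 Sup_subset_mono) auto
  then show "e2ennreal (\<omega> j i) \<le> M z j"
    unfolding between_modulus_eq[symmetric] by (rule e2ennreal_mono)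
  have "\<omega> i j \<le> between_modulus N T (z / sqrt (real n)) (F j) (F 1 \<union> F 2)"
    unfolding between_modulus_def pair_modulus_def ordered_modulus_def
    using assms by (intro max.coboundedI2 Sup_subset_mono) auto
  then show "e2ennreal (\<omega> i j) \<le> M z j"
    unfolding between_modulus_eq[symmetric] by (rule e2ennreal_mono)
qed

abbreviation K where "K \<equiv> length_factor \<alpha>"

lemma K_pos: "0 < K"
  using z_pos by (simp add: length_factor_def add_pos_pos)

text \<open>The mean absolute deviation is at most the standard deviation, by Cauchy-Schwarz against
  the constant 1.\<close>

lemma expected_deviation:
  assumes ij: "i \<in> {1,2}" "j \<in> {1,2}" and f: "f \<in> F 1 \<union> F 2" and w: "\<omega> i j = ereal w"
  shows "integrable (P f) (\<lambda>y. \<bar>S i j y - prob_space.expectation (P f) (S i j)\<bar>)"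
    and "(\<integral>y. \<bar>S i j y - prob_space.expectation (P f) (S i j)\<bar> \<partial>P f) \<le> w / z"
proof -
  interpret prob_space "P f" by (rule prob_F[OF f])
  have G: "gaussian_rv (P f) (S i j)" using gaussian_S[OF ij] F_subset f by auto
  then obtain m s where X [measurable]: "S i j \<in> borel_measurable (P f)"
    and law: "distr (P f) borel (S i j) = distr std_normal_distribution borel (\<lambda>x. m + s * x)"
    by (auto simp: gaussian_rv_def)
  note mom = gaussian_rv_moments[OF prob_space_axioms X law]
  define e where "e = expectation (S i j)"
  have sq: "(\<lambda>y. (S i j y - e)\<^sup>2) = (\<lambda>y. (S i j y)\<^sup>2 - 2 * e * S i j y + e\<^sup>2)"
    by (auto simp: power2_eq_square algebra_simps)
  have i2: "integrable (P f) (\<lambda>y. (S i j y - e)\<^sup>2)" unfolding sq using mom by simp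
  show "integrable (P f) (\<lambda>y. \<bar>S i j y - expectation (S i j)\<bar>)" using mom by simp
  have "(expectation (\<lambda>y. \<bar>S i j y - e\<bar>))\<^sup>2 \<le> variance (S i j)"
    using Cauchy_Schwarz_integral(2)[of "\<lambda>y. \<bar>S i j y - e\<bar>" "P f" "\<lambda>_. 1"] i2
    by (simp add: prob_space e_def)
  then have "expectation (\<lambda>y. \<bar>S i j y - e\<bar>) \<le> sqrt (variance (S i j))" by (rule real_le_rsqrt)
  also have "\<dots> \<le> w / z" by (rule sd_le[OF ij f w])
  finally show "expectation (\<lambda>y. \<bar>S i j y - expectation (S i j)\<bar>) \<le> w / z" unfolding e_def .
qed

text \<open>For \<open>f\<close> in \<open>F j\<close> the intersection is estimated by its member
  \<open>CI_star \<omega> S j\<close>. Each estimator \<open>S i j\<close> at its lower end has bias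
  at least minus half its modulus on \<open>F j\<close>, and each \<open>S j i\<close> at its upper
  end bias at most half, so neither end strays from \<open>T f\<close> by more than two moduli plus
  a deviation.\<close>

lemma expected_length_upper_bound:
  assumes j: "j \<in> {1,2}" and f: "f \<in> F j"
  shows "(\<integral>\<^sup>+y. emeasure lborel (CI y) \<partial>P f) \<le> ennreal K * M z j"
proof (cases "M z j = \<top>")
  case True
  then show ?thesis using K_pos by (simp add: ennreal_mult_top)
next
  case False
  then obtain b where b: "M z j = ennreal b" "0 \<le> b" by (cases "M z j") auto
  have f': "f \<in> F 1 \<union> F 2" using f j by auto
  interpret prob_space "P f" by (rule prob_F[OF f'])
  \<comment> \<open>\<open>M z j\<close> controls the moduli with an index \<open>j\<close> only;
    nothing is known here about the modulus of the other class with itself.\<close>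
  have fin: "\<exists>w. \<omega> k l = ereal w \<and> 0 \<le> w \<and> w \<le> b" if "(k = j \<and> l \<in> {1,2}) \<or> (k \<in> {1,2} \<and> l = j)" for k l
  proof -
    have kl: "k \<in> {1,2}" "l \<in> {1,2}" using that j by auto
    have le: "e2ennreal (\<omega> k l) \<le> ennreal b"
      using pair_modulus_le[of l j] pair_modulus_le[of k j] that j b by auto
    show ?thesis using kl
    proof (cases rule: modulus_cases)
      case 1
      then show ?thesis using le by (simp add: top_unique)
    next
      case (2 w)
      then show ?thesis using le b(2) by (auto simp: ennreal.abs_eq[symmetric] ennreal_le_iff)
    qed
  qed
  define w where "w k l = real_of_ereal (\<omega> k l)" for k l
  have w: "\<omega> k l = ereal (w k l)" "0 \<le> w k l" "w k l \<le> b"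
    if "(k = j \<and> l \<in> {1,2}) \<or> (k \<in> {1,2} \<and> l = j)" for k l
    using fin[OF that] by (auto simp: w_def)
  define dev where "dev k l y = \<bar>S k l y - expectation (S k l)\<bar>" for k l y
  \<comment> \<open>The 2 is the margin 3/2 of the interval plus the bias 1/2.\<close>
  define R where "R k l y = 2 * w k l + dev k l y" for k l y
  have Rnn: "0 \<le> R k l y" if "(k = j \<and> l \<in> {1,2}) \<or> (k \<in> {1,2} \<and> l = j)" for k l y
    using w(2)[OF that] by (simp add: R_def dev_def)
  have ER: "integrable (P f) (R k l) \<and> expectation (R k l) \<le> (2 + 1 / z) * b"
    if kl: "(k = j \<and> l \<in> {1,2}) \<or> (k \<in> {1,2} \<and> l = j)" for k l
  proof -
    have kl': "k \<in> {1,2}" "l \<in> {1,2}" using kl j by auto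
    note d = expected_deviation[OF kl' f' w(1)[OF kl], folded dev_def]
    have eq: "R k l = (\<lambda>y. 2 * w k l + dev k l y)" by (simp add: R_def fun_eq_iff)
    have "expectation (R k l) = 2 * w k l + expectation (dev k l)"
      unfolding eq using d(1) by (simp add: prob_space)
    also have "\<dots> \<le> 2 * w k l + w k l / z" using d(2) by simp
    also have "\<dots> = (2 + 1 / z) * w k l" by (simp add: field_simps)
    also have "\<dots> \<le> (2 + 1 / z) * b" using w(3)[OF kl] z_pos by (intro mult_left_mono) auto
    finally show ?thesis using d(1) by (simp add: eq)
  qed
  have R1: "0 \<le> R 1 j y" and R2: "0 \<le> R 2 j y" and R3: "0 \<le> R j 1 y" and R4: "0 \<le> R j 2 y" for y
    by (rule Rnn, simp)+
  have E1: "integrable (P f) (R 1 j) \<and> expectation (R 1 j) \<le> (2 + 1 / z) * b"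
    and E2: "integrable (P f) (R 2 j) \<and> expectation (R 2 j) \<le> (2 + 1 / z) * b"
    and E3: "integrable (P f) (R j 1) \<and> expectation (R j 1) \<le> (2 + 1 / z) * b"
    and E4: "integrable (P f) (R j 2) \<and> expectation (R j 2) \<le> (2 + 1 / z) * b"
    by (rule ER, simp)+
  \<comment> \<open>The sum of nonnegative terms replaces their maximum, so that the expectation can
    be taken term by term.\<close>
  define A where "A y = R 1 j y + R 2 j y" for y
  define B where "B y = R j 1 y + R j 2 y" for y
  have Ann: "0 \<le> A y" and Bnn: "0 \<le> B y" for y
    unfolding A_def B_def by (intro add_nonneg_nonneg R1 R2 R3 R4)+
  have sub: "CI y \<subseteq> {T f - A y..T f + B y}" for y
  proof
    fix x assume "x \<in> CI y"
    then have x: "x \<in> CI_star \<omega> S j y" using j by (auto simp: CI_adaptive_def)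
    have lo: "T f - R i j y \<le> x" if i: "i \<in> {1,2}" and le: "ereal (S i j y) - 3/2 * \<omega> i j \<le> ereal x" for i
    proof -
      have wij: "\<omega> i j = ereal (w i j)" using w(1)[of i j] i by blast
      have "S i j y - 3 / 2 * w i j \<le> x" using le unfolding wij ereal_half by simp
      moreover have "- (w i j / 2) \<le> expectation (S i j) - T f"
        by (rule balanced_estimatorD(2)[where T=T, OF balanced[OF i j] wij z_pos f])
      ultimately show ?thesis unfolding R_def dev_def by linarith
    qed
    have up: "x \<le> T f + R j i y" if i: "i \<in> {1,2}" and le: "ereal x \<le> ereal (S j i y) + 3/2 * \<omega> j i" for i
    proof -
      have wji: "\<omega> j i = ereal (w j i)" using w(1)[of j i] i by blast
      have "x \<le> S j i y + 3 / 2 * w j i" using le unfolding wji ereal_half by simp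
      moreover have "expectation (S j i) - T f \<le> w j i / 2"
        by (rule balanced_estimatorD(3)[where T=T, OF balanced[OF j i] wji z_pos f])
      ultimately show ?thesis unfolding R_def dev_def by linarith
    qed
    have "T f - R 1 j y \<le> x \<or> T f - R 2 j y \<le> x"
      using x lo unfolding CI_star_def by (auto simp: min_le_iff_disj)
    moreover have "x \<le> T f + R j 1 y \<or> x \<le> T f + R j 2 y"
      using x up unfolding CI_star_def by (auto simp: le_max_iff_disj)
    ultimately show "x \<in> {T f - A y..T f + B y}"
      using R1[of y] R2[of y] R3[of y] R4[of y] unfolding A_def B_def atLeastAtMost_iff by linarith
  qed
  have "(\<integral>\<^sup>+y. emeasure lborel (CI y) \<partial>P f) \<le> (\<integral>\<^sup>+y. ennreal (A y + B y) \<partial>P f)"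
  proof (rule nn_integral_mono)
    fix y
    have "emeasure lborel (CI y) \<le> emeasure lborel {T f - A y..T f + B y}"
      using sub by (intro emeasure_mono) auto
    also have "\<dots> = ennreal (A y + B y)" using Ann[of y] Bnn[of y] by simp
    finally show "emeasure lborel (CI y) \<le> ennreal (A y + B y)" .
  qed
  also have "\<dots> = ennreal (expectation (\<lambda>y. A y + B y))"
  proof (rule nn_integral_eq_integral)
    show "integrable (P f) (\<lambda>y. A y + B y)"
      unfolding A_def B_def using E1 E2 E3 E4 by (intro Bochner_Integration.integrable_add) blast+
    show "AE y in P f. 0 \<le> A y + B y" using Ann Bnn by (intro AE_I2 add_nonneg_nonneg)
  qed
  also have "\<dots> \<le> ennreal (K * b)"
  proof (rule ennreal_leI)
    have "expectation (\<lambda>y. A y + B y) =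
       (expectation (R 1 j) + expectation (R 2 j)) + (expectation (R j 1) + expectation (R j 2))"
      using E1 E2 E3 E4 unfolding A_def B_def by (simp del: One_nat_def)
    also have "\<dots> \<le> K * b"
      using E1 E2 E3 E4 unfolding length_factor_def mult.assoc by linarith
    finally show "expectation (\<lambda>y. A y + B y) \<le> K * b" .
  qed
  also have "\<dots> = ennreal K * M z j" using b K_pos by (simp add: ennreal_mult)
  finally show ?thesis .
qed

lemma modulus_scale:
  assumes "0 < a" "0 < b" "j \<in> {1,2}"
  shows "M a j \<le> ennreal (max 1 (a / b)) * M b j"
proof -
  from common obtain p where p: "p \<in> F 1 \<inter> F 2" by auto
  show ?thesis
    using abs_modulus_scale[OF linear spaces p assms(3), of "a / b" "b / sqrt (real n)"] assms
    by simp
qed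

text \<open>The interval \<open>C\<close> is arbitrary for two uses: the infimum over
  \<open>C\<close> bounds the minimax length, and \<open>C = CI\<close> bounds the modulus by the
  length of the adaptive interval.\<close>

lemma length_lower_bound:
  assumes j: "j \<in> {1,2}" and C: "C \<in> confidence_intervals D P T \<alpha> (F 1 \<union> F 2)"
  shows "ennreal (detection_gap \<alpha>) * M (detection_radius \<alpha>) j \<le> max_length P C (F j)"
  unfolding abs_modulus_def SUP_mult_left_ennreal
proof (rule SUP_least, clarify)
  fix f g assume fg: "f \<in> F j" "g \<in> F 1 \<union> F 2" "N (g - f) \<le> detection_radius \<alpha> / sqrt (real n)"
  have "ennreal (detection_gap \<alpha>) * ennreal \<bar>T g - T f\<bar> \<le> (\<integral>\<^sup>+y. emeasure lborel (C y) \<partial>P f)"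
    using fg j by (intro expected_length_lower_bound[OF alpha(2) C F_subset]) (auto simp: norm_nonneg)
  also have "\<dots> \<le> max_length P C (F j)"
    unfolding max_length_def using fg by (intro SUP_upper)
  finally show "ennreal (detection_gap \<alpha>) * ennreal \<bar>T g - T f\<bar> \<le> max_length P C (F j)" .
qed

lemma length_upper_bound:
  assumes j: "j \<in> {1,2}"
  shows "max_length P CI (F j) \<le> ennreal K * M z j"
  unfolding max_length_def by (rule SUP_least) (rule expected_length_upper_bound[OF j])

lemma adaptive_length_min_max:
  assumes j: "j \<in> {1,2}"
  shows "max_length P CI (F j) \<le> ennreal (adaptation_constant \<alpha>) * min_max_length D P T \<alpha> (F j) (F 1 \<union> F 2)"
proof -
  let ?c = "K * max 1 (z / detection_radius \<alpha>)"
  note pos = K_pos detection_gap_pos[OF alpha(2)] detection_radius_pos[OF alpha(2)] z_pos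
  have "max_length P CI (F j) \<le> ennreal K * M z j" by (rule length_upper_bound[OF j])
  also have "\<dots> \<le> ennreal K * (ennreal (max 1 (z / detection_radius \<alpha>)) * M (detection_radius \<alpha>) j)"
    using pos j by (intro mult_left_mono modulus_scale) auto
  also have "\<dots> = ennreal ?c * M (detection_radius \<alpha>) j"
    using pos by (simp add: ennreal_mult mult.assoc)
  \<comment> \<open>The factor \<open>detection_gap \<alpha>\<close> is split off because the lower
    bound on the length has it in front of the modulus.\<close>
  also have "ennreal ?c = ennreal (?c / detection_gap \<alpha>) * ennreal (detection_gap \<alpha>)"
    using pos by (subst ennreal_mult[symmetric]) auto
  also have "ennreal (?c / detection_gap \<alpha>) * ennreal (detection_gap \<alpha>) * M (detection_radius \<alpha>) j
      \<le> ennreal (?c / detection_gap \<alpha>) * min_max_length D P T \<alpha> (F j) (F 1 \<union> F 2)"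
    unfolding min_max_length_def mult.assoc
    by (intro mult_left_mono INF_greatest length_lower_bound[OF j]) auto
  finally show ?thesis unfolding adaptation_constant_def .
qed

text \<open>The radius \<open>a\<close> is free because the order of magnitude is stated at the
  quantile for \<alpha>/2, which is neither the radius of the construction nor that of the lower
  bound.\<close>

lemma adaptive_length_modulus:
  assumes j: "j \<in> {1,2}" and a: "0 < a"
  shows "max_length P CI (F j) \<le> ennreal (K * max 1 (z / a)) * M a j"
    and "M a j \<le> ennreal (max 1 (a / detection_radius \<alpha>) / detection_gap \<alpha>) * max_length P CI (F j)"
proof -
  note pos = K_pos detection_gap_pos[OF alpha(2)] detection_radius_pos[OF alpha(2)] z_pos
  have "max_length P CI (F j) \<le> ennreal K * M z j" by (rule length_upper_bound[OF j])
  also have "\<dots> \<le> ennreal K * (ennreal (max 1 (z / a)) * M a j)"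
    using pos j a by (intro mult_left_mono modulus_scale) auto
  finally show "max_length P CI (F j) \<le> ennreal (K * max 1 (z / a)) * M a j"
    using pos by (simp add: ennreal_mult mult.assoc)
  let ?m = "max 1 (a / detection_radius \<alpha>)"
  have "M a j \<le> ennreal ?m * M (detection_radius \<alpha>) j"
    using pos j a by (intro modulus_scale) auto
  also have "ennreal ?m = ennreal (?m / detection_gap \<alpha>) * ennreal (detection_gap \<alpha>)"
    using pos by (subst ennreal_mult[symmetric]) auto
  also have "ennreal (?m / detection_gap \<alpha>) * ennreal (detection_gap \<alpha>) * M (detection_radius \<alpha>) j
      \<le> ennreal (?m / detection_gap \<alpha>) * max_length P CI (F j)"
    unfolding mult.assoc by (intro mult_left_mono length_lower_bound[OF j CI_confidence]) auto
  finally show "M a j \<le> ennreal (?m / detection_gap \<alpha>) * max_length P CI (F j)" .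
qed

end

text \<open>Where the sequences agree the ratio is 1 by convention, hence the 1 in both bounds of
  the proof. Elsewhere the two inequalities make the quotient a real number between 1/d and
  c.\<close>

lemma same_orderI:
  fixes a b :: "nat \<Rightarrow> ennreal"
  assumes c: "0 < c" "0 < d" and le: "\<And>n. 1 \<le> n \<Longrightarrow> a n \<le> ennreal c * b n" "\<And>n. 1 \<le> n \<Longrightarrow> b n \<le> ennreal d * a n"
  shows "same_order a b"
proof -
  define r where "r n = (if a n = b n then 1 else a n / b n)" for n
  have r: "ennreal (min 1 (1 / d)) \<le> r n \<and> r n \<le> ennreal (max 1 c)" if n: "1 \<le> n" for n
  proof (cases "a n = b n")
    case True
    then show ?thesis by (simp add: r_def)
  next
    case False
    \<comment> \<open>\<open>b n = 0\<close> would force \<open>a n = 0\<close>, and below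
      \<open>b n = \<top>\<close> would force \<open>a n = \<top>\<close>; both contradict
      \<open>a n \<noteq> b n\<close>.\<close>
    have b0: "b n \<noteq> 0" using False le(1)[OF n] by auto
    have bt: "b n \<noteq> \<top>" using False le(2)[OF n] by (metis ennreal_mult_less_top ennreal_less_top infinity_ennreal_def top.not_eq_extremum top_le top_unique)
    then have at: "a n \<noteq> \<top>" using le(1)[OF n] by (metis ennreal_mult_less_top ennreal_less_top top.not_eq_extremum leD)
    from bt b0 obtain y where y: "b n = ennreal y" "0 < y" by (cases "b n") (auto simp: less_le)
    from at obtain x where x: "a n = ennreal x" "0 \<le> x" by (cases "a n") auto
    have "x \<le> c * y" using le(1)[OF n] x y c by (simp add: ennreal_le_iff flip: ennreal_mult)
    moreover have "y \<le> d * x" using le(2)[OF n] x y c by (simp add: ennreal_le_iff flip: ennreal_mult)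
    moreover have "r n = ennreal (x / y)" using False x y by (simp add: r_def divide_ennreal)
    ultimately show ?thesis using c y x
      by (auto intro!: ennreal_leI simp: field_simps min_le_iff_disj le_max_iff_disj)
  qed
  have ev: "\<forall>\<^sub>F n in sequentially. 1 \<le> n" by (rule eventually_ge_at_top)
  have "0 < ennreal (min 1 (1 / d))" using c by simp
  also have "\<dots> \<le> liminf r" using r by (intro Liminf_bounded eventually_mono[OF ev]) blast
  finally have 1: "0 < liminf r" .
  have "limsup r \<le> ennreal (max 1 c)" using r by (intro Limsup_bounded eventually_mono[OF ev]) blast
  also have "\<dots> < \<infinity>" by simp
  finally have 2: "limsup r < \<infinity>" .
  have 3: "liminf r \<le> limsup r" by (rule Liminf_le_Limsup) simp
  show ?thesis using 1 2 3 unfolding same_order_def r_def Let_def by simp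
qed

section \<open>Total variation from finite-dimensional cylinders\<close>

text \<open>The measure enters only through its space. Cylinders are taken relative to it, since the
  path space consists of continuous functions only.\<close>

definition cylinder :: "('i \<Rightarrow> real) measure \<Rightarrow> 'i set \<Rightarrow> ('i \<Rightarrow> real) set \<Rightarrow> bool" where
  "cylinder M I A \<longleftrightarrow> (\<exists>J B. finite J \<and> J \<subseteq> I \<and> B \<in> sets (Pi\<^sub>M J (\<lambda>_. borel)) \<and>
     A = {w \<in> space M. restrict w J \<in> B})"

lemma cylinder_compl: "cylinder M I A \<Longrightarrow> cylinder M I (space M - A)"
proof -
  assume "cylinder M I A"
  then obtain J B where J: "finite J" "J \<subseteq> I" and B: "B \<in> sets (Pi\<^sub>M J (\<lambda>_. borel))"
    and A: "A = {w \<in> space M. restrict w J \<in> B}" by (auto simp: cylinder_def)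
  have "space (Pi\<^sub>M J (\<lambda>_. borel)) - B \<in> sets (Pi\<^sub>M J (\<lambda>_. borel))" using B by auto
  moreover have "space M - A = {w \<in> space M. restrict w J \<in> space (Pi\<^sub>M J (\<lambda>_. borel)) - B}"
    unfolding A by (auto simp: space_PiM)
  ultimately show ?thesis using J unfolding cylinder_def by blast
qed

text \<open>Both sets are read over the union of their finite index sets.\<close>

lemma cylinder_Un:
  assumes "cylinder M I A" "cylinder M I A'"
  shows "cylinder M I (A \<union> A')"
proof -
  from assms(1) obtain J B where J: "finite J" "J \<subseteq> I" and B: "B \<in> sets (Pi\<^sub>M J (\<lambda>_. borel))"
    and A: "A = {w \<in> space M. restrict w J \<in> B}" by (auto simp: cylinder_def)
  from assms(2) obtain J' B' where J': "finite J'" "J' \<subseteq> I" and B': "B' \<in> sets (Pi\<^sub>M J' (\<lambda>_. borel))"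
    and A': "A' = {w \<in> space M. restrict w J' \<in> B'}" by (auto simp: cylinder_def)
  let ?K = "J \<union> J'"
  let ?N = "Pi\<^sub>M ?K (\<lambda>_. borel)"
  define C where "C = {x \<in> space ?N. restrict x J \<in> B} \<union> {x \<in> space ?N. restrict x J' \<in> B'}"
  have [measurable]: "(\<lambda>x. restrict x J) \<in> ?N \<rightarrow>\<^sub>M Pi\<^sub>M J (\<lambda>_. borel)"
    "(\<lambda>x. restrict x J') \<in> ?N \<rightarrow>\<^sub>M Pi\<^sub>M J' (\<lambda>_. borel)"
    by (auto intro!: measurable_restrict_subset)
  have "C \<in> sets ?N" unfolding C_def using B B' by measurable
  moreover have "A \<union> A' = {w \<in> space M. restrict w ?K \<in> C}"
    unfolding A A' C_def by (auto simp: space_PiM Int_absorb1 Int_commute)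
  ultimately show ?thesis using J J' unfolding cylinder_def by (intro exI[of _ ?K] exI[of _ C]) auto
qed

lemma cylinder_empty: "cylinder M I {}"
  unfolding cylinder_def by (intro exI[of _ "{}"]) auto

lemma cylinder_UN:
  assumes "finite K" "\<And>k. k \<in> K \<Longrightarrow> cylinder M I (A k)"
  shows "cylinder M I (\<Union>k\<in>K. A k)"
  using assms by (induction K) (auto intro: cylinder_empty cylinder_Un)

text \<open>The sets that one cylinder approximates under both laws simultaneously are closed under
  complements and countable unions and include the sets given by one coordinate. The induction runs
  over sets \<open>C\<close> of the full product, with \<open>A = \<Omega> \<inter> C\<close>,
  because the set of continuous paths is not itself measurable in the product.\<close>

lemma cylinder_approximation:
  fixes P Q :: "('i \<Rightarrow> real) measure"
  assumes P: "prob_space P" and Q: "prob_space Q" and sQ: "sets Q = sets P"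
    and sP: "sets P = sets (restrict_space (Pi\<^sub>M I (\<lambda>_. borel)) \<Omega>)"
    and A: "A \<in> sets P" and e: "0 < e"
  shows "\<exists>B\<in>sets P. cylinder P I B \<and>
    measure P (sym_diff A B) < e \<and> measure Q (sym_diff A B) < e"
proof -
  interpret P: prob_space P by fact
  interpret Q: prob_space Q by fact
  define ok where "ok C \<longleftrightarrow> (\<forall>e>0. \<exists>B\<in>sets P. cylinder P I B \<and>
    measure P (sym_diff C B) < e \<and> measure Q (sym_diff C B) < e)" for C
  have sp: "space P = space (restrict_space (Pi\<^sub>M I (\<lambda>_. borel)) \<Omega>)"
    by (rule sets_eq_imp_space_eq[OF sP])
  then have sp': "space P = (\<Pi>\<^sub>E i\<in>I. UNIV) \<inter> \<Omega>" by (auto simp: space_restrict_space space_PiM)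
  have inP: "\<Omega> \<inter> C \<in> sets P" if "C \<in> sets (Pi\<^sub>M I (\<lambda>_. borel))" for C
    using that unfolding sP sets_restrict_space by auto
  from A obtain C where C: "C \<in> sets (Pi\<^sub>M I (\<lambda>_. borel))" and AC: "A = \<Omega> \<inter> C"
    unfolding sP sets_restrict_space by auto
  have "C \<in> sigma_sets (\<Pi>\<^sub>E i\<in>I. UNIV) {{f\<in>\<Pi>\<^sub>E i\<in>I. UNIV. f i \<in> A} | i A. i \<in> I \<and> A \<in> sets borel}"
    using C unfolding sets_PiM_single by simp
  \<comment> \<open>Measurability is carried along since the complement and union cases need it for
    the smaller sets.\<close>
  then have "ok (\<Omega> \<inter> C) \<and> C \<in> sets (Pi\<^sub>M I (\<lambda>_. borel))"
  proof induction
    case (Basic a)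
    then obtain i B where i: "i \<in> I" and B: "B \<in> sets (borel :: real measure)"
      and a: "a = {f \<in> \<Pi>\<^sub>E i\<in>I. UNIV. f i \<in> B}" by auto
    have as: "a \<in> sets (Pi\<^sub>M I (\<lambda>_. borel))" unfolding a sets_PiM_single
      using i B by (intro sigma_sets.Basic) auto
    have "{x \<in> space (Pi\<^sub>M {i} (\<lambda>_. borel)). x i \<in> B} \<in> sets (Pi\<^sub>M {i} (\<lambda>_. borel))"
      using B by measurable
    moreover have "\<Omega> \<inter> a = {w \<in> space P. restrict w {i} \<in> {x \<in> space (Pi\<^sub>M {i} (\<lambda>_. borel)). x i \<in> B}}"
      unfolding a sp' by (auto simp: space_PiM)
    ultimately have "cylinder P I (\<Omega> \<inter> a)" unfolding cylinder_def
      using i by (intro exI[of _ "{i}"]) blast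
    then show ?case using as inP[OF as] unfolding ok_def by (auto intro!: bexI[of _ "\<Omega> \<inter> a"])
  next
    case Empty
    then show ?case unfolding ok_def by (auto intro!: bexI[of _ "{}"] cylinder_empty)
  next
    case (Compl a)
    have "ok (\<Omega> \<inter> ((\<Pi>\<^sub>E i\<in>I. UNIV) - a))" unfolding ok_def
    proof safe
      fix e :: real assume "0 < e"
      with Compl obtain B where B: "B \<in> sets P" "cylinder P I B"
        "measure P (sym_diff (\<Omega> \<inter> a) B) < e" "measure Q (sym_diff (\<Omega> \<inter> a) B) < e" unfolding ok_def by blast
      have "sym_diff (\<Omega> \<inter> ((\<Pi>\<^sub>E i\<in>I. UNIV) - a)) (space P - B) = sym_diff (\<Omega> \<inter> a) B"
        using sets.sets_into_space[OF B(1)] Compl sets.sets_into_space[of a "Pi\<^sub>M I (\<lambda>_. borel)"]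
        unfolding sp' by (auto simp: space_PiM)
      then show "\<exists>B\<in>sets P. cylinder P I B \<and>
           measure P (sym_diff (\<Omega> \<inter> ((\<Pi>\<^sub>E i\<in>I. UNIV) - a)) B) < e \<and>
           measure Q (sym_diff (\<Omega> \<inter> ((\<Pi>\<^sub>E i\<in>I. UNIV) - a)) B) < e"
        using B by (intro bexI[of _ "space P - B"]) (auto intro: cylinder_compl)
    qed
    moreover have "(\<Pi>\<^sub>E i\<in>I. UNIV) - a \<in> sets (Pi\<^sub>M I (\<lambda>_. borel))"
      using Compl sets.compl_sets[of a "Pi\<^sub>M I (\<lambda>_. borel)"] by (simp add: space_PiM)
    ultimately show ?case ..
  next
    case (Union a)
    have Us: "(\<Union>i. a i) \<in> sets (Pi\<^sub>M I (\<lambda>_. borel))" using Union by auto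
    have "ok (\<Omega> \<inter> (\<Union>i. a i))" unfolding ok_def
    proof safe
      fix e :: real assume e: "0 < e"
      define U where "U = \<Omega> \<inter> (\<Union>i. a i)"
      define V where "V n = (\<Union>i<n. \<Omega> \<inter> a i)" for n :: nat
      have aP: "\<Omega> \<inter> a i \<in> sets P" for i using Union inP by auto
      have VP: "V n \<in> sets P" for n unfolding V_def by (intro sets.finite_UN aP) simp
      have UP: "U \<in> sets P" using inP[OF Us] by (simp add: U_def)
      have UV: "U = (\<Union>n. V n)" unfolding U_def V_def using lessI by blast
      have incV: "incseq V" unfolding V_def incseq_def by (fastforce intro: less_le_trans)
      have "(\<lambda>n. measure P (V n)) \<longlonglongrightarrow> measure P U" "(\<lambda>n. measure Q (V n)) \<longlonglongrightarrow> measure Q U"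
        unfolding UV using VP incV
        by (auto intro!: P.finite_Lim_measure_incseq Q.finite_Lim_measure_incseq simp: sQ)
      then have "\<forall>\<^sub>F n in sequentially. measure P U - e / 2 < measure P (V n)"
        "\<forall>\<^sub>F n in sequentially. measure Q U - e / 2 < measure Q (V n)"
        using e by (auto intro: order_tendstoD)
      then have "\<forall>\<^sub>F n in sequentially. measure P U - e / 2 < measure P (V n) \<and> measure Q U - e / 2 < measure Q (V n)"
        by (rule eventually_conj)
      then obtain n where n: "measure P U - e / 2 < measure P (V n)" "measure Q U - e / 2 < measure Q (V n)"
        using eventually_happens' sequentially_bot by blast
      have VU: "V n \<subseteq> U" unfolding UV by auto
      have tail: "measure P (U - V n) < e / 2" "measure Q (U - V n) < e / 2"
        using n VU UP VP by (auto simp: P.finite_measure_Diff Q.finite_measure_Diff sQ)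
      \<comment> \<open>The other half of \<open>e\<close> is shared among the \<open>n\<close> sets
        of the finite union; \<open>n + 1\<close> keeps the denominator positive for
        \<open>n = 0\<close>.\<close>
      define d where "d = e / (2 * (real n + 1))"
      have d: "0 < d" using e by (simp add: d_def)
      have "\<exists>B\<in>sets P. cylinder P I B \<and>
          measure P (sym_diff (\<Omega> \<inter> a i) B) < d \<and> measure Q (sym_diff (\<Omega> \<inter> a i) B) < d" for i
        using Union d unfolding ok_def by blast
      then obtain B where B: "\<And>i. B i \<in> sets P" "\<And>i. cylinder P I (B i)"
         "\<And>i. measure P (sym_diff (\<Omega> \<inter> a i) (B i)) < d" "\<And>i. measure Q (sym_diff (\<Omega> \<inter> a i) (B i)) < d"
        by metis
      define W where "W = (\<Union>i<n. B i)"
      have WP: "W \<in> sets P" unfolding W_def using B(1) by auto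
      have sub: "sym_diff U W \<subseteq> (U - V n) \<union> (\<Union>i<n. sym_diff (\<Omega> \<inter> a i) (B i))"
        using VU unfolding V_def W_def by blast
      have bound: "measure R (sym_diff U W) < e" if R: "prob_space R" "sets R = sets P"
        "measure R (U - V n) < e / 2" "\<And>i. measure R (sym_diff (\<Omega> \<inter> a i) (B i)) < d" for R
      proof -
        interpret R: prob_space R by fact
        have "measure R (sym_diff U W) \<le> measure R ((U - V n) \<union> (\<Union>i<n. sym_diff (\<Omega> \<inter> a i) (B i)))"
          using sub UP VP aP B(1) R(2) by (intro R.finite_measure_mono) auto
        also have "\<dots> \<le> measure R (U - V n) + measure R (\<Union>i<n. sym_diff (\<Omega> \<inter> a i) (B i))"
          using UP VP aP B(1) R(2) by (intro measure_Un_le) auto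
        also have "measure R (\<Union>i<n. sym_diff (\<Omega> \<inter> a i) (B i)) \<le> (\<Sum>i<n. measure R (sym_diff (\<Omega> \<inter> a i) (B i)))"
          using aP B(1) R(2) by (intro R.finite_measure_subadditive_finite) auto
        also have "\<dots> \<le> (\<Sum>i<n. d)" using R(4) by (intro sum_mono) (auto simp: less_imp_le)
        also have "\<dots> = n * d" by simp
        also have "\<dots> \<le> e / 2"
        proof -
          have "real n * e \<le> (real n + 1) * e" using e by simp
          then show ?thesis by (simp add: d_def field_simps)
        qed
        finally show ?thesis using R(3) by simp
      qed
      show "\<exists>B\<in>sets P. cylinder P I B \<and>
           measure P (sym_diff (\<Omega> \<inter> (\<Union>i. a i)) B) < e \<and> measure Q (sym_diff (\<Omega> \<inter> (\<Union>i. a i)) B) < e"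
        using bound[OF P refl tail(1) B(3)] bound[OF Q sQ tail(2) B(4)] WP B(2)
        unfolding U_def[symmetric]
        by (intro bexI[of _ W]) (auto simp: W_def intro!: cylinder_UN)
    qed
    then show ?case using Us ..
  qed
  then show ?thesis using e unfolding AC ok_def by blast
qed

lemma abs_measure_diff_le_sym_diff:
  assumes "prob_space P" "A \<in> sets P" "B \<in> sets P"
  shows "\<bar>measure P A - measure P B\<bar> \<le> measure P (sym_diff A B)"
proof -
  interpret prob_space P by fact
  have "prob A \<le> prob (B \<union> sym_diff A B)" "prob B \<le> prob (A \<union> sym_diff A B)"
    using assms by (auto intro!: finite_measure_mono)
  moreover have "prob (B \<union> sym_diff A B) \<le> prob B + prob (sym_diff A B)"
     "prob (A \<union> sym_diff A B) \<le> prob A + prob (sym_diff A B)"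
    using assms by (auto intro!: measure_Un_le)
  ultimately show ?thesis by linarith
qed

text \<open>Replacing \<open>A\<close> by a common approximating cylinder costs \<open>e / 2\<close>
  under each of the two laws.\<close>

lemma total_variation_from_cylinders:
  fixes P Q :: "('i \<Rightarrow> real) measure"
  assumes P: "prob_space P" and Q: "prob_space Q" and sQ: "sets Q = sets P"
    and sP: "sets P = sets (restrict_space (Pi\<^sub>M I (\<lambda>_. borel)) \<Omega>)"
    and le: "\<And>J B. \<lbrakk>finite J; J \<subseteq> I; B \<in> sets (Pi\<^sub>M J (\<lambda>_. borel))\<rbrakk> \<Longrightarrow>
      \<bar>measure P {w \<in> space P. restrict w J \<in> B} - measure Q {w \<in> space P. restrict w J \<in> B}\<bar> \<le> \<delta>"
    and A: "A \<in> sets P"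
  shows "\<bar>measure P A - measure Q A\<bar> \<le> \<delta>"
proof (rule field_le_epsilon)
  fix e :: real assume "0 < e"
  then have "0 < e / 2" by simp
  from cylinder_approximation[OF P Q sQ sP A this] obtain B where B: "B \<in> sets P" "cylinder P I B"
    "measure P (sym_diff A B) < e / 2" "measure Q (sym_diff A B) < e / 2" by blast
  have "\<bar>measure P B - measure Q B\<bar> \<le> \<delta>"
    using B(2) le unfolding cylinder_def by blast
  then show "\<bar>measure P A - measure Q A\<bar> \<le> \<delta> + e"
    using abs_measure_diff_le_sym_diff[OF P A B(1)] abs_measure_diff_le_sym_diff[OF Q, of A B] A B sQ by simp
qed

section \<open>The Gaussian sequence model\<close>

lemma distr_gaussian_measure_restrict:
  assumes "finite J" "J \<subseteq> I"
  shows "distr (gaussian_measure I) (gaussian_measure J) (\<lambda>x. restrict x J) = gaussian_measure J"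
proof -
  interpret product_prob_space "\<lambda>_::'a. std_normal_distribution"
    by (rule product_prob_space_std_normal)
  show ?thesis using assms by (rule distr_PiM_restrict_finite)
qed

lemma gaussian_sequence_map_measurable:
  "(\<lambda>z. \<lambda>i\<in>M. f i + z i / sqrt (real n)) \<in> gaussian_measure M \<rightarrow>\<^sub>M sequence_data_space M"
  unfolding sequence_data_space_def by measurable

lemma sets_gaussian_sequence: "sets (gaussian_sequence M n f) = sets (sequence_data_space M)"
  by (simp add: gaussian_sequence_def)

lemma prob_space_gaussian_sequence: "prob_space (gaussian_sequence M n f)"
  unfolding gaussian_sequence_def
  by (intro prob_space.prob_space_distr prob_space_gaussian_measure gaussian_sequence_map_measurable)

text \<open>Adding the signal acts on each coordinate separately, so it commutes with the projection
  to \<open>J\<close>, and the projected noise is standard Gaussian on \<open>J\<close>.\<close>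

lemma measure_gaussian_sequence_cylinder:
  assumes J: "finite J" "J \<subseteq> M" and B: "B \<in> sets (Pi\<^sub>M J (\<lambda>_. borel))"
  shows "measure (gaussian_sequence M n f) {w \<in> space (gaussian_sequence M n f). restrict w J \<in> B} =
    measure (gaussian_measure J) {x \<in> space (gaussian_measure J). (\<lambda>i\<in>J. f i + x i / sqrt (real n)) \<in> B}"
proof -
  let ?\<phi> = "\<lambda>z. \<lambda>i\<in>M. f i + z i / sqrt (real n)"
  let ?C = "{x \<in> space (gaussian_measure J). (\<lambda>i\<in>J. f i + x i / sqrt (real n)) \<in> B}"
  have "{w \<in> space (sequence_data_space M). restrict w J \<in> B} \<in> sets (sequence_data_space M)"
    using measurable_restrict_subset[OF J(2), of "\<lambda>_. borel :: real measure"] B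
    unfolding sequence_data_space_def by measurable
  then have "measure (gaussian_sequence M n f) {w \<in> space (gaussian_sequence M n f). restrict w J \<in> B} =
      measure (gaussian_measure M) (?\<phi> -` {w \<in> space (sequence_data_space M). restrict w J \<in> B} \<inter> space (gaussian_measure M))"
    unfolding gaussian_sequence_def by (subst measure_distr[OF gaussian_sequence_map_measurable]) simp_all
  also have "?\<phi> -` {w \<in> space (sequence_data_space M). restrict w J \<in> B} \<inter> space (gaussian_measure M) =
      (\<lambda>x. restrict x J) -` ?C \<inter> space (gaussian_measure M)"
  proof -
    have "restrict (?\<phi> z) J = (\<lambda>i\<in>J. f i + restrict z J i / sqrt (real n))" for z
      using J(2) by (auto simp: restrict_def fun_eq_iff)
    then show ?thesis by (auto simp: sequence_data_space_def space_PiM)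
  qed
  also have "measure (gaussian_measure M) \<dots> =
      measure (distr (gaussian_measure M) (gaussian_measure J) (\<lambda>x. restrict x J)) ?C"
  proof (rule measure_distr[symmetric])
    show "(\<lambda>x. restrict x J) \<in> gaussian_measure M \<rightarrow>\<^sub>M gaussian_measure J"
      by (rule measurable_restrict_subset[OF J(2)])
    show "?C \<in> sets (gaussian_measure J)" using B by measurable
  qed
  finally show ?thesis unfolding distr_gaussian_measure_restrict[OF J] .
qed

lemma l2_space_diff: "f \<in> l2_space M \<Longrightarrow> g \<in> l2_space M \<Longrightarrow> g - f \<in> l2_space M"
proof -
  assume f: "f \<in> l2_space M" and g: "g \<in> l2_space M"
  have "(\<lambda>i. 2 * (g i)\<^sup>2 + 2 * (f i)\<^sup>2) summable_on M"
    using f g unfolding l2_space_def by (intro summable_on_add summable_on_cmult_right) auto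
  moreover have "(g i - f i)\<^sup>2 \<le> 2 * (g i)\<^sup>2 + 2 * (f i)\<^sup>2" for i
    using zero_le_power2[of "g i + f i"] by (simp add: power2_eq_square algebra_simps)
  ultimately have "(\<lambda>i. (g i - f i)\<^sup>2) summable_on M"
    by (rule summable_on_comparison_test) simp
  then show ?thesis by (simp add: l2_space_def)
qed

lemma shift_experiment_gaussian_sequence:
  assumes n: "1 \<le> n"
  shows "shift_experiment (sequence_data_space M) (gaussian_sequence M n) (l2_norm M) (l2_space M) n"
proof (rule shift_experiment.intro)
  show "1 \<le> n" by fact
  show "prob_space (gaussian_sequence M n f)" for f by (rule prob_space_gaussian_sequence)
  show "sets (gaussian_sequence M n f) = sets (sequence_data_space M)" for f by (rule sets_gaussian_sequence)
  show "l2_norm M (c *\<^sub>R f) = \<bar>c\<bar> * l2_norm M f" for c f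
    by (simp add: l2_norm_def scaleR_fun_def power_mult_distrib infsum_cmult_right' real_sqrt_mult)
  show "\<bar>measure (gaussian_sequence M n f) A - measure (gaussian_sequence M n g) A\<bar>
      \<le> sqrt (exp ((sqrt (real n) * l2_norm M (g - f))\<^sup>2) - 1)"
    if fg: "f \<in> l2_space M" "g \<in> l2_space M" and A: "A \<in> sets (sequence_data_space M)" for f g A
  proof (rule total_variation_from_cylinders[where I=M and \<Omega>=UNIV])
    fix J B assume J: "finite J" "J \<subseteq> M" and B: "B \<in> sets (Pi\<^sub>M J (\<lambda>_. borel :: real measure))"
    have space_eq: "space (gaussian_sequence M n g) = space (gaussian_sequence M n f)" for f g
      by (simp add: gaussian_sequence_def)
    define C where "C = {x \<in> space (gaussian_measure J). (\<lambda>i\<in>J. f i + x i / sqrt (real n)) \<in> B}"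
    \<comment> \<open>The difference of the signals in units of the noise level: shifting the noise
      by \<open>d\<close> turns data with signal \<open>f\<close> into data with signal
      \<open>g\<close>.\<close>
    define d where "d i = sqrt (real n) * (g i - f i)" for i
    have C: "C \<in> sets (gaussian_measure J)" unfolding C_def using B by measurable
    have n0: "0 < sqrt (real n)" using n by simp
    have shift: "(\<lambda>i\<in>J. f i + (\<lambda>i\<in>J. x i + d i) i / sqrt (real n)) = (\<lambda>i\<in>J. g i + x i / sqrt (real n))" for x
      using n0 by (auto simp: d_def field_simps intro!: restrict_ext)
    have "(\<Sum>i\<in>J. (d i)\<^sup>2) = real n * (\<Sum>i\<in>J. ((g - f) i)\<^sup>2)"
      by (simp add: d_def power_mult_distrib sum_distrib_left)
    also have "\<dots> \<le> real n * (\<Sum>\<^sub>\<infinity>i\<in>M. ((g - f) i)\<^sup>2)"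
      using l2_space_diff[OF fg] J
      by (intro mult_left_mono finite_sum_le_infsum) (auto simp: l2_space_def)
    also have "\<dots> = (sqrt (real n) * l2_norm M (g - f))\<^sup>2"
      by (simp add: l2_norm_def power_mult_distrib infsum_nonneg)
    finally have dn: "(\<Sum>i\<in>J. (d i)\<^sup>2) \<le> (sqrt (real n) * l2_norm M (g - f))\<^sup>2" .
    have "\<bar>measure (gaussian_measure J) C - measure (gaussian_measure J) {x \<in> space (gaussian_measure J). (\<lambda>i\<in>J. x i + d i) \<in> C}\<bar>
        \<le> sqrt (exp (\<Sum>i\<in>J. (d i)\<^sup>2) - 1)"
      by (rule gaussian_shift_bound[OF J(1) C])
    also have "\<dots> \<le> sqrt (exp ((sqrt (real n) * l2_norm M (g - f))\<^sup>2) - 1)" using dn by simp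
    also have "{x \<in> space (gaussian_measure J). (\<lambda>i\<in>J. x i + d i) \<in> C} =
        {x \<in> space (gaussian_measure J). (\<lambda>i\<in>J. g i + x i / sqrt (real n)) \<in> B}"
      unfolding C_def using shift by (simp add: space_gaussian_measure)
    finally show "\<bar>measure (gaussian_sequence M n f) {w \<in> space (gaussian_sequence M n f). restrict w J \<in> B} -
         measure (gaussian_sequence M n g) {w \<in> space (gaussian_sequence M n f). restrict w J \<in> B}\<bar>
       \<le> sqrt (exp ((sqrt (real n) * l2_norm M (g - f))\<^sup>2) - 1)"
      using measure_gaussian_sequence_cylinder[OF J B, of n f] measure_gaussian_sequence_cylinder[OF J B, of n g]
      unfolding C_def space_eq[of g f] by (simp only:)
  qed (use A in \<open>simp_all only: sets_gaussian_sequence prob_space_gaussian_sequence sequence_data_space_def sets_restrict_UNIV\<close>)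
qed

text \<open>A finite partial sum is an affine function of finitely many Gaussian coordinates, and
  the series is the mean square limit of these along the finite subsets of \<open>M\<close>.\<close>

lemma gaussian_sequence_linear_estimatorD:
  assumes S: "gaussian_sequence_linear_estimator M n S"
  shows "S \<in> borel_measurable (sequence_data_space M)"
    and "f \<in> l2_space M \<Longrightarrow> gaussian_rv (gaussian_sequence M n f) S"
proof -
  from S obtain c h I where I [measurable]: "I \<in> borel_measurable (sequence_data_space M)"
    and lim: "\<And>f. f \<in> l2_space M \<Longrightarrow>
      ((\<lambda>A. \<integral>\<^sup>+ y. ennreal ((I y - (\<Sum>i\<in>A. h i * y i))\<^sup>2) \<partial>gaussian_sequence M n f) \<longlongrightarrow> 0)
          (finite_subsets_at_top M)"
    and S: "S = (\<lambda>y. c + I y)"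
    unfolding gaussian_sequence_linear_estimator_def gaussian_series_def by auto
  show SM: "S \<in> borel_measurable (sequence_data_space M)" unfolding S by measurable
  assume f: "f \<in> l2_space M"
  show "gaussian_rv (gaussian_sequence M n f) S"
  proof (rule gaussian_rv_mean_square_limit)
    show "prob_space (gaussian_sequence M n f)" by (rule prob_space_gaussian_sequence)
    show "S \<in> borel_measurable (gaussian_sequence M n f)"
      using SM by (simp add: gaussian_sequence_def)
    show "finite_subsets_at_top M \<noteq> bot" by simp
    show "((\<lambda>A. \<integral>\<^sup>+ y. ennreal ((S y - (c + (\<Sum>i\<in>A. h i * y i)))\<^sup>2) \<partial>gaussian_sequence M n f) \<longlongrightarrow> 0)
          (finite_subsets_at_top M)"
      using lim[OF f] by (simp add: S)
    show "\<forall>\<^sub>F A in finite_subsets_at_top M. gaussian_rv (gaussian_sequence M n f) (\<lambda>y. c + (\<Sum>i\<in>A. h i * y i))"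
    proof (rule eventually_finite_subsets_at_top_weakI)
      fix A assume A: "finite A" "A \<subseteq> M"
      define c' where "c' = c + (\<Sum>i\<in>A. h i * f i)"
      have r: "(\<lambda>x. restrict x A) \<in> gaussian_measure M \<rightarrow>\<^sub>M gaussian_measure A"
        by (rule measurable_restrict_subset[OF A(2)])
      have "gaussian_rv (distr (gaussian_measure M) (gaussian_measure A) (\<lambda>x. restrict x A))
          (\<lambda>x. c' + (\<Sum>i\<in>A. (h i / sqrt (real n)) * x i))"
        unfolding distr_gaussian_measure_restrict[OF A] by (rule gaussian_rv_linear[OF A(1)])
      then have "gaussian_rv (gaussian_measure M) (\<lambda>z. c' + (\<Sum>i\<in>A. (h i / sqrt (real n)) * restrict z A i))"
        by (subst (asm) gaussian_rv_distr[OF r]) simp_all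
      moreover have "c' + (\<Sum>i\<in>A. (h i / sqrt (real n)) * restrict z A i) =
          c + (\<Sum>i\<in>A. h i * (\<lambda>i\<in>M. f i + z i / sqrt (real n)) i)" for z
      proof -
        have "(\<Sum>i\<in>A. h i * (\<lambda>i\<in>M. f i + z i / sqrt (real n)) i) =
            (\<Sum>i\<in>A. h i * f i + (h i / sqrt (real n)) * restrict z A i)"
          using A by (intro sum.cong) (auto simp: distrib_left)
        then show ?thesis by (simp add: c'_def sum.distrib)
      qed
      ultimately have "gaussian_rv (gaussian_measure M) (\<lambda>z. c + (\<Sum>i\<in>A. h i * (\<lambda>i\<in>M. f i + z i / sqrt (real n)) i))"
        by simp
      moreover have "(\<lambda>y. c + (\<Sum>i\<in>A. h i * y i)) \<in> borel_measurable (sequence_data_space M)"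
        using A unfolding sequence_data_space_def
        by (intro borel_measurable_add borel_measurable_sum borel_measurable_times borel_measurable_const)
           (auto intro!: measurable_component_singleton)
      ultimately show "gaussian_rv (gaussian_sequence M n f) (\<lambda>y. c + (\<Sum>i\<in>A. h i * y i))"
        unfolding gaussian_sequence_def
        by (subst gaussian_rv_distr[OF gaussian_sequence_map_measurable]) simp_all
    qed
  qed
qed

section \<open>The white noise model\<close>

lemma unit_interval_lmeasurable: "unit_interval \<in> lmeasurable"
  by (simp add: unit_interval_def)

lemma L2_space_integrable: "f \<in> L2_space \<Longrightarrow> integrable (lebesgue_on unit_interval) f"
  using finite_measure.square_integrable_imp_integrable[OF finite_measure_lebesgue_on[OF unit_interval_lmeasurable]]
  unfolding L2_space_def by blast

lemma L2_space_diff: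
  assumes f: "f \<in> L2_space" and g: "g \<in> L2_space"
  shows "g - f \<in> L2_space"
proof -
  have [measurable]: "f \<in> borel_measurable (lebesgue_on unit_interval)" "g \<in> borel_measurable (lebesgue_on unit_interval)"
    using f g by (auto simp: L2_space_def)
  have "integrable (lebesgue_on unit_interval) (\<lambda>t. (g t - f t)\<^sup>2)"
  proof (rule Bochner_Integration.integrable_bound)
    show "integrable (lebesgue_on unit_interval) (\<lambda>t. 2 * (g t)\<^sup>2 + 2 * (f t)\<^sup>2)"
      using f g by (simp add: L2_space_def)
    have "(g t - f t)\<^sup>2 \<le> 2 * (g t)\<^sup>2 + 2 * (f t)\<^sup>2" for t
      using zero_le_power2[of "g t + f t"] by (simp add: power2_eq_square algebra_simps)
    then show "AE t in lebesgue_on unit_interval. norm ((g t - f t)\<^sup>2) \<le> norm (2 * (g t)\<^sup>2 + 2 * (f t)\<^sup>2)"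
      by simp
  qed measurable
  moreover have "g - f \<in> borel_measurable (lebesgue_on unit_interval)"
    unfolding fun_diff_def by measurable
  ultimately show ?thesis by (simp add: L2_space_def)
qed

section \<open>The signal as a continuous path\<close>

definition drift :: "(real \<Rightarrow> real) \<Rightarrow> real \<Rightarrow> real" where
  "drift f t = (\<integral>s. f s \<partial>lebesgue_on {-1/2..t})"

lemma drift_eq: "drift f t = (\<integral>x. indicator {-1/2..t} x * f x \<partial>lebesgue)"
  unfolding drift_def by (subst integral_restrict_space) simp_all

lemma drift_left: "drift f (-1/2) = 0"
  unfolding drift_eq
proof (rule integral_eq_zero_AE)
  have "AE x in lebesgue. x \<noteq> (-1/2 :: real)"
    by (rule AE_completion) (rule AE_lborel_singleton)
  then show "AE x in lebesgue. indicator {-1/2..-1/2} x * f x = 0"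
    by eventually_elim (simp add: indicator_def)
qed

text \<open>Half-open intervals make neighbouring grid cells disjoint, so that integrals over the
  cells add up.\<close>

lemma drift_increment:
  assumes f: "integrable (lebesgue_on unit_interval) f"
    and st: "s \<in> unit_interval" "t \<in> unit_interval" "s \<le> t"
  shows "drift f t - drift f s = (\<integral>x. indicator {s<..t} x * f x \<partial>lebesgue_on unit_interval)"
proof -
  have i: "integrable lebesgue (\<lambda>x. indicator unit_interval x * f x)"
    using f by (subst (asm) integrable_restrict_space) (simp_all add: unit_interval_def)
  have "integrable lebesgue (\<lambda>x. indicator {-1/2..u} x * f x)" if "u \<in> unit_interval" for u
  proof -
    have "integrable lebesgue (\<lambda>x. indicator {-1/2..u} x *\<^sub>R (indicator unit_interval x * f x))"
      using i by (intro integrable_mult_indicator) auto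
    also have "(\<lambda>x. indicator {-1/2..u} x *\<^sub>R (indicator unit_interval x * f x)) = (\<lambda>x. indicator {-1/2..u} x * f x)"
      using that by (auto simp: unit_interval_def indicator_def fun_eq_iff)
    finally show ?thesis .
  qed
  then have "drift f t - drift f s = (\<integral>x. indicator {-1/2..t} x * f x - indicator {-1/2..s} x * f x \<partial>lebesgue)"
    unfolding drift_eq using st by (subst Bochner_Integration.integral_diff) auto
  also have "\<dots> = (\<integral>x. indicator unit_interval x *\<^sub>R (indicator {s<..t} x * f x) \<partial>lebesgue)"
    using st by (intro Bochner_Integration.integral_cong) (auto simp: unit_interval_def indicator_def)
  also have "\<dots> = (\<integral>x. indicator {s<..t} x * f x \<partial>lebesgue_on unit_interval)"
    by (subst integral_restrict_space) (simp_all add: unit_interval_def)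
  finally show ?thesis .
qed

lemma integrable_indicator_interval:
  fixes h :: "real \<Rightarrow> real"
  assumes h: "integrable (lebesgue_on unit_interval) h"
  shows "integrable (lebesgue_on unit_interval) (\<lambda>x. indicator {s<..t} x * h x)"
proof -
  have "{s<..t} \<inter> unit_interval \<in> sets (lebesgue_on unit_interval)"
    by (auto simp: sets_restrict_space unit_interval_def)
  then have "integrable (lebesgue_on unit_interval) (\<lambda>x. indicator ({s<..t} \<inter> unit_interval) x *\<^sub>R h x)"
    using h by (rule integrable_mult_indicator)
  then show ?thesis
    by (rule Bochner_Integration.integrable_cong[THEN iffD1, rotated -1]) (auto simp: indicator_def)
qed

lemma integrable_indicator_L2:
  "f \<in> L2_space \<Longrightarrow> integrable (lebesgue_on unit_interval) (\<lambda>x. indicator {s<..t} x * (f x)\<^sup>2)"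
  by (rule integrable_indicator_interval) (simp add: L2_space_def)

text \<open>Cauchy-Schwarz for the indicator, which is its own square, and its product with
  \<open>f\<close>. The inequality yields both the continuity of the drift and the bound on the
  shift along a grid.\<close>

lemma drift_increment_square_le:
  assumes f: "f \<in> L2_space" and st: "s \<in> unit_interval" "t \<in> unit_interval" "s \<le> t"
  shows "(drift f t - drift f s)\<^sup>2 \<le> (t - s) * (\<integral>x. indicator {s<..t} x * (f x)\<^sup>2 \<partial>lebesgue_on unit_interval)"
proof -
  let ?M = "lebesgue_on unit_interval"
  have fm [measurable]: "f \<in> borel_measurable ?M" using f by (simp add: L2_space_def)
  have im [measurable]: "(indicator {s<..t} :: real \<Rightarrow> real) \<in> borel_measurable ?M"
    by (intro measurable_restrict_space1 borel_measurable_indicator) auto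
  have sq: "((indicator {s<..t} x :: real))\<^sup>2 = indicator {s<..t} x" for x
    by (simp add: indicator_def)
  have one: "(\<integral>x. indicator {s<..t} x \<partial>?M) = t - s" "integrable ?M (indicator {s<..t} :: real \<Rightarrow> real)"
  proof -
    have "(\<integral>x. indicator {s<..t} x \<partial>?M) =
        (\<integral>x. indicator unit_interval x *\<^sub>R indicator {s<..t} x \<partial>lebesgue :: real)"
      by (subst integral_restrict_space) (simp_all add: unit_interval_def)
    moreover have "indicator unit_interval x *\<^sub>R indicator {s<..t} x = (indicator {s<..t} x :: real)" for x
      using st by (auto simp: unit_interval_def indicator_def)
    ultimately have "(\<integral>x. indicator {s<..t} x \<partial>?M) = (\<integral>x. indicator {s<..t} x \<partial>lebesgue :: real)"
      by (simp only:)
    then show "(\<integral>x. indicator {s<..t} x \<partial>?M) = t - s" using st by simp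
    show "integrable ?M (indicator {s<..t} :: real \<Rightarrow> real)"
      by (rule finite_measure.integrable_const_bound[OF finite_measure_lebesgue_on[OF unit_interval_lmeasurable], where B=1])
         (auto simp: indicator_def)
  qed
  have "drift f t - drift f s = (\<integral>x. indicator {s<..t} x * (indicator {s<..t} x * f x) \<partial>?M)"
    unfolding drift_increment[OF L2_space_integrable[OF f] st]
    by (rule Bochner_Integration.integral_cong) (auto simp: indicator_def)
  also have "\<dots>\<^sup>2 \<le> (\<integral>x. (indicator {s<..t} x)\<^sup>2 \<partial>?M) * (\<integral>x. (indicator {s<..t} x * f x)\<^sup>2 \<partial>?M)"
    using one integrable_indicator_L2[OF f]
    by (intro Cauchy_Schwarz_integral(2)) (simp_all add: power_mult_distrib sq)
  finally show ?thesis using one by (simp add: power_mult_distrib sq)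
qed

lemma L2_norm_square: "(L2_norm f)\<^sup>2 = (\<integral>x. (f x)\<^sup>2 \<partial>lebesgue_on unit_interval)"
  by (simp add: L2_norm_def)

text \<open>The drift is Hoelder continuous of exponent 1/2 with constant \<open>L2_norm f\<close>.
  Continuity places the observed path in \<open>path_space\<close>.\<close>

lemma drift_continuous:
  assumes f: "f \<in> L2_space"
  shows "continuous_on unit_interval (drift f)"
proof -
  have le: "\<bar>drift f t - drift f s\<bar> \<le> sqrt (t - s) * L2_norm f"
    if st: "s \<in> unit_interval" "t \<in> unit_interval" "s \<le> t" for s t
  proof -
    have "(\<integral>x. indicator {s<..t} x * (f x)\<^sup>2 \<partial>lebesgue_on unit_interval) \<le> (L2_norm f)\<^sup>2"
      unfolding L2_norm_square using f
      by (intro integral_mono integrable_indicator_L2) (auto simp: L2_space_def indicator_def)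
    then have "(drift f t - drift f s)\<^sup>2 \<le> (t - s) * (L2_norm f)\<^sup>2"
      using drift_increment_square_le[OF f st] st(3) by (meson diff_ge_0_iff_ge mult_left_mono order_trans)
    then have "\<bar>drift f t - drift f s\<bar>\<^sup>2 \<le> (sqrt (t - s) * L2_norm f)\<^sup>2"
      using st(3) by (simp add: power_mult_distrib)
    then show ?thesis
      by (rule power2_le_imp_le) (use st(3) in \<open>simp add: L2_norm_def\<close>)
  qed
  have le': "\<bar>drift f t - drift f s\<bar> \<le> sqrt \<bar>t - s\<bar> * L2_norm f"
    if st: "s \<in> unit_interval" "t \<in> unit_interval" for s t
    using le[of s t] le[of t s] st by (cases "s \<le> t") (auto simp: abs_minus_commute)
  show ?thesis unfolding continuous_on_def
  proof
    fix s assume s: "s \<in> unit_interval"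
    have "((\<lambda>t. sqrt \<bar>t - s\<bar> * L2_norm f) \<longlongrightarrow> sqrt \<bar>s - s\<bar> * L2_norm f) (at s within unit_interval)"
      by (intro tendsto_intros)
    then have "((\<lambda>t. sqrt \<bar>t - s\<bar> * L2_norm f) \<longlongrightarrow> 0) (at s within unit_interval)" by simp
    moreover have "\<forall>\<^sub>F t in at s within unit_interval. norm (drift f t - drift f s) \<le> sqrt \<bar>t - s\<bar> * L2_norm f"
      using le'[OF s] by (auto simp: eventually_at_filter)
    ultimately have "((\<lambda>t. drift f t - drift f s) \<longlongrightarrow> 0) (at s within unit_interval)"
      by (rule Lim_null_comparison[rotated])
    then show "(drift f \<longlongrightarrow> drift f s) (at s within unit_interval)" by (rule Lim_null[THEN iffD2])
  qed
qed

lemma space_path_space: "space path_space = (\<Pi>\<^sub>E i\<in>unit_interval. UNIV) \<inter> {w. continuous_on unit_interval w}"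
  by (auto simp: path_space_def space_restrict_space space_PiM)

lemma path_space_component: "t \<in> unit_interval \<Longrightarrow> (\<lambda>w. w t) \<in> borel_measurable path_space"
  unfolding path_space_def by (intro measurable_restrict_space1 measurable_component_singleton)

definition signal_plus_noise :: "nat \<Rightarrow> (real \<Rightarrow> real) \<Rightarrow> (real \<Rightarrow> real) \<Rightarrow> real \<Rightarrow> real" where
  "signal_plus_noise n f w = (\<lambda>t\<in>unit_interval. drift f t + w t / sqrt (real n))"

lemma signal_plus_noise_measurable:
  assumes f: "f \<in> L2_space" and W: "sets W = sets path_space"
  shows "signal_plus_noise n f \<in> W \<rightarrow>\<^sub>M path_space"
proof -
  have "signal_plus_noise n f \<in> path_space \<rightarrow>\<^sub>M restrict_space (Pi\<^sub>M unit_interval (\<lambda>_. borel)) {w. continuous_on unit_interval w}"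
  proof (rule measurable_restrict_space2)
    show "signal_plus_noise n f \<in> path_space \<rightarrow>\<^sub>M Pi\<^sub>M unit_interval (\<lambda>_. borel)"
      unfolding signal_plus_noise_def
      by (intro measurable_restrict borel_measurable_add borel_measurable_divide borel_measurable_const path_space_component)
    show "signal_plus_noise n f \<in> space path_space \<rightarrow> {w. continuous_on unit_interval w}"
    proof (rule Pi_I, rule CollectI)
      fix w assume "w \<in> space path_space"
      then have w: "continuous_on unit_interval w" by (simp add: space_path_space)
      have "continuous_on unit_interval (\<lambda>t. drift f t + w t * (1 / sqrt (real n)))"
        by (intro continuous_intros drift_continuous[OF f] w)
      then show "continuous_on unit_interval (signal_plus_noise n f w)"
        by (rule continuous_on_eq) (simp add: signal_plus_noise_def)
    qed
  qed
  then show ?thesis unfolding path_space_def[symmetric] using W by (simp cong: measurable_cong_sets)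
qed

lemma white_noise_eq: "white_noise W n f = distr W path_space (signal_plus_noise n f)"
  unfolding white_noise_def signal_plus_noise_def drift_def ..

section \<open>Increments along a finite grid\<close>

definition grid :: "nat \<Rightarrow> (nat \<Rightarrow> real) \<Rightarrow> bool" where
  "grid k \<tau> \<longleftrightarrow> (\<forall>i\<le>k. \<tau> i \<in> unit_interval) \<and> (\<forall>i<k. \<tau> i < \<tau> (Suc i))"

lemma gridD:
  assumes "grid k \<tau>" "i < k"
  shows "\<tau> i \<in> unit_interval" "\<tau> (Suc i) \<in> unit_interval" "\<tau> i < \<tau> (Suc i)"
  using assms by (auto simp: grid_def)

definition increments :: "nat \<Rightarrow> (nat \<Rightarrow> real) \<Rightarrow> (real \<Rightarrow> real) \<Rightarrow> nat \<Rightarrow> real" where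
  "increments k \<tau> y = (\<lambda>i\<in>{..<k}. y (\<tau> (Suc i)) - y (\<tau> i))"

lemma increments_measurable: "grid k \<tau> \<Longrightarrow> increments k \<tau> \<in> path_space \<rightarrow>\<^sub>M Pi\<^sub>M {..<k} (\<lambda>_. borel)"
  unfolding increments_def
  by (intro measurable_restrict borel_measurable_diff path_space_component) (simp_all add: grid_def)

text \<open>Divided by its standard deviation every increment is N(0,1), and independence makes the
  joint law a product. White noise on a grid thereby becomes an affine image of
  \<open>gaussian_measure {..<k}\<close>.\<close>

lemma wiener_increments:
  assumes W: "wiener_measure W" and \<tau>: "grid k \<tau>"
  shows "distr W (Pi\<^sub>M {..<k} (\<lambda>_. borel))
      (\<lambda>w. \<lambda>i\<in>{..<k}. (w (\<tau> (Suc i)) - w (\<tau> i)) / sqrt (\<tau> (Suc i) - \<tau> i)) = gaussian_measure {..<k}"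
proof -
  define \<xi> where "\<xi> i w = (w (\<tau> (Suc i)) - w (\<tau> i)) / sqrt (\<tau> (Suc i) - \<tau> i)" for i and w :: "real \<Rightarrow> real"
  interpret prob_space W using W by (simp add: wiener_measure_def)
  have sW: "sets W = sets path_space" using W by (simp add: wiener_measure_def)
  have m: "\<xi> i \<in> borel_measurable W" if "i < k" for i
    using path_space_component[OF gridD(1)[OF \<tau> that]] path_space_component[OF gridD(2)[OF \<tau> that]] sW
    unfolding \<xi>_def by (simp cong: measurable_cong_sets)
  have N: "distr W borel (\<xi> i) = std_normal_distribution" if i: "i < k" for i
  proof -
    have "distributed W lborel (\<lambda>w. w (\<tau> (Suc i)) - w (\<tau> i)) (normal_density 0 (sqrt (\<tau> (Suc i) - \<tau> i)))"
      using W gridD[OF \<tau> i] unfolding wiener_measure_def by blast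
    then have "distributed W lborel (\<xi> i) std_normal_density"
      using normal_standard_normal_convert[of "sqrt (\<tau> (Suc i) - \<tau> i)" "\<lambda>w. w (\<tau> (Suc i)) - w (\<tau> i)" 0] gridD[OF \<tau> i]
      unfolding \<xi>_def by simp
    from distributed_distr_eq_density[OF this] show ?thesis by (simp cong: distr_cong)
  qed
  have "distr W (Pi\<^sub>M {..<k} (\<lambda>_. borel)) (\<lambda>w. \<lambda>i\<in>{..<k}. \<xi> i w) = gaussian_measure {..<k}"
  \<comment> \<open>The characterisation of independence by product laws requires a nonempty index
    set; for \<open>k = 0\<close> both sides are the point mass on the empty function.\<close>
  proof (cases "k = 0")
    case True
    interpret N: product_prob_space "\<lambda>_::nat. std_normal_distribution"
      by (rule product_prob_space_std_normal)
    have mm: "(\<lambda>w. \<lambda>i\<in>{..<k}. \<xi> i w) \<in> W \<rightarrow>\<^sub>M Pi\<^sub>M {..<k} (\<lambda>_. borel)"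
      by (intro measurable_restrict) (auto simp: m)
    interpret D: prob_space "distr W (Pi\<^sub>M {..<k} (\<lambda>_. borel)) (\<lambda>w. \<lambda>i\<in>{..<k}. \<xi> i w)"
      by (rule prob_space_distr[OF mm])
    show ?thesis
    proof (rule N.PiM_eqI)
      fix A :: "nat \<Rightarrow> real set"
      show "emeasure (distr W (Pi\<^sub>M {..<k} (\<lambda>_. borel)) (\<lambda>w. \<lambda>i\<in>{..<k}. \<xi> i w)) (Pi\<^sub>E {..<k} A) =
          (\<Prod>i\<in>{..<k}. emeasure std_normal_distribution (A i))"
        using D.emeasure_space_1 True by (simp add: space_PiM)
    qed (simp_all add: sets_gaussian_measure)
  next
    case False
    have "indep_vars (\<lambda>_. borel) (\<lambda>i w. w (\<tau> (Suc i)) - w (\<tau> i)) {..<k}"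
      using W \<tau> unfolding wiener_measure_def grid_def by blast
    then have "indep_vars (\<lambda>_. borel) \<xi> {..<k}"
      unfolding \<xi>_def by (rule indep_vars_compose2) simp
    then have "distr W (Pi\<^sub>M {..<k} (\<lambda>_. borel)) (\<lambda>w. \<lambda>i\<in>{..<k}. \<xi> i w) = (\<Pi>\<^sub>M i\<in>{..<k}. distr W borel (\<xi> i))"
      using False m by (subst (asm) indep_vars_iff_distr_eq_PiM') auto
    also have "\<dots> = gaussian_measure {..<k}"
      by (intro PiM_cong) (auto simp: N)
    finally show ?thesis .
  qed
  then show ?thesis by (simp add: \<xi>_def)
qed

definition grid_mean :: "(real \<Rightarrow> real) \<Rightarrow> (nat \<Rightarrow> real) \<Rightarrow> nat \<Rightarrow> real" where
  "grid_mean f \<tau> i = drift f (\<tau> (Suc i)) - drift f (\<tau> i)"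

definition grid_sd :: "nat \<Rightarrow> (nat \<Rightarrow> real) \<Rightarrow> nat \<Rightarrow> real" where
  "grid_sd n \<tau> i = sqrt (\<tau> (Suc i) - \<tau> i) / sqrt (real n)"

lemma white_noise_increments:
  assumes W: "wiener_measure W" and \<tau>: "grid k \<tau>" and f: "f \<in> L2_space"
  shows "distr (white_noise W n f) (Pi\<^sub>M {..<k} (\<lambda>_. borel)) (increments k \<tau>) =
    distr (gaussian_measure {..<k}) (Pi\<^sub>M {..<k} (\<lambda>_. borel)) (\<lambda>x. \<lambda>i\<in>{..<k}. grid_mean f \<tau> i + grid_sd n \<tau> i * x i)"
proof -
  have sW: "sets W = sets path_space" using W by (simp add: wiener_measure_def)
  let ?N = "Pi\<^sub>M {..<k} (\<lambda>_. borel) :: (nat \<Rightarrow> real) measure"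
  let ?\<xi> = "\<lambda>w. \<lambda>i\<in>{..<k}. (w (\<tau> (Suc i)) - w (\<tau> i)) / sqrt (\<tau> (Suc i) - \<tau> i)"
  let ?a = "\<lambda>x. \<lambda>i\<in>{..<k}. grid_mean f \<tau> i + grid_sd n \<tau> i * x i"
  have \<xi>: "?\<xi> \<in> W \<rightarrow>\<^sub>M ?N"
  proof (rule measurable_restrict)
    fix i assume "i \<in> {..<k}"
    then have i: "i < k" by simp
    show "(\<lambda>w. (w (\<tau> (Suc i)) - w (\<tau> i)) / sqrt (\<tau> (Suc i) - \<tau> i)) \<in> borel_measurable W"
      using path_space_component[OF gridD(1)[OF \<tau> i]] path_space_component[OF gridD(2)[OF \<tau> i]] sW
      by (simp cong: measurable_cong_sets)
  qed
  have a: "?a \<in> ?N \<rightarrow>\<^sub>M ?N" by measurable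
  have "distr (white_noise W n f) ?N (increments k \<tau>) = distr W ?N (\<lambda>w. increments k \<tau> (signal_plus_noise n f w))"
    unfolding white_noise_eq
    by (subst distr_distr[OF increments_measurable[OF \<tau>] signal_plus_noise_measurable[OF f sW]]) (simp add: comp_def)
  also have "(\<lambda>w. increments k \<tau> (signal_plus_noise n f w)) = (\<lambda>w. ?a (?\<xi> w))"
  proof (rule ext, unfold increments_def, rule restrict_ext)
    fix w i assume "i \<in> {..<k}"
    then have i: "i < k" by simp
    have "sqrt (\<tau> (Suc i) - \<tau> i) \<noteq> 0" using gridD[OF \<tau> i] by simp
    then have "grid_sd n \<tau> i * ((w (\<tau> (Suc i)) - w (\<tau> i)) / sqrt (\<tau> (Suc i) - \<tau> i)) =
        (w (\<tau> (Suc i)) - w (\<tau> i)) / sqrt (real n)"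
      by (simp add: grid_sd_def)
    moreover have "signal_plus_noise n f w (\<tau> (Suc i)) - signal_plus_noise n f w (\<tau> i) =
        (drift f (\<tau> (Suc i)) - drift f (\<tau> i)) + (w (\<tau> (Suc i)) - w (\<tau> i)) / sqrt (real n)"
      using gridD[OF \<tau> i] by (simp add: signal_plus_noise_def diff_divide_distrib)
    moreover have "?\<xi> w i = (w (\<tau> (Suc i)) - w (\<tau> i)) / sqrt (\<tau> (Suc i) - \<tau> i)" using i by simp
    ultimately show "signal_plus_noise n f w (\<tau> (Suc i)) - signal_plus_noise n f w (\<tau> i) =
        grid_mean f \<tau> i + grid_sd n \<tau> i * ?\<xi> w i"
      by (simp only: grid_mean_def)
  qed
  also have "distr W ?N (\<lambda>w. ?a (?\<xi> w)) = distr (distr W ?N ?\<xi>) ?N ?a"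
    by (subst distr_distr[OF a \<xi>]) (simp add: comp_def)
  also have "\<dots> = distr (gaussian_measure {..<k}) ?N ?a"
    unfolding wiener_increments[OF W \<tau>] ..
  finally show ?thesis .
qed

lemma prob_space_white_noise:
  assumes W: "wiener_measure W" and f: "f \<in> L2_space"
  shows "prob_space (white_noise W n f)"
  unfolding white_noise_eq using W f
  by (intro prob_space.prob_space_distr signal_plus_noise_measurable) (auto simp: wiener_measure_def)

lemma sets_white_noise: "sets (white_noise W n f) = sets path_space"
  by (simp add: white_noise_def)

lemma space_white_noise: "space (white_noise W n f) = space path_space"
  by (simp add: white_noise_def)

text \<open>Increments determine the values of a path only together with its starting value.\<close>

lemma white_noise_start:
  assumes W: "wiener_measure W" and f: "f \<in> L2_space"
  shows "AE y in white_noise W n f. y (-1/2) = 0"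
proof -
  have sW: "sets W = sets path_space" using W by (simp add: wiener_measure_def)
  have u: "-1/2 \<in> unit_interval" by (simp add: unit_interval_def)
  have "AE w in W. signal_plus_noise n f w (-1/2) = 0"
    using W u drift_left[of f] unfolding wiener_measure_def signal_plus_noise_def by auto
  moreover have "{y \<in> space path_space. y (-1/2) = 0} \<in> sets path_space"
    using path_space_component[OF u] by measurable
  ultimately show ?thesis unfolding white_noise_eq
    using signal_plus_noise_measurable[OF f sW] by (subst AE_distr_iff) auto
qed

lemma sum_indicator_grid:
  fixes \<tau> :: "nat \<Rightarrow> real"
  assumes "\<forall>i<k. \<tau> i < \<tau> (Suc i)"
  shows "(\<Sum>i<k. indicator {\<tau> i<..\<tau> (Suc i)} x) = (indicator {\<tau> 0<..\<tau> k} x :: real)"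
proof -
  \<comment> \<open>The order of the end points is carried along: it makes the old interval and the
    new cell join to a single interval.\<close>
  have "\<tau> 0 \<le> \<tau> k \<and> (\<Sum>i<k. indicator {\<tau> i<..\<tau> (Suc i)} x) = (indicator {\<tau> 0<..\<tau> k} x :: real)"
    using assms
  proof (induction k)
    case (Suc k)
    then have k: "\<tau> 0 \<le> \<tau> k" "\<tau> k < \<tau> (Suc k)"
      and IH: "(\<Sum>i<k. indicator {\<tau> i<..\<tau> (Suc i)} x) = (indicator {\<tau> 0<..\<tau> k} x :: real)"
      by auto
    have "(\<Sum>i<Suc k. indicator {\<tau> i<..\<tau> (Suc i)} x) =
        (indicator {\<tau> 0<..\<tau> k} x + indicator {\<tau> k<..\<tau> (Suc k)} x :: real)"
      by (simp only: sum.lessThan_Suc IH)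
    also have "\<dots> = indicator {\<tau> 0<..\<tau> (Suc k)} x"
      using k by (auto simp: indicator_def)
    finally show ?case using k by simp
  qed simp
  then show ?thesis ..
qed

text \<open>The grid is the sorted list of the times in \<open>J\<close> and the left end point,
  which comes first because it is the least element of \<open>unit_interval\<close>;
  \<open>m t\<close> is the position of \<open>t\<close>.\<close>

lemma grid_covering:
  assumes J: "finite J" "J \<subseteq> unit_interval"
  shows "\<exists>k \<tau> m. grid k \<tau> \<and> \<tau> 0 = -1/2 \<and> (\<forall>t\<in>J. m t \<le> k \<and> \<tau> (m t) = t)"
proof -
  define xs where "xs = sorted_list_of_set (insert (-1/2) J)"
  have set: "set xs = insert (-1/2) J" and st: "sorted_wrt (<) xs"
    unfolding xs_def
    using set_sorted_list_of_set[of "insert (-1/2) J"] strict_sorted_list_of_set[of "insert (-1/2) J"] J(1) by blast+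
  define k where "k = length xs - 1"
  have len: "length xs = Suc k" using set unfolding k_def by (cases xs) auto
  have lt: "xs ! i < xs ! j" if "i < j" "j \<le> k" for i j
    using sorted_wrt_nth_less[OF st, of i j] that len by simp
  have inU: "xs ! i \<in> unit_interval" if "i \<le> k" for i
  proof -
    have "xs ! i \<in> set xs" using that len by (intro nth_mem) simp
    then show ?thesis using set J(2) by (auto simp: unit_interval_def)
  qed
  have "\<forall>t\<in>J. \<exists>m. m \<le> k \<and> xs ! m = t"
    using set len by (metis in_set_conv_nth insertCI less_Suc_eq_le)
  then obtain m where m: "\<forall>t\<in>J. m t \<le> k \<and> xs ! (m t) = t" by metis
  obtain p where p: "p \<le> k" "xs ! p = -1/2"
    using set len by (metis in_set_conv_nth insertI1 less_Suc_eq_le)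
  have "xs ! 0 = -1/2"
  proof (cases "p = 0")
    case False
    then show ?thesis using lt[of 0 p] p inU[of 0] by (simp add: unit_interval_def)
  qed (use p in simp)
  then show ?thesis using inU lt m
    by (intro exI[of _ k] exI[of _ "\<lambda>i. xs ! i"] exI[of _ m]) (auto simp: grid_def)
qed

text \<open>On each cell Cauchy-Schwarz bounds the squared standardised increment by
  \<open>n\<close> times the integral of \<open>h\<close> squared over that cell. The cells are
  disjoint, so the sum stays below the full integral, whatever the grid.\<close>

lemma grid_shift_le:
  assumes h: "h \<in> L2_space" and \<tau>: "grid k \<tau>" and n: "1 \<le> n"
  shows "(\<Sum>i<k. (grid_mean h \<tau> i / grid_sd n \<tau> i)\<^sup>2) \<le> (sqrt (real n) * L2_norm h)\<^sup>2"
proof -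
  let ?M = "lebesgue_on unit_interval"
  have "(\<Sum>i<k. (grid_mean h \<tau> i / grid_sd n \<tau> i)\<^sup>2) \<le>
      (\<Sum>i<k. real n * (\<integral>x. indicator {\<tau> i<..\<tau> (Suc i)} x * (h x)\<^sup>2 \<partial>?M))"
  proof (rule sum_mono)
    fix i assume "i \<in> {..<k}"
    then have i: "\<tau> i \<in> unit_interval" "\<tau> (Suc i) \<in> unit_interval" "\<tau> i < \<tau> (Suc i)"
      using gridD[OF \<tau>] by auto
    have "(grid_mean h \<tau> i / grid_sd n \<tau> i)\<^sup>2 = real n * ((drift h (\<tau> (Suc i)) - drift h (\<tau> i))\<^sup>2 / (\<tau> (Suc i) - \<tau> i))"
      using i n by (simp add: grid_mean_def grid_sd_def power_divide power_mult_distrib)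
    also have "\<dots> \<le> real n * (\<integral>x. indicator {\<tau> i<..\<tau> (Suc i)} x * (h x)\<^sup>2 \<partial>?M)"
      using drift_increment_square_le[OF h i(1,2)] i(3)
      by (intro mult_left_mono) (simp_all add: divide_le_eq mult.commute)
    finally show "(grid_mean h \<tau> i / grid_sd n \<tau> i)\<^sup>2 \<le> real n * (\<integral>x. indicator {\<tau> i<..\<tau> (Suc i)} x * (h x)\<^sup>2 \<partial>?M)" .
  qed
  also have "\<dots> = real n * (\<integral>x. (\<Sum>i<k. indicator {\<tau> i<..\<tau> (Suc i)} x * (h x)\<^sup>2) \<partial>?M)"
    using integrable_indicator_L2[OF h] by (subst Bochner_Integration.integral_sum) (auto simp: sum_distrib_left)
  also have "(\<lambda>x. \<Sum>i<k. indicator {\<tau> i<..\<tau> (Suc i)} x * (h x)\<^sup>2) = (\<lambda>x. indicator {\<tau> 0<..\<tau> k} x * (h x)\<^sup>2)"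
    using \<tau> by (simp add: sum_indicator_grid grid_def flip: sum_distrib_right)
  also have "real n * (\<integral>x. indicator {\<tau> 0<..\<tau> k} x * (h x)\<^sup>2 \<partial>?M) \<le> real n * (\<integral>x. (h x)\<^sup>2 \<partial>?M)"
    using h by (intro mult_left_mono integral_mono integrable_indicator_L2) (auto simp: L2_space_def indicator_def)
  also have "\<dots> = (sqrt (real n) * L2_norm h)\<^sup>2" by (simp add: power_mult_distrib L2_norm_square)
  finally show ?thesis .
qed

section \<open>Comparison of two white noise laws\<close>

lemma grid_mean_diff:
  assumes f: "f \<in> L2_space" and g: "g \<in> L2_space" and \<tau>: "grid k \<tau>" "i < k"
  shows "grid_mean (g - f) \<tau> i = grid_mean g \<tau> i - grid_mean f \<tau> i"
proof -
  note i = gridD(1,2)[OF \<tau>] less_imp_le[OF gridD(3)[OF \<tau>]]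
  have "indicator {\<tau> i<..\<tau> (Suc i)} x * (g - f) x =
      indicator {\<tau> i<..\<tau> (Suc i)} x * g x - indicator {\<tau> i<..\<tau> (Suc i)} x * f x" for x
    unfolding minus_apply by (rule right_diff_distrib)
  then show ?thesis
    unfolding grid_mean_def drift_increment[OF L2_space_integrable[OF L2_space_diff[OF f g]] i]
      drift_increment[OF L2_space_integrable[OF f] i] drift_increment[OF L2_space_integrable[OF g] i]
    by (simp only: Bochner_Integration.integral_diff integrable_indicator_interval L2_space_integrable f g)
qed

text \<open>For a path that starts at 0, which is almost every path, the partial sums of its
  increments are its values at the times in \<open>J\<close>. The cylinder thus agrees almost surely
  with the event that the increments lie in \<open>C\<close>.\<close>

lemma measure_white_noise_cylinder:
  assumes W: "wiener_measure W" and f: "f \<in> L2_space" and \<tau>: "grid k \<tau>" "\<tau> 0 = -1/2"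
    and J: "finite J" "J \<subseteq> unit_interval" and m: "\<forall>t\<in>J. m t \<le> k \<and> \<tau> (m t) = t"
    and B: "B \<in> sets (Pi\<^sub>M J (\<lambda>_. borel))"
    and C: "C = {v \<in> space (Pi\<^sub>M {..<k} (\<lambda>_. borel :: real measure)). (\<lambda>t\<in>J. \<Sum>l\<in>{..<m t}. v l) \<in> B}"
  shows "C \<in> sets (Pi\<^sub>M {..<k} (\<lambda>_. borel))"
    and "measure (white_noise W n f) {y \<in> space path_space. restrict y J \<in> B} =
      measure (gaussian_measure {..<k})
        {x \<in> space (gaussian_measure {..<k}). (\<lambda>i\<in>{..<k}. grid_mean f \<tau> i + grid_sd n \<tau> i * x i) \<in> C}"
proof -
  let ?N = "Pi\<^sub>M {..<k} (\<lambda>_. borel) :: (nat \<Rightarrow> real) measure"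
  let ?\<Phi> = "\<lambda>v. \<lambda>t\<in>J. \<Sum>l\<in>{..<m t}. v l :: real"
  let ?P = "white_noise W n f"
  have "?\<Phi> \<in> ?N \<rightarrow>\<^sub>M Pi\<^sub>M J (\<lambda>_. borel)"
  proof (rule measurable_restrict)
    fix t assume "t \<in> J"
    then have "m t \<le> k" using m by blast
    then show "(\<lambda>v. \<Sum>l\<in>{..<m t}. v l) \<in> borel_measurable ?N"
      by (intro borel_measurable_sum measurable_component_singleton) auto
  qed
  then show Cs: "C \<in> sets ?N" unfolding C using B by measurable
  interpret prob_space ?P by (rule prob_space_white_noise[OF W f])
  have inc: "increments k \<tau> \<in> ?P \<rightarrow>\<^sub>M ?N"
    using increments_measurable[OF \<tau>(1)] by (simp add: sets_white_noise cong: measurable_cong_sets)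
  have res: "(\<lambda>y. restrict y J) \<in> ?P \<rightarrow>\<^sub>M Pi\<^sub>M J (\<lambda>_. borel)"
    using measurable_restrict_space1[OF measurable_restrict_subset[OF J(2)]]
    by (simp add: sets_white_noise path_space_def cong: measurable_cong_sets)
  have eq: "?\<Phi> (increments k \<tau> y) = restrict y J" if "y (-1/2) = 0" for y
  proof (rule restrict_ext)
    fix t assume t: "t \<in> J"
    then have mt: "m t \<le> k" "\<tau> (m t) = t" using m by auto
    have "(\<Sum>l\<in>{..<m t}. increments k \<tau> y l) = (\<Sum>l<m t. y (\<tau> (Suc l)) - y (\<tau> l))"
      using mt by (intro sum.cong) (auto simp: increments_def)
    also have "\<dots> = y (\<tau> (m t)) - y (\<tau> 0)" by (rule sum_lessThan_telescope)
    finally show "(\<Sum>l\<in>{..<m t}. increments k \<tau> y l) = y t" using that mt \<tau>(2) by simp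
  qed
  have "measure ?P {y \<in> space path_space. restrict y J \<in> B} = measure ?P (increments k \<tau> -` C \<inter> space ?P)"
  proof (rule finite_measure_eq_AE)
    show "AE y in ?P. y \<in> {y \<in> space path_space. restrict y J \<in> B} \<longleftrightarrow> y \<in> increments k \<tau> -` C \<inter> space ?P"
      using white_noise_start[OF W f, of n] AE_space
    proof eventually_elim
      case (elim y)
      have "increments k \<tau> y \<in> space ?N" by (rule measurable_space[OF inc elim(2)])
      then show ?case using elim eq[of y, OF elim(1)] by (simp add: C space_white_noise)
    qed
    show "{y \<in> space path_space. restrict y J \<in> B} \<in> events"
      using measurable_sets[OF res B] by (simp add: space_white_noise vimage_def Int_def conj_commute)
    show "increments k \<tau> -` C \<inter> space ?P \<in> events" by (rule measurable_sets[OF inc Cs])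
  qed
  also have "\<dots> = measure (distr ?P ?N (increments k \<tau>)) C"
    by (rule measure_distr[OF inc Cs, symmetric])
  also have "\<dots> = measure (gaussian_measure {..<k})
        {x \<in> space (gaussian_measure {..<k}). (\<lambda>i\<in>{..<k}. grid_mean f \<tau> i + grid_sd n \<tau> i * x i) \<in> C}"
    unfolding white_noise_increments[OF W \<tau>(1) f]
    by (subst measure_distr[OF _ Cs]) (measurable, auto intro!: arg_cong2[where f=measure])
  finally show "measure (white_noise W n f) {y \<in> space path_space. restrict y J \<in> B} =
      measure (gaussian_measure {..<k})
        {x \<in> space (gaussian_measure {..<k}). (\<lambda>i\<in>{..<k}. grid_mean f \<tau> i + grid_sd n \<tau> i * x i) \<in> C}" .
qed

text \<open>True also for a function whose square is not integrable: its norm has the default value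
  0, and so has that of each multiple.\<close>

lemma L2_norm_scaleR: "L2_norm (c *\<^sub>R f) = \<bar>c\<bar> * L2_norm f"
  by (simp add: L2_norm_def scaleR_fun_def power_mult_distrib real_sqrt_mult)

text \<open>On a grid the two laws of the increments share their standard deviations and differ in
  their means, hence differ by a shift of the standardised noise.\<close>

lemma white_noise_total_variation:
  assumes W: "wiener_measure W" and n: "1 \<le> n" and f: "f \<in> L2_space" and g: "g \<in> L2_space"
    and A: "A \<in> sets path_space"
  shows "\<bar>measure (white_noise W n f) A - measure (white_noise W n g) A\<bar>
    \<le> sqrt (exp ((sqrt (real n) * L2_norm (g - f))\<^sup>2) - 1)"
proof (rule total_variation_from_cylinders)
  show "prob_space (white_noise W n f)" "prob_space (white_noise W n g)"
    by (intro prob_space_white_noise W f g)+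
  show "sets (white_noise W n g) = sets (white_noise W n f)" by (simp only: sets_white_noise)
  show "sets (white_noise W n f) =
      sets (restrict_space (Pi\<^sub>M unit_interval (\<lambda>_. borel)) {w. continuous_on unit_interval w})"
    by (simp only: sets_white_noise path_space_def)
  show "A \<in> sets (white_noise W n f)" using A by (simp only: sets_white_noise)
  fix J B assume J: "finite J" "J \<subseteq> unit_interval" and B: "B \<in> sets (Pi\<^sub>M J (\<lambda>_. borel :: real measure))"
  obtain k \<tau> m where \<tau>: "grid k \<tau>" "\<tau> 0 = -1/2" and m: "\<forall>t\<in>J. m t \<le> k \<and> \<tau> (m t) = t"
    using grid_covering[OF J] by blast
  define C where "C = {v \<in> space (Pi\<^sub>M {..<k} (\<lambda>_. borel :: real measure)). (\<lambda>t\<in>J. \<Sum>l\<in>{..<m t}. v l) \<in> B}"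
  note cyl = measure_white_noise_cylinder[OF W _ \<tau> J m B C_def]
  have Cs [measurable]: "C \<in> sets (Pi\<^sub>M {..<k} (\<lambda>_. borel))" by (rule cyl(1)[OF f])
  define E where "E = {x \<in> space (gaussian_measure {..<k}). (\<lambda>i\<in>{..<k}. grid_mean f \<tau> i + grid_sd n \<tau> i * x i) \<in> C}"
  \<comment> \<open>The difference of the grid means in units of the standard deviation of each
    increment.\<close>
  define d where "d i = grid_mean (g - f) \<tau> i / grid_sd n \<tau> i" for i
  have E: "E \<in> sets (gaussian_measure {..<k})" unfolding E_def by measurable
  have shift: "(\<lambda>i\<in>{..<k}. grid_mean f \<tau> i + grid_sd n \<tau> i * (\<lambda>i\<in>{..<k}. x i + d i) i) =
      (\<lambda>i\<in>{..<k}. grid_mean g \<tau> i + grid_sd n \<tau> i * x i)" for x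
  proof (rule restrict_ext)
    fix i assume "i \<in> {..<k}"
    then have i: "i < k" by simp
    have "grid_sd n \<tau> i \<noteq> 0" using gridD(3)[OF \<tau>(1) i] n by (simp add: grid_sd_def)
    then have "grid_sd n \<tau> i * d i = grid_mean g \<tau> i - grid_mean f \<tau> i"
      using grid_mean_diff[OF f g \<tau>(1) i] by (simp add: d_def)
    then show "grid_mean f \<tau> i + grid_sd n \<tau> i * (\<lambda>i\<in>{..<k}. x i + d i) i = grid_mean g \<tau> i + grid_sd n \<tau> i * x i"
      using i by (simp add: distrib_left)
  qed
  have "\<bar>measure (gaussian_measure {..<k}) E -
      measure (gaussian_measure {..<k}) {x \<in> space (gaussian_measure {..<k}). (\<lambda>i\<in>{..<k}. x i + d i) \<in> E}\<bar>
      \<le> sqrt (exp (\<Sum>i<k. (d i)\<^sup>2) - 1)"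
    by (rule gaussian_shift_bound[OF finite_lessThan E])
  also have "\<dots> \<le> sqrt (exp ((sqrt (real n) * L2_norm (g - f))\<^sup>2) - 1)"
    using grid_shift_le[OF L2_space_diff[OF f g] \<tau>(1) n] by (simp add: d_def)
  also have "{x \<in> space (gaussian_measure {..<k}). (\<lambda>i\<in>{..<k}. x i + d i) \<in> E} =
      {x \<in> space (gaussian_measure {..<k}). (\<lambda>i\<in>{..<k}. grid_mean g \<tau> i + grid_sd n \<tau> i * x i) \<in> C}"
    unfolding E_def mem_Collect_eq shift by (simp add: space_gaussian_measure)
  finally show "\<bar>measure (white_noise W n f) {w \<in> space (white_noise W n f). restrict w J \<in> B} -
      measure (white_noise W n g) {w \<in> space (white_noise W n f). restrict w J \<in> B}\<bar>
    \<le> sqrt (exp ((sqrt (real n) * L2_norm (g - f))\<^sup>2) - 1)"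
    unfolding space_white_noise cyl(2)[OF f] cyl(2)[OF g] E_def .
qed

lemma shift_experiment_white_noise:
  assumes W: "wiener_measure W" and n: "1 \<le> n"
  shows "shift_experiment path_space (white_noise W n) L2_norm L2_space n"
proof (rule shift_experiment.intro)
  show "1 \<le> n" by fact
  show "prob_space (white_noise W n f)" if "f \<in> L2_space" for f
    using W that by (rule prob_space_white_noise)
  show "sets (white_noise W n f) = sets path_space" for f by (rule sets_white_noise)
  show "L2_norm (c *\<^sub>R f) = \<bar>c\<bar> * L2_norm f" for c f by (rule L2_norm_scaleR)
qed (rule white_noise_total_variation[OF W n])

section \<open>Linear estimators in white noise\<close>

lemma gaussian_rv_step_integral:
  assumes W: "wiener_measure W" and f: "f \<in> L2_space" and \<tau>: "grid k \<tau>"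
  shows "gaussian_rv (white_noise W n f) (\<lambda>y. c + step_integral k \<tau> a y)"
proof -
  let ?N = "Pi\<^sub>M {..<k} (\<lambda>_. borel) :: (nat \<Rightarrow> real) measure"
  let ?P = "white_noise W n f"
  let ?L = "\<lambda>v. c + (\<Sum>i<k. a i * v i)"
  let ?a = "\<lambda>x. \<lambda>i\<in>{..<k}. grid_mean f \<tau> i + grid_sd n \<tau> i * x i"
  have L: "?L \<in> borel_measurable ?N" by measurable
  have a: "?a \<in> gaussian_measure {..<k} \<rightarrow>\<^sub>M ?N" by measurable
  have inc: "increments k \<tau> \<in> ?P \<rightarrow>\<^sub>M ?N"
    using increments_measurable[OF \<tau>] by (simp add: sets_white_noise cong: measurable_cong_sets)
  have "gaussian_rv (gaussian_measure {..<k})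
      (\<lambda>x. (c + (\<Sum>i<k. a i * grid_mean f \<tau> i)) + (\<Sum>i<k. (a i * grid_sd n \<tau> i) * x i))"
    by (rule gaussian_rv_linear) simp
  also have "(\<lambda>x. (c + (\<Sum>i<k. a i * grid_mean f \<tau> i)) + (\<Sum>i<k. (a i * grid_sd n \<tau> i) * x i)) = (\<lambda>x. ?L (?a x))"
    by (simp add: distrib_left sum.distrib mult.assoc add.assoc)
  finally have "gaussian_rv (distr (gaussian_measure {..<k}) ?N ?a) ?L"
    by (subst gaussian_rv_distr[OF a L])
  then have "gaussian_rv (distr ?P ?N (increments k \<tau>)) ?L"
    unfolding white_noise_increments[OF W \<tau> f] .
  then have "gaussian_rv ?P (\<lambda>y. ?L (increments k \<tau> y))"
    by (subst (asm) gaussian_rv_distr[OF inc L])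
  also have "(\<lambda>y. ?L (increments k \<tau> y)) = (\<lambda>y. c + step_integral k \<tau> a y)"
    by (simp add: step_integral_def increments_def)
  finally show ?thesis .
qed

text \<open>The integrals of the approximating step functions are linear in finitely many
  increments, hence Gaussian, and \<open>I\<close> is their mean square limit under every signal in
  \<open>L2_space\<close>.\<close>

lemma white_noise_linear_estimatorD:
  assumes S: "white_noise_linear_estimator W n S"
  shows "S \<in> borel_measurable path_space"
    and "\<lbrakk>wiener_measure W; f \<in> L2_space\<rbrakk> \<Longrightarrow> gaussian_rv (white_noise W n f) S"
proof -
  from S obtain c h I where h: "white_noise_integral W n h I" and S: "S = (\<lambda>y. c + I y)"
    unfolding white_noise_linear_estimator_def by auto
  from h have I: "I \<in> borel_measurable path_space" by (simp add: white_noise_integral_def)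
  from h obtain k \<tau> a where g: "\<forall>m. grid (k m) (\<tau> m)"
    and lim: "\<forall>f\<in>L2_space. (\<lambda>m. \<integral>\<^sup>+ y. ennreal ((I y - step_integral (k m) (\<tau> m) (a m) y)\<^sup>2) \<partial>white_noise W n f)
           \<longlonglongrightarrow> 0"
    unfolding white_noise_integral_def grid_def by blast
  show SM: "S \<in> borel_measurable path_space" unfolding S using I by measurable
  assume W: "wiener_measure W" and f: "f \<in> L2_space"
  show "gaussian_rv (white_noise W n f) S"
  proof (rule gaussian_rv_mean_square_limit)
    show "prob_space (white_noise W n f)" by (rule prob_space_white_noise[OF W f])
    show "S \<in> borel_measurable (white_noise W n f)"
      using SM by (simp add: sets_white_noise cong: measurable_cong_sets)
    show "sequentially \<noteq> bot" by simp
    show "\<forall>\<^sub>F m in sequentially. gaussian_rv (white_noise W n f) (\<lambda>y. c + step_integral (k m) (\<tau> m) (a m) y)"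
      by (intro always_eventually allI gaussian_rv_step_integral W f spec[OF g])
    show "(\<lambda>m. \<integral>\<^sup>+ y. ennreal ((S y - (c + step_integral (k m) (\<tau> m) (a m) y))\<^sup>2) \<partial>white_noise W n f) \<longlonglongrightarrow> 0"
      using bspec[OF lim f] by (simp add: S)
  qed
qed

section \<open>Adaptation in both models\<close>

lemma adaptation_constant_pos:
  assumes "0 < \<alpha>" "\<alpha> < 1 / 2"
  shows "0 < adaptation_constant \<alpha>"
proof -
  have "0 < normal_quantile (\<alpha> / 2 / 2)" using assms by (intro normal_quantile_pos) auto
  then have "0 < length_factor \<alpha>" by (simp add: length_factor_def add_pos_pos)
  then show ?thesis
    using detection_gap_pos[OF assms(2)] by (simp add: adaptation_constant_def)
qed

text \<open>Both models at once: \<open>admissible\<close> stands for the conditions on the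
  estimators at one sample size. The comparison of orders concerns the whole sequence and therefore
  asks for them at every \<open>n\<close>.\<close>

lemma adaptive_interval_conclusion:
  fixes P :: "nat \<Rightarrow> ('i \<Rightarrow> real) \<Rightarrow> 'd measure" and F :: "nat \<Rightarrow> ('i \<Rightarrow> real) set"
  assumes alpha: "0 < \<alpha>" "\<alpha> < 1 / 2"
    and loc: "\<And>n. \<lbrakk>1 \<le> n; admissible n\<rbrakk> \<Longrightarrow> adaptive_interval D (P n) N H n V T F \<alpha> (S n)"
  shows "(\<forall>n\<ge>1. admissible n \<longrightarrow>
      CI_adaptive (pair_modulus N T F n (\<alpha> / 2)) (S n) \<in> confidence_intervals D (P n) T \<alpha> (F 1 \<union> F 2) \<and>
      (\<forall>j\<in>{1,2}.
         min_max_length D (P n) T \<alpha> (F j) (F 1 \<union> F 2) \<le> max_length (P n) (CI_adaptive (pair_modulus N T F n (\<alpha> / 2)) (S n)) (F j) \<and>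
         max_length (P n) (CI_adaptive (pair_modulus N T F n (\<alpha> / 2)) (S n)) (F j)
           \<le> ennreal (adaptation_constant \<alpha>) * min_max_length D (P n) T \<alpha> (F j) (F 1 \<union> F 2))) \<and>
    ((\<forall>n\<ge>1. admissible n) \<longrightarrow>
      (\<forall>j\<in>{1,2}. same_order (\<lambda>n. max_length (P n) (CI_adaptive (pair_modulus N T F n (\<alpha> / 2)) (S n)) (F j))
         (\<lambda>n. e2ennreal (between_modulus N T (normal_quantile (\<alpha> / 2) / sqrt (real n)) (F j) (F 1 \<union> F 2)))))"
proof (intro conjI allI impI ballI)
  fix n j assume n: "1 \<le> n" and adm: "admissible n"
  interpret adaptive_interval D "P n" N H n V T F \<alpha> "S n" by (rule loc[OF n adm])
  show "CI_adaptive (pair_modulus N T F n (\<alpha> / 2)) (S n) \<in> confidence_intervals D (P n) T \<alpha> (F 1 \<union> F 2)"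
    by (rule CI_confidence)
  then show "min_max_length D (P n) T \<alpha> (F j) (F 1 \<union> F 2) \<le> max_length (P n) (CI_adaptive (pair_modulus N T F n (\<alpha> / 2)) (S n)) (F j)"
    unfolding min_max_length_def by (rule INF_lower)
  assume "j \<in> {1,2}"
  then show "max_length (P n) (CI_adaptive (pair_modulus N T F n (\<alpha> / 2)) (S n)) (F j)
      \<le> ennreal (adaptation_constant \<alpha>) * min_max_length D (P n) T \<alpha> (F j) (F 1 \<union> F 2)"
    by (rule adaptive_length_min_max)
next
  fix j :: nat assume adm: "\<forall>n\<ge>1. admissible n" and j: "j \<in> {1,2}"
  \<comment> \<open>\<open>a\<close> is the radius in the claim, \<open>z\<close> the radius used by
    the construction.\<close>
  define a where "a = normal_quantile (\<alpha> / 2)"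
  define z where "z = normal_quantile (\<alpha> / 2 / 2)"
  have a: "0 < a" and z: "0 < z" unfolding a_def z_def using alpha by (auto intro!: normal_quantile_pos)
  have L: "0 < length_factor \<alpha>" using z unfolding z_def by (simp add: length_factor_def add_pos_pos)
  show "same_order (\<lambda>n. max_length (P n) (CI_adaptive (pair_modulus N T F n (\<alpha> / 2)) (S n)) (F j))
      (\<lambda>n. e2ennreal (between_modulus N T (normal_quantile (\<alpha> / 2) / sqrt (real n)) (F j) (F 1 \<union> F 2)))"
  proof (rule same_orderI)
    show "0 < length_factor \<alpha> * max 1 (z / a)" using L by simp
    show "0 < max 1 (a / detection_radius \<alpha>) / detection_gap \<alpha>"
      using detection_gap_pos[OF alpha(2)] by simp
    fix n :: nat assume n: "1 \<le> n"
    then have "admissible n" using adm by blast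
    then interpret adaptive_interval D "P n" N H n V T F \<alpha> "S n" by (rule loc[OF n])
    show "max_length (P n) (CI_adaptive (pair_modulus N T F n (\<alpha> / 2)) (S n)) (F j) \<le> ennreal (length_factor \<alpha> * max 1 (z / a)) *
        e2ennreal (between_modulus N T (normal_quantile (\<alpha> / 2) / sqrt (real n)) (F j) (F 1 \<union> F 2))"
      using adaptive_length_modulus(1)[OF j a]
      unfolding between_modulus_eq z_def a_def[symmetric] .
    show "e2ennreal (between_modulus N T (normal_quantile (\<alpha> / 2) / sqrt (real n)) (F j) (F 1 \<union> F 2)) \<le>
        ennreal (max 1 (a / detection_radius \<alpha>) / detection_gap \<alpha>) * max_length (P n) (CI_adaptive (pair_modulus N T F n (\<alpha> / 2)) (S n)) (F j)"
      using adaptive_length_modulus(2)[OF j a]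
      unfolding between_modulus_eq a_def[symmetric] .
  qed
qed

lemma adaptive_interval_white_noise:
  assumes alpha: "0 < \<alpha>" "\<alpha> < 1 / 2"
    and m: "wiener_measure W \<and> linear_functional_on V T \<and>
       (\<forall>i\<in>{1,2}. F i \<subseteq> V \<inter> L2_space \<and> convex (F i)) \<and> F 1 \<inter> F 2 \<noteq> {}"
    and n: "1 \<le> n"
    and adm: "\<forall>i\<in>{1,2}. \<forall>j\<in>{1,2}. white_noise_linear_estimator W n (S i j) \<and>
      balanced_estimator (white_noise W n) T F (\<alpha> / 2) (pair_modulus L2_norm T F n (\<alpha> / 2)) i j (S i j)"
  shows "adaptive_interval path_space (white_noise W n) L2_norm L2_space n V T F \<alpha> S"
proof (rule adaptive_interval.intro)
  have W: "wiener_measure W" using m by blast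
  show "shift_experiment path_space (white_noise W n) L2_norm L2_space n"
    by (rule shift_experiment_white_noise[OF W n])
  show "adaptive_interval_axioms path_space (white_noise W n) L2_norm L2_space n V T F \<alpha> S"
  proof (rule adaptive_interval_axioms.intro)
    show "0 \<le> L2_norm f" for f by (simp add: L2_norm_def)
  qed (use m adm alpha W white_noise_linear_estimatorD in blast)+
qed

lemma adaptive_interval_gaussian_sequence:
  assumes alpha: "0 < \<alpha>" "\<alpha> < 1 / 2"
    and m: "linear_functional_on V T \<and>
       (\<forall>i\<in>{1,2}. F i \<subseteq> V \<inter> l2_space M \<and> convex (F i)) \<and> F 1 \<inter> F 2 \<noteq> {}"
    and n: "1 \<le> n"
    and adm: "\<forall>i\<in>{1,2}. \<forall>j\<in>{1,2}. gaussian_sequence_linear_estimator M n (S i j) \<and>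
      balanced_estimator (gaussian_sequence M n) T F (\<alpha> / 2) (pair_modulus (l2_norm M) T F n (\<alpha> / 2)) i j (S i j)"
  shows "adaptive_interval (sequence_data_space M) (gaussian_sequence M n) (l2_norm M) (l2_space M) n V T F \<alpha> S"
proof (rule adaptive_interval.intro)
  show "shift_experiment (sequence_data_space M) (gaussian_sequence M n) (l2_norm M) (l2_space M) n"
    by (rule shift_experiment_gaussian_sequence[OF n])
  show "adaptive_interval_axioms (sequence_data_space M) (gaussian_sequence M n) (l2_norm M) (l2_space M) n V T F \<alpha> S"
  proof (rule adaptive_interval_axioms.intro)
    show "0 \<le> l2_norm M f" for f by (simp add: l2_norm_def infsum_nonneg)
  qed (use m adm alpha gaussian_sequence_linear_estimatorD in blast)+
qed

theorem proposition2:
  fixes \<alpha> :: real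
  assumes "0 < \<alpha>" and "\<alpha> < 1/2"
  shows "\<exists>C::real. 0 < C \<and>
    \<comment> \<open>white noise model\<close>
    (\<forall>W V T F That.
       wiener_measure W \<and> linear_functional_on V T \<and>
       (\<forall>i\<in>{1,2}. F i \<subseteq> V \<inter> L2_space \<and> convex (F i)) \<and> F 1 \<inter> F 2 \<noteq> {} \<longrightarrow>
       (let P = white_noise W;
            \<omega> = (\<lambda>n. pair_modulus L2_norm T F n (\<alpha> / 2));
            admissible = (\<lambda>n. \<forall>i\<in>{1,2}. \<forall>j\<in>{1,2}.
              white_noise_linear_estimator W n (That n i j) \<and>
              balanced_estimator (P n) T F (\<alpha> / 2) (\<omega> n) i j (That n i j));
            CI = (\<lambda>n. CI_adaptive (\<omega> n) (That n))
        in (\<forall>n\<ge>1. admissible n \<longrightarrow>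
              CI n \<in> confidence_intervals path_space (P n) T \<alpha> (F 1 \<union> F 2) \<and>
              (\<forall>j\<in>{1,2}.
                 min_max_length path_space (P n) T \<alpha> (F j) (F 1 \<union> F 2)
                   \<le> max_length (P n) (CI n) (F j) \<and>
                 max_length (P n) (CI n) (F j)
                   \<le> ennreal C * min_max_length path_space (P n) T \<alpha> (F j) (F 1 \<union> F 2))) \<and>
           ((\<forall>n\<ge>1. admissible n) \<longrightarrow>
              (\<forall>j\<in>{1,2}.
                 same_order
                   (\<lambda>n. max_length (P n) (CI n) (F j))
                   (\<lambda>n. e2ennreal (between_modulus L2_norm T
                           (normal_quantile (\<alpha> / 2) / sqrt (real n)) (F j) (F 1 \<union> F 2))))))) \<and>
    \<comment> \<open>Gaussian sequence model\<close>
    (\<forall>M V T F That.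
       linear_functional_on V T \<and>
       (\<forall>i\<in>{1,2}. F i \<subseteq> V \<inter> l2_space M \<and> convex (F i)) \<and> F 1 \<inter> F 2 \<noteq> {} \<longrightarrow>
       (let P = gaussian_sequence M;
            \<omega> = (\<lambda>n. pair_modulus (l2_norm M) T F n (\<alpha> / 2));
            admissible = (\<lambda>n. \<forall>i\<in>{1,2}. \<forall>j\<in>{1,2}.
              gaussian_sequence_linear_estimator M n (That n i j) \<and>
              balanced_estimator (P n) T F (\<alpha> / 2) (\<omega> n) i j (That n i j));
            CI = (\<lambda>n. CI_adaptive (\<omega> n) (That n))
        in (\<forall>n\<ge>1. admissible n \<longrightarrow>
              CI n \<in> confidence_intervals (sequence_data_space M) (P n) T \<alpha> (F 1 \<union> F 2) \<and>
              (\<forall>j\<in>{1,2}.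
                 min_max_length (sequence_data_space M) (P n) T \<alpha> (F j) (F 1 \<union> F 2)
                   \<le> max_length (P n) (CI n) (F j) \<and>
                 max_length (P n) (CI n) (F j)
                   \<le> ennreal C * min_max_length (sequence_data_space M) (P n) T \<alpha> (F j) (F 1 \<union> F 2))) \<and>
           ((\<forall>n\<ge>1. admissible n) \<longrightarrow>
              (\<forall>j\<in>{1,2}.
                 same_order
                   (\<lambda>n. max_length (P n) (CI n) (F j))
                   (\<lambda>n. e2ennreal (between_modulus (l2_norm M) T
                           (normal_quantile (\<alpha> / 2) / sqrt (real n)) (F j) (F 1 \<union> F 2)))))))"
proof (intro exI conjI allI impI)
  \<comment> \<open>The witness is built from \<alpha> alone and serves both models.\<close>
  show "0 < adaptation_constant \<alpha>" using assms by (rule adaptation_constant_pos)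
next
  fix W V and T :: "(real \<Rightarrow> real) \<Rightarrow> real" and F :: "nat \<Rightarrow> (real \<Rightarrow> real) set"
    and That :: "nat \<Rightarrow> nat \<Rightarrow> nat \<Rightarrow> (real \<Rightarrow> real) \<Rightarrow> real"
  assume m: "wiener_measure W \<and> linear_functional_on V T \<and>
       (\<forall>i\<in>{1,2}. F i \<subseteq> V \<inter> L2_space \<and> convex (F i)) \<and> F 1 \<inter> F 2 \<noteq> {}"
  show "let P = white_noise W;
            \<omega> = (\<lambda>n. pair_modulus L2_norm T F n (\<alpha> / 2));
            admissible = (\<lambda>n. \<forall>i\<in>{1,2}. \<forall>j\<in>{1,2}.
              white_noise_linear_estimator W n (That n i j) \<and>
              balanced_estimator (P n) T F (\<alpha> / 2) (\<omega> n) i j (That n i j));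
            CI = (\<lambda>n. CI_adaptive (\<omega> n) (That n))
        in (\<forall>n\<ge>1. admissible n \<longrightarrow>
              CI n \<in> confidence_intervals path_space (P n) T \<alpha> (F 1 \<union> F 2) \<and>
              (\<forall>j\<in>{1,2}.
                 min_max_length path_space (P n) T \<alpha> (F j) (F 1 \<union> F 2)
                   \<le> max_length (P n) (CI n) (F j) \<and>
                 max_length (P n) (CI n) (F j)
                   \<le> ennreal (adaptation_constant \<alpha>) * min_max_length path_space (P n) T \<alpha> (F j) (F 1 \<union> F 2))) \<and>
           ((\<forall>n\<ge>1. admissible n) \<longrightarrow>
              (\<forall>j\<in>{1,2}.
                 same_order
                   (\<lambda>n. max_length (P n) (CI n) (F j))
                   (\<lambda>n. e2ennreal (between_modulus L2_norm T
                           (normal_quantile (\<alpha> / 2) / sqrt (real n)) (F j) (F 1 \<union> F 2)))))"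
    unfolding Let_def
    by (rule adaptive_interval_conclusion[OF assms]) (rule adaptive_interval_white_noise[OF assms m])
next
  fix M V and T :: "(nat \<Rightarrow> real) \<Rightarrow> real" and F :: "nat \<Rightarrow> (nat \<Rightarrow> real) set"
    and That :: "nat \<Rightarrow> nat \<Rightarrow> nat \<Rightarrow> (nat \<Rightarrow> real) \<Rightarrow> real"
  assume m: "linear_functional_on V T \<and>
       (\<forall>i\<in>{1,2}. F i \<subseteq> V \<inter> l2_space M \<and> convex (F i)) \<and> F 1 \<inter> F 2 \<noteq> {}"
  show "let P = gaussian_sequence M;
            \<omega> = (\<lambda>n. pair_modulus (l2_norm M) T F n (\<alpha> / 2));
            admissible = (\<lambda>n. \<forall>i\<in>{1,2}. \<forall>j\<in>{1,2}.
              gaussian_sequence_linear_estimator M n (That n i j) \<and>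
              balanced_estimator (P n) T F (\<alpha> / 2) (\<omega> n) i j (That n i j));
            CI = (\<lambda>n. CI_adaptive (\<omega> n) (That n))
        in (\<forall>n\<ge>1. admissible n \<longrightarrow>
              CI n \<in> confidence_intervals (sequence_data_space M) (P n) T \<alpha> (F 1 \<union> F 2) \<and>
              (\<forall>j\<in>{1,2}.
                 min_max_length (sequence_data_space M) (P n) T \<alpha> (F j) (F 1 \<union> F 2)
                   \<le> max_length (P n) (CI n) (F j) \<and>
                 max_length (P n) (CI n) (F j)
                   \<le> ennreal (adaptation_constant \<alpha>) * min_max_length (sequence_data_space M) (P n) T \<alpha> (F j) (F 1 \<union> F 2))) \<and>
           ((\<forall>n\<ge>1. admissible n) \<longrightarrow>
              (\<forall>j\<in>{1,2}.
                 same_order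
                   (\<lambda>n. max_length (P n) (CI n) (F j))
                   (\<lambda>n. e2ennreal (between_modulus (l2_norm M) T
                           (normal_quantile (\<alpha> / 2) / sqrt (real n)) (F j) (F 1 \<union> F 2)))))"
    unfolding Let_def
    by (rule adaptive_interval_conclusion[OF assms]) (rule adaptive_interval_gaussian_sequence[OF assms m])
qed

end
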